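(* Let $1\le t\le n$, let $\Gamma_{n,t}$ be the $t$-path simplicial tree of the path graph $P_n$, and let $I_{n,t}=I(\Gamma_{n,t})$. Then for any integer $k$ with $1\le k+1\le\nu(\Gamma_{n,t})$, $$\operatorname{reg}\left(\frac{R}{I_{n,t}^{[k+1]}}\right)=kt+(t-1)\,\nu_1(\Gamma_{n-kt,t})=kt+\operatorname{reg}\left(\frac{R}{I_{n-kt,t}}\right).$$
   Context: $P_m$ is the path graph on vertices $1,\ldots,m$ with edges $\{i,i+1\}$. For $t\le m$, $\Gamma_{m,t}$ is the simplicial complex with facets $F_i=\{i,i+1,\ldots,i+t-1\}$ for $i=1,\ldots,m-t+1$. The $t$-path ideal $I_{m,t}=I(\Gamma_{m,t})$ is generated by the monomials $\prod_{j\in F_i}x_j$, $1\le i\le m-t+1$; for $m\le n$ it is viewed as an ideal of $R=K[x_1,\dots,x_n]$, $K$ a field (regularity of the quotient does not depend on extra variables). For a squarefree monomial ideal $I$, $I^{[k]}$ is the ideal generated by the squarefree monomials among the minimal monomial generators of $I^k$. A matching of a simplicial complex $\Delta$ is a set of pairwise disjoint facets; $\nu(\Delta)$ is the maximum size of a matching. A matching $M$ is an induced matching if the only facets of $\Delta$ contained in $\bigcup_{E\in M}E$ are those in $M$; $\nu_1(\Delta)$ is the maximum size of an induced matching. $\operatorname{reg}$ denotes Castelnuovo-Mumford regularity. *)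

theory Defs
  imports "HOL-Algebra.Ideal_Product" "HOL-Library.Poly_Mapping"
begin

section \<open>The polynomial ring in the variables indexed by 1..n\<close>

text \<open>
  A monomial is an exponent function of type \<open>nat \<Rightarrow>\<^sub>0 nat\<close>; a polynomial is a finitely supported
  family of coefficients indexed by monomials, and \<open>*\<close> on this type is the convolution product.
\<close>

type_synonym monom = "nat \<Rightarrow>\<^sub>0 nat"
type_synonym 'a mpoly = "monom \<Rightarrow>\<^sub>0 'a"

definition poly_ring :: "nat \<Rightarrow> 'a::field mpoly ring"
  where "poly_ring n =
    \<lparr> carrier = {p. \<forall>m\<in>Poly_Mapping.keys p. Poly_Mapping.keys m \<subseteq> {1..n}},
      monoid.mult = (*), one = 1, zero = 0, add = (+) \<rparr>"

definition monom_poly :: "monom \<Rightarrow> 'a::field mpoly"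
  where "monom_poly m = Poly_Mapping.single m 1"

definition X :: "nat \<Rightarrow> 'a::field mpoly"
  where "X j = monom_poly (Poly_Mapping.single j 1)"

definition total_degree :: "monom \<Rightarrow> nat"
  where "total_degree m = (\<Sum>j\<in>Poly_Mapping.keys m. Poly_Mapping.lookup m j)"

text \<open>The degree is an integer, so that for negative \<open>d\<close> only the zero polynomial qualifies.\<close>

definition homogeneous :: "int \<Rightarrow> 'a::field mpoly \<Rightarrow> bool"
  where "homogeneous d p \<longleftrightarrow> (\<forall>m\<in>Poly_Mapping.keys p. int (total_degree m) = d)"


section \<open>Squarefree powers of monomial ideals\<close>

definition monom_dvd :: "monom \<Rightarrow> monom \<Rightarrow> bool"
  where "monom_dvd m m' \<longleftrightarrow> (\<forall>j. Poly_Mapping.lookup m j \<le> Poly_Mapping.lookup m' j)"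

definition squarefree_monom :: "monom \<Rightarrow> bool"
  where "squarefree_monom m \<longleftrightarrow> (\<forall>j. Poly_Mapping.lookup m j \<le> 1)"

text \<open>
  The minimal monomial generators of a monomial ideal \<open>J\<close> are the monomials in \<open>J\<close> that are minimal
  with respect to divisibility.
\<close>

definition min_monom_gens :: "'a::field mpoly set \<Rightarrow> monom set"
  where "min_monom_gens J =
    {m. monom_poly m \<in> J \<and> (\<forall>m'. monom_poly m' \<in> J \<and> monom_dvd m' m \<longrightarrow> m' = m)}"

definition squarefree_power :: "nat \<Rightarrow> 'a::field mpoly set \<Rightarrow> nat \<Rightarrow> 'a mpoly set"
  where "squarefree_power n I k =
    Idl\<^bsub>poly_ring n\<^esub> (monom_poly `
      {m \<in> min_monom_gens (I [^]\<^bsub>ideals_set (poly_ring n)\<^esub> k). squarefree_monom m})"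


section \<open>Simplicial complexes and path ideals\<close>

text \<open>A simplicial complex is given by its set of faces.\<close>

definition facets :: "nat set set \<Rightarrow> nat set set"
  where "facets \<Delta> = {F \<in> \<Delta>. \<forall>G\<in>\<Delta>. F \<subseteq> G \<longrightarrow> G = F}"

definition facet_ideal :: "nat \<Rightarrow> nat set set \<Rightarrow> 'a::field mpoly set"
  where "facet_ideal n \<Delta> = Idl\<^bsub>poly_ring n\<^esub> {\<Prod>j\<in>F. X j | F. F \<in> facets \<Delta>}"

definition is_matching :: "nat set set \<Rightarrow> nat set set \<Rightarrow> bool"
  where "is_matching \<Delta> M \<longleftrightarrow> M \<subseteq> facets \<Delta> \<and> (\<forall>E\<in>M. \<forall>F\<in>M. E \<noteq> F \<longrightarrow> E \<inter> F = {})"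

definition is_induced_matching :: "nat set set \<Rightarrow> nat set set \<Rightarrow> bool"
  where "is_induced_matching \<Delta> M \<longleftrightarrow>
    is_matching \<Delta> M \<and> {F \<in> facets \<Delta>. F \<subseteq> \<Union>M} = M"

definition matching_number :: "nat set set \<Rightarrow> nat"  (\<open>\<nu>\<close>)
  where "\<nu> \<Delta> = Max {card M | M. is_matching \<Delta> M}"

definition induced_matching_number :: "nat set set \<Rightarrow> nat"  (\<open>\<nu>\<^sub>1\<close>)
  where "\<nu>\<^sub>1 \<Delta> = Max {card M | M. is_induced_matching \<Delta> M}"

text \<open>Only used for \<open>t \<le> m\<close>, where the subtraction does not truncate.\<close>

definition path_complex :: "nat \<Rightarrow> nat \<Rightarrow> nat set set"  (\<open>\<Gamma>\<close>)
  where "\<Gamma> m t = {A. \<exists>i\<in>{1..m - t + 1}. A \<subseteq> {i..i + t - 1}}"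

text \<open>The \<open>t\<close>-path ideal of the path on \<open>m\<close> vertices, as an ideal of the ring in \<open>n \<ge> m\<close> variables.\<close>

definition path_ideal :: "nat \<Rightarrow> nat \<Rightarrow> nat \<Rightarrow> 'a::field mpoly set"
  where "path_ideal n m t = facet_ideal n (\<Gamma> m t)"


section \<open>Minimal graded free resolutions and regularity\<close>

text \<open>
  With \<open>R = poly_ring n\<close>, vectors in \<open>R\<^sup>r\<close> are functions on \<open>{..<r}\<close> (extensional, so that equality of
  vectors is equality of functions). A matrix \<open>A\<close> with \<open>r\<close> rows and \<open>c\<close> columns has entries \<open>A a b\<close>
  for \<open>a < r\<close>, \<open>b < c\<close>; entries outside this range are irrelevant.
\<close>

definition free_module :: "nat \<Rightarrow> nat \<Rightarrow> (nat \<Rightarrow> 'a::field mpoly) set"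
  where "free_module n r = {..<r} \<rightarrow>\<^sub>E carrier (poly_ring n)"

definition mat_apply ::
    "nat \<Rightarrow> nat \<Rightarrow> (nat \<Rightarrow> nat \<Rightarrow> 'a::field mpoly) \<Rightarrow> (nat \<Rightarrow> 'a mpoly) \<Rightarrow> nat \<Rightarrow> 'a mpoly"
  where "mat_apply r c A v = (\<lambda>a\<in>{..<r}. \<Sum>b<c. A a b * v b)"

text \<open>
  The record describes a sequence of graded free modules and maps
  \<open>\<dots> \<rightarrow> F\<^sub>2 \<rightarrow> F\<^sub>1 \<rightarrow> F\<^sub>0 \<rightarrow> R/I\<close>: \<open>F\<^sub>i\<close> has \<open>rnk i\<close> basis elements, the \<open>b\<close>-th of which has degree
  \<open>shift i b\<close> (that is, \<open>F\<^sub>i\<close> is the direct sum of the \<open>R(- shift i b)\<close>); \<open>diff i\<close> is the matrix of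
  \<open>F\<^bsub>i+1\<^esub> \<rightarrow> F\<^sub>i\<close>; and \<open>aug b\<close> represents in \<open>R\<close> the image in \<open>R/I\<close> of the \<open>b\<close>-th basis element
  of \<open>F\<^sub>0\<close>.
\<close>

record 'p free_complex =
  rnk :: "nat \<Rightarrow> nat"
  shift :: "nat \<Rightarrow> nat \<Rightarrow> int"
  aug :: "nat \<Rightarrow> 'p"
  diff :: "nat \<Rightarrow> nat \<Rightarrow> nat \<Rightarrow> 'p"

text \<open>
  The first two conditions say that the maps are homogeneous of degree 0; the others say that the
  sequence is exact at \<open>R/I\<close>, at \<open>F\<^sub>0\<close> and at \<open>F\<^bsub>i+1\<^esub>\<close>.
\<close>

definition graded_free_resolution :: "nat \<Rightarrow> 'a::field mpoly set \<Rightarrow> 'a mpoly free_complex \<Rightarrow> bool"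
  where "graded_free_resolution n I F \<longleftrightarrow>
    (\<forall>b<rnk F 0. aug F b \<in> carrier (poly_ring n) \<and> homogeneous (shift F 0 b) (aug F b)) \<and>
    (\<forall>i. \<forall>a<rnk F i. \<forall>b<rnk F (i + 1).
       diff F i a b \<in> carrier (poly_ring n) \<and>
       homogeneous (shift F (i + 1) b - shift F i a) (diff F i a b)) \<and>
    (\<forall>p\<in>carrier (poly_ring n). \<exists>v\<in>free_module n (rnk F 0).
       p - (\<Sum>b<rnk F 0. aug F b * v b) \<in> I) \<and>
    mat_apply (rnk F 0) (rnk F 1) (diff F 0) ` free_module n (rnk F 1) =
      {v \<in> free_module n (rnk F 0). (\<Sum>b<rnk F 0. aug F b * v b) \<in> I} \<and>
    (\<forall>i. mat_apply (rnk F (i + 1)) (rnk F (i + 2)) (diff F (i + 1)) ` free_module n (rnk F (i + 2)) =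
      {v \<in> free_module n (rnk F (i + 1)).
         mat_apply (rnk F i) (rnk F (i + 1)) (diff F i) v = (\<lambda>a\<in>{..<rnk F i}. 0)})"

text \<open>
  Minimality: every differential maps \<open>F\<^bsub>i+1\<^esub>\<close> into \<open>\<mm> F\<^sub>i\<close>, where \<open>\<mm>\<close> is generated by the variables,
  that is, the matrix entries have constant term 0.
\<close>

definition minimal_graded_free_resolution ::
    "nat \<Rightarrow> 'a::field mpoly set \<Rightarrow> 'a mpoly free_complex \<Rightarrow> bool"
  where "minimal_graded_free_resolution n I F \<longleftrightarrow>
    graded_free_resolution n I F \<and>
    (\<forall>i. \<forall>a<rnk F i. \<forall>b<rnk F (i + 1). Poly_Mapping.lookup (diff F i a b) 0 = 0)"

text \<open>
  The graded Betti number \<open>\<beta>\<^bsub>i,j\<^esub>(R/I)\<close> for a homogeneous ideal \<open>I\<close>: the number of basis elements of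
  degree \<open>j\<close> in the \<open>i\<close>-th module of a minimal graded free resolution of \<open>R/I\<close>. Such a resolution
  exists and is unique up to isomorphism of graded complexes, so the choice is immaterial.
\<close>

definition graded_betti :: "nat \<Rightarrow> 'a::field mpoly set \<Rightarrow> nat \<Rightarrow> int \<Rightarrow> nat"
  where "graded_betti n I i j =
    (let F = (SOME F. minimal_graded_free_resolution n I F) in card {b. b < rnk F i \<and> shift F i b = j})"

text \<open>
  The Castelnuovo-Mumford regularity of \<open>R/I\<close>, for a proper homogeneous ideal \<open>I\<close> (for \<open>I = R\<close> the set
  is empty and the value is unspecified).
\<close>

definition reg_quot :: "nat \<Rightarrow> 'a::field mpoly set \<Rightarrow> int"
  where "reg_quot n I = Max {j - int i | i j. graded_betti n I i j \<noteq> 0}"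

end

(*
  Koszul homology H_i(x; R/J) detects the graded Betti numbers: chasing through
  0 -> Z_{i+1} -> F_i -> Z_i -> 0 with the acyclicity of the Koszul complex of a free module identifies
  H_p(Z_{i+1}) with H_{p+1}(Z_i), and minimality identifies the generators of F_i with H_0(Z_i).
  The same chase bounds the degrees of the generators of each syzygy module, so a minimal resolution
  exists without appeal to noetherianity.

  Let J(m,k) be the ideal whose squarefree monomials contain k disjoint intervals of length t inside
  [1..m].  Upper bound, by Mayer-Vietoris and induction on m:
    J(m,k) = J(m-1,k) + M J(m-t,k-1)  with  M = x_{m-t+1} ... x_m,
  and the intersection of the two summands is M (x_{m-t} J(m-t-1,k-1) + J(m-t-1,k)).
  Lower bound: the join of the boundaries of the simplices on
    A_0 = [1..(k+1)t]  and  A_j = [kt+j(t+1)+1..kt+j(t+1)+t],  0 < j < nu_1,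
  is a sphere in the Stanley-Reisner complex of J(n,k+1) with a face that is maximal among the faces
  contained in the union W of the A_j, hence a nonzero Koszul class in multidegree W.
*)
theory Submission
  imports Defs "HOL.Vector_Spaces" "HOL-Library.Function_Algebras"
begin

section \<open>Polynomials\<close>

text \<open>The regularity is read off a minimal resolution picked by \<open>SOME\<close>, so
  nothing can be computed before such a resolution is known to exist and its generator degrees are
  known to be independent of the choice. Koszul homology settles both, and since the regularity is a
  maximum, only vanishing matters, never dimensions. Modules are kept inside an ambient module, with
  cycles and boundaries taken modulo a submodule, so R/J and all syzygy modules fall under the same
  lemmas. The constants are forced by two counts. Mayer-Vietoris allows the intersection a bound one
  higher than the sum, and the factor M raises a bound by t; hence the cofactor of M must satisfy
  the bound lowered by t - 1, which is what one block of t + 1 vertices is worth. On the other side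
  W has kt + tv points, and a facet of the sphere misses one point of each of the v blocks, so its
  class has Koszul index v and contributes kt + (t-1)v. The two counts meet for v the largest number
  of blocks that fit. The block A_0 is longer because it also absorbs the kt points occupied by the
  other k intervals.\<close>

abbreviation lookup :: "('b \<Rightarrow>\<^sub>0 'c::zero) \<Rightarrow> 'b \<Rightarrow> 'c" where "lookup \<equiv> Poly_Mapping.lookup"
abbreviation keys :: "('b \<Rightarrow>\<^sub>0 'c::zero) \<Rightarrow> 'b set" where "keys \<equiv> Poly_Mapping.keys"
abbreviation polys :: "nat \<Rightarrow> 'a::field mpoly set" where "polys n \<equiv> carrier (poly_ring n)"
abbreviation single :: "'b \<Rightarrow> 'c \<Rightarrow> ('b \<Rightarrow>\<^sub>0 'c::zero)" where "single \<equiv> Poly_Mapping.single"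
abbreviation xv :: "nat \<Rightarrow> monom" where "xv s \<equiv> single s (Suc 0)"

lemma keys_plus_nat: "keys (a + b :: monom) = keys a \<union> keys b"
  by (auto simp: in_keys_iff lookup_add)

lemma total_degree_superset:
  assumes "finite A" "keys m \<subseteq> A"
  shows "total_degree m = (\<Sum>j\<in>A. lookup m j)"
  unfolding total_degree_def using assms by (intro sum.mono_neutral_left) (auto simp: in_keys_iff)

lemma total_degree_add: "total_degree (a + b) = total_degree a + total_degree b"
proof -
  have "total_degree (a+b) = (\<Sum>j\<in>keys a \<union> keys b. lookup (a+b) j)"
    by (rule total_degree_superset) (auto simp: keys_plus_nat)
  also have "\<dots> = total_degree a + total_degree b"
    by (simp add: lookup_add sum.distrib total_degree_superset[of "keys a \<union> keys b"])
  finally show ?thesis .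
qed

lemma total_degree_xv [simp]: "total_degree (xv s) = 1"
  by (simp add: total_degree_def)

lemma total_degree_zero [simp]: "total_degree 0 = 0"
  by (simp add: total_degree_def)

lemma total_degree_eq_0_iff: "total_degree m = 0 \<longleftrightarrow> m = 0"
  by (auto simp: total_degree_def in_keys_iff intro!: poly_mapping_eqI)

lemma minus_xv_plus: "s \<in> keys m \<Longrightarrow> (m - xv s) + xv s = m"
  by (rule poly_mapping_eqI) (auto simp: lookup_add lookup_minus lookup_single when_def in_keys_iff)

lemma lookup_single_times_add:
  fixes p :: "'a::field mpoly"
  shows "lookup (single a c * p) (a + m) = c * lookup p m"
  by (simp add: lookup_mult lookup_single when_mult)

lemma keys_single_times:
  fixes p :: "'a::field mpoly"
  shows "keys (single a c * p) \<subseteq> (\<lambda>m. a + m) ` keys p"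
  using keys_mult[of "single a c" p] by (auto split: if_splits)

lemma lookup_X_times:
  fixes p :: "'a::field mpoly"
  shows "lookup (X u * p) m = (if u \<in> keys m then lookup p (m - xv u) else 0)"
proof (cases "u \<in> keys m")
  case True
  then show ?thesis
    using lookup_single_times_add[of "xv u" 1 p "m - xv u"] minus_xv_plus[OF True]
    by (simp add: X_def monom_poly_def add.commute)
next
  case False
  have "m \<notin> keys (X u * p)"
  proof
    assume "m \<in> keys (X u * p)"
    then obtain m' where "m = xv u + m'"
      using keys_single_times[of "xv u" 1 p] by (auto simp: X_def monom_poly_def)
    with False show False by (simp add: keys_plus_nat)
  qed
  with False show ?thesis by (simp add: in_keys_iff)
qed

text \<open>Division by \<open>X s\<close> that drops the monomials not divisible by it; a left
  inverse of multiplication by \<open>X s\<close>.\<close>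

definition quo :: "nat \<Rightarrow> 'a::field mpoly \<Rightarrow> 'a mpoly"
  where "quo s p = Poly_Mapping.map_key (\<lambda>m. m + xv s) p"

lemma lookup_quo: "lookup (quo s p) m = lookup p (m + xv s)"
  unfolding quo_def by (subst map_key.rep_eq) (auto simp: inj_def)

definition restr :: "(monom \<Rightarrow> bool) \<Rightarrow> 'a::field mpoly \<Rightarrow> 'a mpoly"
  where "restr P p = Poly_Mapping.mapp (\<lambda>m c. if P m then c else 0) p"

lemma lookup_restr: "lookup (restr P p) m = (if P m then lookup p m else 0)"
  by (auto simp: restr_def lookup_mapp in_keys_iff when_def)

lemma keys_restr: "keys (restr P p) = {m \<in> keys p. P m}"
  by (auto simp: in_keys_iff lookup_restr split: if_splits)

lemma keys_quo: "m \<in> keys (quo s p) \<longleftrightarrow> m + xv s \<in> keys p"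
  by (auto simp: in_keys_iff lookup_quo)

lemma restr_minus: "restr P (p - q) = restr P p - restr P q"
  by (rule poly_mapping_eqI) (simp add: lookup_restr lookup_minus)

lemma restr_zero [simp]: "restr P 0 = 0"
  by (rule poly_mapping_eqI) (simp add: lookup_restr)

lemma restr_sum: "restr P (sum f A) = (\<Sum>a\<in>A. restr P (f a))"
  by (rule poly_mapping_eqI) (simp add: lookup_restr lookup_sum)

lemma quo_minus: "quo s (p - q) = quo s p - quo s q"
  by (rule poly_mapping_eqI) (simp add: lookup_quo lookup_minus)

lemma quo_zero [simp]: "quo s 0 = 0"
  by (rule poly_mapping_eqI) (simp add: lookup_quo)

lemma quo_sum: "quo s (sum f A) = (\<Sum>a\<in>A. quo s (f a))"
  by (rule poly_mapping_eqI) (simp add: lookup_quo lookup_sum)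

lemma quo_X_times [simp]: "quo s (X s * p) = p"
  by (rule poly_mapping_eqI) (simp add: lookup_quo lookup_X_times keys_plus_nat)

lemma X_times_quo: "X s * quo s p = restr (\<lambda>m. s \<in> keys m) p"
  by (rule poly_mapping_eqI) (simp add: lookup_quo lookup_X_times lookup_restr minus_xv_plus)

lemma X_times_cancel: "X s * p = X s * q \<longleftrightarrow> p = q"
  by (metis quo_X_times)

lemma keys_X_times: "m \<in> keys (X s * p) \<longleftrightarrow> (\<exists>m'\<in>keys p. m = m' + xv s)"
proof
  assume "m \<in> keys (X s * p)"
  then have "s \<in> keys m" "m - xv s \<in> keys p"
    by (auto simp: in_keys_iff lookup_X_times split: if_splits)
  then show "\<exists>m'\<in>keys p. m = m' + xv s"
    using minus_xv_plus by force
qed (auto simp: in_keys_iff lookup_X_times lookup_add split: if_splits)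

lemma polys_iff: "p \<in> polys n \<longleftrightarrow> (\<forall>m\<in>keys p. keys m \<subseteq> {1..n})"
  by (simp add: poly_ring_def)

lemma polys_zero [simp]: "0 \<in> polys n" and polys_one [simp]: "1 \<in> polys n"
  by (auto simp: polys_iff)

lemma polys_add [intro]: "p \<in> polys n \<Longrightarrow> q \<in> polys n \<Longrightarrow> p + q \<in> polys n"
  using keys_add[of p q] by (auto simp: polys_iff)

lemma polys_uminus [intro]: "p \<in> polys n \<Longrightarrow> - p \<in> polys n"
  by (auto simp: polys_iff in_keys_iff)

lemma polys_minus [intro]: "p \<in> polys n \<Longrightarrow> q \<in> polys n \<Longrightarrow> p - q \<in> polys n"
  using polys_add[of p n "- q"] by auto

lemma polys_mult [intro]: "p \<in> polys n \<Longrightarrow> q \<in> polys n \<Longrightarrow> p * q \<in> polys n"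
  using keys_mult[of p q] by (fastforce simp: polys_iff keys_plus_nat)

lemma polys_X [intro]: "s \<in> {1..n} \<Longrightarrow> X s \<in> polys n"
  by (auto simp: polys_iff X_def monom_poly_def)

lemma polys_sum [intro]: "(\<And>a. a \<in> A \<Longrightarrow> f a \<in> polys n) \<Longrightarrow> sum f A \<in> polys n"
  by (induction A rule: infinite_finite_induct) auto

lemma polys_restr [intro]: "p \<in> polys n \<Longrightarrow> restr P p \<in> polys n"
  by (auto simp: polys_iff keys_restr)

lemma polys_quo [intro]: "p \<in> polys n \<Longrightarrow> quo s p \<in> polys n"
  by (fastforce simp: polys_iff keys_quo keys_plus_nat)

lemma poly_ring_simps [simp]:
  "mult (poly_ring n) = (*)" "one (poly_ring n) = 1" "zero (poly_ring n) = 0" "add (poly_ring n) = (+)"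
  by (simp_all add: poly_ring_def)

lemma cring_poly_ring: "cring (poly_ring n :: 'a::field mpoly ring)"
proof (rule cringI)
  show "abelian_group (poly_ring n :: 'a mpoly ring)"
  proof (rule abelian_groupI)
    fix p :: "'a mpoly" assume "p \<in> polys n"
    then show "\<exists>q\<in>polys n. q \<oplus>\<^bsub>poly_ring n\<^esub> p = \<zero>\<^bsub>poly_ring n\<^esub>"
      by (intro bexI[of _ "- p"]) auto
  qed (auto simp: add.assoc add.commute)
  show "comm_monoid (poly_ring n :: 'a mpoly ring)"
    by (rule comm_monoidI) (auto simp: mult.assoc mult.commute)
qed (auto simp: distrib_right)

lemma homogeneous_zero [simp]: "homogeneous d 0"
  by (simp add: homogeneous_def)

lemma homogeneous_add: "homogeneous d p \<Longrightarrow> homogeneous d q \<Longrightarrow> homogeneous d (p + q)"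
  using keys_add[of p q] by (auto simp: homogeneous_def)

lemma homogeneous_uminus: "homogeneous d p \<Longrightarrow> homogeneous d (- p)"
  by (auto simp: homogeneous_def in_keys_iff)

lemma homogeneous_minus: "homogeneous d p \<Longrightarrow> homogeneous d q \<Longrightarrow> homogeneous d (p - q)"
  using homogeneous_add[of d p "- q"] homogeneous_uminus by auto

lemma homogeneous_mult: "homogeneous d p \<Longrightarrow> homogeneous e q \<Longrightarrow> homogeneous (d + e) (p * q)"
  using keys_mult[of p q] by (fastforce simp: homogeneous_def total_degree_add)

lemma homogeneous_X: "homogeneous 1 (X s)"
  by (simp add: homogeneous_def X_def monom_poly_def)

lemma homogeneous_restr: "homogeneous d p \<Longrightarrow> homogeneous d (restr P p)"
  by (auto simp: homogeneous_def keys_restr)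

lemma homogeneous_quo:
  assumes "homogeneous d p" shows "homogeneous (d - 1) (quo s p)"
proof -
  have "int (total_degree m) = d - 1" if "m + xv s \<in> keys p" for m
    using assms that total_degree_add[of m "xv s"] by (fastforce simp: homogeneous_def)
  then show ?thesis by (simp add: homogeneous_def keys_quo)
qed

lemma homogeneous_neg: "homogeneous d p \<Longrightarrow> d < 0 \<Longrightarrow> p = 0"
  by (rule ccontr) (force simp: homogeneous_def simp flip: keys_eq_empty)

section \<open>Homogeneous parts of the polynomial ring\<close>

definition hpoly :: "nat \<Rightarrow> int \<Rightarrow> 'a::field mpoly set"
  where "hpoly n d = {p \<in> polys n. homogeneous d p}"

lemma hpoly_closed [intro]:
  "0 \<in> hpoly n d"
  "p \<in> hpoly n d \<Longrightarrow> q \<in> hpoly n d \<Longrightarrow> p + q \<in> hpoly n d"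
  "p \<in> hpoly n d \<Longrightarrow> q \<in> hpoly n d \<Longrightarrow> p - q \<in> hpoly n d"
  "p \<in> hpoly n d \<Longrightarrow> - p \<in> hpoly n d"
  "p \<in> hpoly n d \<Longrightarrow> restr P p \<in> hpoly n d"
  by (auto simp: hpoly_def homogeneous_add homogeneous_minus homogeneous_uminus homogeneous_restr)

lemma hpoly_mult: "p \<in> hpoly n d \<Longrightarrow> q \<in> hpoly n e \<Longrightarrow> p * q \<in> hpoly n (d + e)"
  by (auto simp: hpoly_def homogeneous_mult)

lemma hpoly_X_times: "s \<in> {1..n} \<Longrightarrow> p \<in> hpoly n d \<Longrightarrow> X s * p \<in> hpoly n (d + 1)"
  using hpoly_mult[of "X s" n 1 p d] by (simp add: hpoly_def homogeneous_X polys_X add.commute)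

lemma hpoly_quo: "p \<in> hpoly n d \<Longrightarrow> quo s p \<in> hpoly n (d - 1)"
  by (auto simp: hpoly_def homogeneous_quo)

lemma hpoly_sum: "(\<And>a. a \<in> A \<Longrightarrow> f a \<in> hpoly n d) \<Longrightarrow> sum f A \<in> hpoly n d"
  by (induction A rule: infinite_finite_induct) auto

definition hcomp :: "int \<Rightarrow> 'a::field mpoly \<Rightarrow> 'a mpoly"
  where "hcomp d p = restr (\<lambda>m. int (total_degree m) = d) p"

lemma homogeneous_hcomp [simp]: "homogeneous d (hcomp d p)"
  by (simp add: homogeneous_def hcomp_def keys_restr)

lemma hcomp_in_hpoly: "p \<in> polys n \<Longrightarrow> hcomp d p \<in> hpoly n d"
  by (auto simp: hpoly_def) (auto simp: hcomp_def)

lemma hcomp_homogeneous: "homogeneous e p \<Longrightarrow> hcomp d p = (if d = e then p else 0)"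
  by (rule poly_mapping_eqI) (auto simp: hcomp_def lookup_restr homogeneous_def in_keys_iff)

lemma hcomp_sum: "hcomp d (sum f A) = (\<Sum>a\<in>A. hcomp d (f a))"
  by (simp add: hcomp_def restr_sum)

lemma sum_hcomp: "(\<Sum>e\<in>(\<lambda>m. int (total_degree m)) ` keys p. hcomp e p) = p"
proof (rule poly_mapping_eqI)
  fix m
  show "lookup (\<Sum>e\<in>(\<lambda>m. int (total_degree m)) ` keys p. hcomp e p) m = lookup p m"
    by (auto simp: lookup_sum hcomp_def lookup_restr in_keys_iff image_iff)
qed

lemma hcomp_mult:
  assumes "homogeneous e a"
  shows "hcomp d (a * v) = a * hcomp (d - e) v"
proof -
  let ?E = "(\<lambda>m. int (total_degree m)) ` keys v"
  have "hcomp d (a * v) = hcomp d (a * (\<Sum>f\<in>?E. hcomp f v))"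
    by (simp only: sum_hcomp)
  also have "\<dots> = (\<Sum>f\<in>?E. hcomp d (a * hcomp f v))"
    by (simp add: sum_distrib_left hcomp_sum)
  also have "\<dots> = (\<Sum>f\<in>?E. if f = d - e then a * hcomp f v else 0)"
    by (intro sum.cong refl) (auto simp: hcomp_homogeneous[OF homogeneous_mult[OF assms homogeneous_hcomp]])
  also have "\<dots> = a * hcomp (d - e) v"
  proof (cases "d - e \<in> ?E")
    case False
    then have "hcomp (d - e) v = 0"
      by (force intro!: poly_mapping_eqI simp: hcomp_def lookup_restr in_keys_iff image_iff)
    with False show ?thesis by simp
  qed simp
  finally show ?thesis .
qed

section \<open>Koszul homology of a subquotient\<close>

text \<open>The Koszul differential, written from the side of its target: \<open>c S\<close> is the
  coefficient of the exterior basis element of \<open>S\<close>, and the coefficient at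
  \<open>T\<close> collects one term for each index added to \<open>T\<close>. The action
  \<open>sc\<close> is a parameter so that polynomials and vectors share the definition.\<close>

definition bd :: "nat \<Rightarrow> ('a::field mpoly \<Rightarrow> 'w::ab_group_add \<Rightarrow> 'w) \<Rightarrow> (nat set \<Rightarrow> 'w) \<Rightarrow> nat set \<Rightarrow> 'w"
  where "bd n sc c T = (\<Sum>u\<in>{1..n} - T. sc ((- 1) ^ card {t \<in> T. t < u} * X u) (c (insert u T)))"

text \<open>The coefficient at a set with \<open>p\<close> elements lies in degree
  \<open>j - p\<close>, so \<open>j\<close> is the total degree of the chain. Zero values at all
  other sets make a chain determined by its proper coefficients.\<close>

definition chain :: "nat \<Rightarrow> (int \<Rightarrow> 'w::ab_group_add set) \<Rightarrow> nat \<Rightarrow> int \<Rightarrow> (nat set \<Rightarrow> 'w) set"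
  where "chain n A p j =
    {c. \<forall>S. if S \<subseteq> {1..n} \<and> card S = p then c S \<in> A (j - int p) else c S = 0}"

text \<open>Vanishing in degree \<open>j\<close> of the \<open>p\<close>-th Koszul homology of
  \<open>A\<close> modulo \<open>N\<close>, phrased with representatives so that no quotient has to
  be formed. For \<open>p = 0\<close> the cycle condition is vacuous.\<close>

definition acyc ::
    "nat \<Rightarrow> ('a::field mpoly \<Rightarrow> 'w::ab_group_add \<Rightarrow> 'w) \<Rightarrow> (int \<Rightarrow> 'w set) \<Rightarrow> 'w set \<Rightarrow> nat \<Rightarrow> int \<Rightarrow> bool"
  where "acyc n sc A N p j \<longleftrightarrow>
    (\<forall>c\<in>chain n A p j. (\<forall>S. bd n sc c S \<in> N) \<longrightarrow>
       (\<exists>f\<in>chain n A (Suc p) j. \<forall>S. c S - bd n sc f S \<in> N))"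

abbreviation hbd :: "nat \<Rightarrow> (nat set \<Rightarrow> 'a::field mpoly) \<Rightarrow> nat set \<Rightarrow> 'a mpoly"
  where "hbd n \<equiv> bd n (*)"

abbreviation hchain :: "nat \<Rightarrow> nat \<Rightarrow> int \<Rightarrow> (nat set \<Rightarrow> 'a::field mpoly) set"
  where "hchain n \<equiv> chain n (hpoly n)"

abbreviation hacyc :: "nat \<Rightarrow> 'a::field mpoly set \<Rightarrow> nat \<Rightarrow> int \<Rightarrow> bool"
  where "hacyc n \<equiv> acyc n (*) (hpoly n)"

lemma card_less_insert:
  fixes u w :: nat
  assumes "w \<notin> T" "finite T"
  shows "card {t \<in> insert w T. t < u} = card {t \<in> T. t < u} + (if w < u then 1 else 0)"
proof -
  have "{t \<in> insert w T. t < u} = (if w < u then insert w {t \<in> T. t < u} else {t \<in> T. t < u})"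
    by auto
  then show ?thesis using assms by simp
qed

lemma card_0_subset: "S \<subseteq> {1..n::nat} \<and> card S = 0 \<longleftrightarrow> S = {}"
  using finite_subset[of S "{1..n}"] by auto

text \<open>Each unordered pair occurs twice with opposite signs. Cancelling the terms in this way
  gives \<open>bd_bd\<close> in every characteristic.\<close>

lemma sum_antisymmetric_pairs:
  fixes g :: "nat \<Rightarrow> nat \<Rightarrow> 'w::ab_group_add"
  assumes "finite E" and anti: "\<And>u w. u \<in> E \<Longrightarrow> w \<in> E \<Longrightarrow> u < w \<Longrightarrow> g u w = - g w u"
  shows "(\<Sum>u\<in>E. \<Sum>w\<in>E - {u}. g u w) = 0"
proof -
  have "(\<Sum>u\<in>E. \<Sum>w\<in>E - {u}. g u w) = (\<Sum>u\<in>E. (\<Sum>w\<in>{w\<in>E. u < w}. g u w) + (\<Sum>w\<in>{w\<in>E. w < u}. g u w))"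
  proof (intro sum.cong refl)
    fix u assume "u \<in> E"
    have "E - {u} = {w\<in>E. u < w} \<union> {w\<in>E. w < u}" by auto
    then show "(\<Sum>w\<in>E - {u}. g u w) = (\<Sum>w\<in>{w\<in>E. u < w}. g u w) + (\<Sum>w\<in>{w\<in>E. w < u}. g u w)"
      using \<open>finite E\<close> by (simp add: sum.union_disjoint disjoint_iff)
  qed
  also have "\<dots> = (\<Sum>u\<in>E. \<Sum>w\<in>{w\<in>E. u < w}. g u w) + (\<Sum>u\<in>E. \<Sum>w\<in>{w\<in>E. w < u}. g u w)"
    by (rule sum.distrib)
  also have "(\<Sum>u\<in>E. \<Sum>w\<in>{w\<in>E. w < u}. g u w) = (\<Sum>w\<in>E. \<Sum>u\<in>{u\<in>E. w < u}. g u w)"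
    using \<open>finite E\<close> by (rule sum.swap_restrict[OF _ \<open>finite E\<close>])
  also have "\<dots> = (\<Sum>w\<in>E. \<Sum>u\<in>{u\<in>E. w < u}. - g w u)"
    by (intro sum.cong refl) (simp add: anti)
  also have "\<dots> = - (\<Sum>u\<in>E. \<Sum>w\<in>{w\<in>E. u < w}. g u w)"
    by (simp add: sum_negf)
  finally show ?thesis by simp
qed

lemma chainI:
  assumes "\<And>S. S \<subseteq> {1..n} \<Longrightarrow> card S = p \<Longrightarrow> c S \<in> A (j - int p)"
    and "\<And>S. \<not> (S \<subseteq> {1..n} \<and> card S = p) \<Longrightarrow> c S = 0"
  shows "c \<in> chain n A p j"
  using assms by (auto simp: chain_def)

lemma chainD1: "c \<in> chain n A p j \<Longrightarrow> S \<subseteq> {1..n} \<Longrightarrow> card S = p \<Longrightarrow> c S \<in> A (j - int p)"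
  by (auto simp: chain_def)

lemma chainD0: "c \<in> chain n A p j \<Longrightarrow> \<not> (S \<subseteq> {1..n} \<and> card S = p) \<Longrightarrow> c S = 0"
  unfolding chain_def by (auto split: if_splits)

text \<open>\<open>A d\<close> is the degree \<open>d\<close> part of a graded module and \<open>N\<close> a submodule; together they represent the
  quotient of the module by \<open>N\<close>.\<close>

locale gmod = module sc for sc :: "'a::field mpoly \<Rightarrow> 'w::ab_group_add \<Rightarrow> 'w" +
  fixes n :: nat and A :: "int \<Rightarrow> 'w set" and N :: "'w set"
  assumes A_zero: "0 \<in> A d"
    and A_minus: "x \<in> A d \<Longrightarrow> y \<in> A d \<Longrightarrow> x - y \<in> A d"
    and A_X: "u \<in> {1..n} \<Longrightarrow> x \<in> A d \<Longrightarrow> sc (X u) x \<in> A (d + 1)"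
    and N_zero: "0 \<in> N"
    and N_minus: "x \<in> N \<Longrightarrow> y \<in> N \<Longrightarrow> x - y \<in> N"
    and N_X: "u \<in> {1..n} \<Longrightarrow> x \<in> N \<Longrightarrow> sc (X u) x \<in> N"
begin

lemma A_uminus: "x \<in> A d \<Longrightarrow> - x \<in> A d"
  using A_minus[OF A_zero, of x] by simp

lemma A_add: "x \<in> A d \<Longrightarrow> y \<in> A d \<Longrightarrow> x + y \<in> A d"
  using A_minus[of x d "- y"] A_uminus by simp

lemma N_uminus: "x \<in> N \<Longrightarrow> - x \<in> N"
  using N_minus[OF N_zero, of x] by simp

lemma N_add: "x \<in> N \<Longrightarrow> y \<in> N \<Longrightarrow> x + y \<in> N"
  using N_minus[of x "- y"] N_uminus by simp

lemma A_sum: "(\<And>a. a \<in> I \<Longrightarrow> f a \<in> A d) \<Longrightarrow> sum f I \<in> A d"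
  by (induction I rule: infinite_finite_induct) (auto intro: A_zero A_add)

lemma N_sum: "(\<And>a. a \<in> I \<Longrightarrow> f a \<in> N) \<Longrightarrow> sum f I \<in> N"
  by (induction I rule: infinite_finite_induct) (auto intro: N_zero N_add)

lemma scale_sign: "sc ((- 1) ^ k * p) x = (if even k then sc p x else - sc p x)"
  by (cases "even k") simp_all

lemma bd_N: "(\<And>S. c S \<in> N) \<Longrightarrow> bd n sc c T \<in> N"
  unfolding bd_def by (intro N_sum) (auto simp: scale_sign intro!: N_X N_uminus simp del: minus_mult_left)

lemma bd_chain:
  assumes "c \<in> chain n A (Suc p) j"
  shows "bd n sc c \<in> chain n A p j"
proof (rule chainI)
  fix S assume S: "S \<subseteq> {1..n}" "card S = p"
  show "bd n sc c S \<in> A (j - int p)"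
    unfolding bd_def
  proof (rule A_sum)
    fix u assume u: "u \<in> {1..n} - S"
    have "finite S" using S(1) finite_subset by blast
    then have "c (insert u S) \<in> A (j - int (Suc p))"
      using S u by (intro chainD1[OF assms]) auto
    then have "sc (X u) (c (insert u S)) \<in> A (j - int p)"
      using A_X[of u "c (insert u S)" "j - int (Suc p)"] u by simp
    then show "sc ((- 1) ^ card {t \<in> S. t < u} * X u) (c (insert u S)) \<in> A (j - int p)"
      by (simp add: scale_sign A_uminus)
  qed
next
  fix S assume S: "\<not> (S \<subseteq> {1..n} \<and> card S = p)"
  have "c (insert u S) = 0" if "u \<in> {1..n} - S" for u
  proof (rule chainD0[OF assms], rule notI)
    assume *: "insert u S \<subseteq> {1..n} \<and> card (insert u S) = Suc p"
    then have "finite S" using finite_subset[of S "{1..n}"] by blast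
    then have "card (insert u S) = Suc (card S)" using that by (intro card_insert_disjoint) auto
    with * S show False by simp
  qed
  then show "bd n sc c S = 0" by (simp add: bd_def)
qed

lemma bd_chain_0: "c \<in> chain n A 0 j \<Longrightarrow> bd n sc c T = 0"
proof -
  assume c: "c \<in> chain n A 0 j"
  have "c (insert u T) = 0" if "u \<in> {1..n}" for u
    using c by (rule chainD0) (simp only: card_0_subset insert_not_empty not_False_eq_True)
  then show ?thesis by (simp add: bd_def)
qed

lemma bd_infinite:
  assumes "c \<in> chain n A p j" "infinite T"
  shows "bd n sc c T = 0"
proof -
  have "c (insert u T) = 0" for u
    using assms finite_subset[of "insert u T" "{1..n}"] by (intro chainD0[OF assms(1)]) auto
  then show ?thesis by (simp add: bd_def)
qed

lemma bd_minus: "bd n sc (\<lambda>S. c S - d S) T = bd n sc c T - bd n sc d T"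
  by (simp add: bd_def scale_right_diff_distrib sum_subtractf)

lemma bd_add: "bd n sc (\<lambda>S. c S + d S) T = bd n sc c T + bd n sc d T"
  by (simp add: bd_def scale_right_distrib sum.distrib)

lemma bd_bd:
  assumes c: "c \<in> chain n A p j"
  shows "bd n sc (bd n sc c) T = 0"
proof (cases "finite T")
  case True
  let ?\<sigma> = "\<lambda>u T. (- 1 :: 'a mpoly) ^ card {t \<in> T. t < u}"
  define g where "g u w = sc (?\<sigma> u T * X u * (?\<sigma> w (insert u T) * X w)) (c (insert w (insert u T)))" for u w
  have "bd n sc (bd n sc c) T = (\<Sum>u\<in>{1..n} - T. \<Sum>w\<in>({1..n} - T) - {u}. g u w)"
    by (simp add: bd_def scale_sum_right g_def) (intro sum.cong refl; auto)
  also have "\<dots> = 0"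
  proof (rule sum_antisymmetric_pairs)
    fix u w assume uw: "u \<in> {1..n} - T" "w \<in> {1..n} - T" "u < w"
    \<comment> \<open>Adding \<open>u\<close> first shifts the position of \<open>w\<close> by one;
      adding \<open>w\<close> first leaves the position of \<open>u\<close> unchanged.\<close>
    have 1: "?\<sigma> w (insert u T) = - ?\<sigma> w T"
      using uw True card_less_insert[of u T w] by simp
    have 2: "?\<sigma> u (insert w T) = ?\<sigma> u T"
      using uw True card_less_insert[of w T u] by simp
    show "g u w = - g w u"
      unfolding g_def 1 2 by (simp add: insert_commute mult_ac)
  qed simp
  finally show ?thesis .
next
  case False
  then have "bd n sc c (insert u T) = 0" for u
    by (intro bd_infinite[OF c]) simp
  then show ?thesis by (simp add: bd_def[of n sc "bd n sc c"])
qed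

lemma chain_minus: "c \<in> chain n A p j \<Longrightarrow> d \<in> chain n A p j \<Longrightarrow> (\<lambda>S. c S - d S) \<in> chain n A p j"
  unfolding chain_def by (fastforce intro: A_minus split: if_splits)

lemma chain_add: "c \<in> chain n A p j \<Longrightarrow> d \<in> chain n A p j \<Longrightarrow> (\<lambda>S. c S + d S) \<in> chain n A p j"
  unfolding chain_def by (fastforce intro: A_add split: if_splits)

text \<open>Index 0 in the language of Nakayama: up to \<open>N\<close>, every element of degree
  \<open>j\<close> is a combination of variables times elements of degree \<open>j - 1\<close>, so
  degree \<open>j\<close> needs no new generator.\<close>

lemma acyc_0_iff:
  "acyc n sc A N 0 j \<longleftrightarrow>
    (\<forall>a\<in>A j. \<exists>g. (\<forall>u\<in>{1..n}. g u \<in> A (j - 1)) \<and> a - (\<Sum>u\<in>{1..n}. sc (X u) (g u)) \<in> N)"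
proof
  assume ac: "acyc n sc A N 0 j"
  show "\<forall>a\<in>A j. \<exists>g. (\<forall>u\<in>{1..n}. g u \<in> A (j - 1)) \<and> a - (\<Sum>u\<in>{1..n}. sc (X u) (g u)) \<in> N"
  proof
    fix a assume a: "a \<in> A j"
    define c where "c S = (if S = {} then a else 0)" for S :: "nat set"
    have c: "c \<in> chain n A 0 j"
    proof (rule chainI)
      fix S :: "nat set" assume "S \<subseteq> {1..n}" "card S = 0"
      then have "S = {}" using card_0_subset by blast
      then show "c S \<in> A (j - int 0)" using a by (simp add: c_def)
    qed (auto simp: c_def)
    moreover have "bd n sc c S \<in> N" for S
      using bd_chain_0[OF c] N_zero by simp
    ultimately obtain f where f: "f \<in> chain n A (Suc 0) j" "\<And>S. c S - bd n sc f S \<in> N"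
      using ac unfolding acyc_def by blast
    have "f {u} \<in> A (j - 1)" if "u \<in> {1..n}" for u
      using chainD1[OF f(1), of "{u}"] that by simp
    moreover have "a - (\<Sum>u\<in>{1..n}. sc (X u) (f {u})) \<in> N"
      using f(2)[of "{}"] by (simp add: c_def bd_def)
    ultimately show "\<exists>g. (\<forall>u\<in>{1..n}. g u \<in> A (j - 1)) \<and> a - (\<Sum>u\<in>{1..n}. sc (X u) (g u)) \<in> N"
      by (intro exI[of _ "\<lambda>u. f {u}"]) auto
  qed
next
  assume *: "\<forall>a\<in>A j. \<exists>g. (\<forall>u\<in>{1..n}. g u \<in> A (j - 1)) \<and> a - (\<Sum>u\<in>{1..n}. sc (X u) (g u)) \<in> N"
  show "acyc n sc A N 0 j"
    unfolding acyc_def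
  proof (intro ballI impI)
    fix c assume c: "c \<in> chain n A 0 j"
    have "c {} \<in> A j" using chainD1[OF c, of "{}"] by simp
    with * obtain g where g: "\<forall>u\<in>{1..n}. g u \<in> A (j - 1)" "c {} - (\<Sum>u\<in>{1..n}. sc (X u) (g u)) \<in> N"
      by blast
    define f where "f S = (if S \<subseteq> {1..n} \<and> card S = 1 then g (the_elem S) else 0)" for S
    have f: "f \<in> chain n A (Suc 0) j"
      using g(1) by (intro chainI) (auto simp: f_def card_1_singleton_iff)
    moreover have "c S - bd n sc f S \<in> N" for S
    proof (cases "S = {}")
      case True
      have "bd n sc f {} = (\<Sum>u\<in>{1..n}. sc (X u) (g u))"
        by (auto simp: bd_def f_def intro!: sum.cong)
      with True g(2) show ?thesis by simp
    next
      case False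
      then have "\<not> (S \<subseteq> {1..n} \<and> card S = 0)"
        by (simp only: card_0_subset simp_thms)
      then show ?thesis
        using chainD0[OF c] chainD0[OF bd_chain[OF f]] N_zero by simp
    qed
    ultimately show "\<exists>f\<in>chain n A (Suc 0) j. \<forall>S. c S - bd n sc f S \<in> N" by blast
  qed
qed

end

section \<open>The Koszul complex of a free module\<close>

text \<open>The Koszul complex of the polynomial ring is contracted by moving the smallest variable of a monomial
  into the index set, which is possible unless a smaller index is already there.\<close>

definition divmin :: "nat \<Rightarrow> 'a::field mpoly \<Rightarrow> 'a mpoly"
  where "divmin s p = restr (\<lambda>m. keys m \<subseteq> {s..}) (quo s p)"

lemma lookup_divmin: "lookup (divmin s p) m = (if keys m \<subseteq> {s..} then lookup p (m + xv s) else 0)"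
  by (simp add: divmin_def lookup_restr lookup_quo)

lemma divmin_zero [simp]: "divmin s 0 = 0"
  by (simp add: divmin_def)

lemma divmin_sum: "divmin s (sum f A) = (\<Sum>a\<in>A. divmin s (f a))"
  by (simp add: divmin_def quo_sum restr_sum)

lemma divmin_uminus: "divmin s (- p) = - divmin s p"
  by (rule poly_mapping_eqI) (simp add: lookup_divmin)

lemma divmin_X_less: "u < s \<Longrightarrow> divmin s (X u * p) = 0"
  by (rule poly_mapping_eqI) (auto simp: lookup_divmin lookup_X_times keys_plus_nat)

lemma divmin_X_same: "divmin s (X s * p) = restr (\<lambda>m. keys m \<subseteq> {s..}) p"
  by (simp add: divmin_def)

lemma divmin_X_greater:
  assumes "s < u" shows "divmin s (X u * p) = X u * divmin s p"
proof (rule poly_mapping_eqI)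
  fix m
  show "lookup (divmin s (X u * p)) m = lookup (X u * divmin s p) m"
  proof (cases "u \<in> keys m")
    case True
    have m: "m - xv u + xv u = m" using minus_xv_plus[OF True] .
    have "m - xv u + xv u + xv s = (m - xv u + xv s) + xv u" by (simp only: ac_simps)
    then have 1: "m + xv s - xv u = m - xv u + xv s" unfolding m by simp
    have "keys m = keys (m - xv u) \<union> {u}"
      using keys_plus_nat[of "m - xv u" "xv u"] by (simp add: m)
    then have "keys m \<subseteq> {s..} \<longleftrightarrow> keys (m - xv u) \<subseteq> {s..}"
      using assms by auto
    with True 1 show ?thesis
      by (simp add: lookup_divmin lookup_X_times keys_plus_nat)
  next
    case False
    with assms show ?thesis by (simp add: lookup_divmin lookup_X_times keys_plus_nat)
  qed
qed

lemma X_times_divmin: "X s * divmin s p = restr (\<lambda>m. s \<in> keys m \<and> keys m \<subseteq> {s..}) p"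
proof (rule poly_mapping_eqI)
  fix m
  show "lookup (X s * divmin s p) m = lookup (restr (\<lambda>m. s \<in> keys m \<and> keys m \<subseteq> {s..}) p) m"
  proof (cases "s \<in> keys m")
    case True
    have "keys m = keys (m - xv s) \<union> {s}"
      using keys_plus_nat[of "m - xv s" "xv s"] by (simp add: minus_xv_plus True)
    with True show ?thesis
      by (simp add: lookup_divmin lookup_X_times lookup_restr minus_xv_plus)
  qed (simp add: lookup_X_times lookup_restr)
qed

text \<open>Either all variables of a monomial are at least \<open>s\<close>, or its smallest
  variable is exactly one \<open>u < s\<close>; so each monomial is counted once. For
  \<open>s = n + 1\<close> the remainder is the constant term.\<close>

lemma smallest_variable_decomposition:
  assumes "p \<in> polys n" "s \<le> n + 1"
  shows "(\<Sum>u\<in>{1..<s}. X u * divmin u p) + restr (\<lambda>m. keys m \<subseteq> {s..}) p = p"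
proof (rule poly_mapping_eqI)
  fix m
  have "lookup (\<Sum>u\<in>{1..<s}. X u * divmin u p) m =
      (\<Sum>u\<in>{1..<s}. if u \<in> keys m \<and> keys m \<subseteq> {u..} then lookup p m else 0)"
    by (simp add: lookup_sum X_times_divmin lookup_restr)
  also have "\<dots> + (if keys m \<subseteq> {s..} then lookup p m else 0) = lookup p m"
  proof (cases "m \<in> keys p")
    case False
    then have "lookup p m = 0" by (simp add: in_keys_iff)
    then show ?thesis by (simp cong: if_cong)
  next
    case True
    then have m: "keys m \<subseteq> {1..n}" using assms(1) by (auto simp: polys_iff)
    show ?thesis
    proof (cases "keys m \<subseteq> {s..}")
      case True
      have nn: "\<not> (u \<in> keys m \<and> keys m \<subseteq> {u..})" if "u \<in> {1..<s}" for u
        using that True by auto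
      have "(\<Sum>u\<in>{1..<s}. if u \<in> keys m \<and> keys m \<subseteq> {u..} then lookup p m else 0) = 0"
        by (intro sum.neutral ballI if_not_P nn)
      with True show ?thesis by simp
    next
      case False
      then have ne: "keys m \<noteq> {}" by auto
      have min: "Min (keys m) \<in> keys m" "\<And>x. x \<in> keys m \<Longrightarrow> Min (keys m) \<le> x"
        using ne by auto
      obtain x where "x \<in> keys m" "x < s" using False by (meson atLeast_iff not_le subsetI)
      then have "Min (keys m) < s" using le_less_trans[OF min(2)] by blast
      with min(1) m have range: "Min (keys m) \<in> {1..<s}" by auto
      have "u \<in> keys m \<and> keys m \<subseteq> {u..} \<longleftrightarrow> u = Min (keys m)" for u
        using min by (auto simp: subset_iff intro!: le_antisym)
      with False range show ?thesis by simp
    qed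
  qed
  finally show "lookup ((\<Sum>u\<in>{1..<s}. X u * divmin u p) + restr (\<lambda>m. keys m \<subseteq> {s..}) p) m = lookup p m"
    by (simp add: lookup_add lookup_restr)
qed

lemma sum_X_times_divmin:
  assumes "p \<in> polys n" "lookup p 0 = 0"
  shows "(\<Sum>u\<in>{1..n}. X u * divmin u p) = p"
proof -
  have "restr (\<lambda>m. keys m \<subseteq> {n+1..}) p = 0"
  proof (rule poly_mapping_eqI)
    fix m
    show "lookup (restr (\<lambda>m. keys m \<subseteq> {n+1..}) p) m = lookup 0 m"
    proof (cases "m \<in> keys p \<and> keys m \<subseteq> {n+1..}")
      case True
      then have "keys m = {}" using assms(1) by (fastforce simp: polys_iff)
      then show ?thesis using assms(2) by (simp add: lookup_restr)
    qed (auto simp: lookup_restr in_keys_iff)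
  qed
  then show ?thesis
    using smallest_variable_decomposition[OF assms(1), of "n + 1"] by (simp add: atLeastLessThanSuc_atLeastAtMost)
qed

lemma hpoly_divmin: "p \<in> hpoly n d \<Longrightarrow> divmin s p \<in> hpoly n (d - 1)"
  by (simp add: divmin_def hpoly_closed hpoly_quo)

lemma hpoly_polys: "p \<in> hpoly n d \<Longrightarrow> p \<in> polys n"
  by (simp add: hpoly_def)

definition homotopy :: "nat \<Rightarrow> (nat set \<Rightarrow> 'a::field mpoly) \<Rightarrow> nat set \<Rightarrow> 'a mpoly"
  where "homotopy n c S = (if S \<subseteq> {1..n} \<and> S \<noteq> {} then divmin (Min S) (c (S - {Min S})) else 0)"

lemma module_times: "module ((*) :: 'a::field mpoly \<Rightarrow> _)"
  by unfold_locales (auto simp: algebra_simps)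

lemma gmod_hpoly:
  assumes "0 \<in> N" "\<And>x y. x \<in> N \<Longrightarrow> y \<in> N \<Longrightarrow> x - y \<in> N"
    and "\<And>u x. u \<in> {1..n} \<Longrightarrow> x \<in> N \<Longrightarrow> X u * x \<in> N"
  shows "gmod (*) n (hpoly n) (N :: 'a::field mpoly set)"
  by (intro gmod.intro module_times gmod_axioms.intro) (use assms in \<open>auto intro: hpoly_X_times\<close>)

lemma homotopy_chain:
  assumes c: "c \<in> chain n (\<lambda>d. hpoly n (d - a)) p j"
  shows "homotopy n c \<in> chain n (\<lambda>d. hpoly n (d - a)) (Suc p) j"
proof (rule chainI)
  fix S :: "nat set" assume S: "S \<subseteq> {1..n}" "card S = Suc p"
  then have fin: "finite S" and ne: "S \<noteq> {}" by (auto intro: finite_subset)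
  have "card (S - {Min S}) = p" using S fin ne by simp
  then have "c (S - {Min S}) \<in> hpoly n (j - int p - a)"
    using S by (intro chainD1[OF c]) auto
  then have "divmin (Min S) (c (S - {Min S})) \<in> hpoly n (j - int p - a - 1)"
    by (rule hpoly_divmin)
  then show "homotopy n c S \<in> hpoly n (j - int (Suc p) - a)"
    using S ne by (simp add: homotopy_def algebra_simps)
next
  fix S :: "nat set" assume S: "\<not> (S \<subseteq> {1..n} \<and> card S = Suc p)"
  show "homotopy n c S = 0"
  proof (cases "S \<subseteq> {1..n} \<and> S \<noteq> {}")
    case True
    then have fin: "finite S" by (auto intro: finite_subset)
    have "Min S \<in> S" using fin True by simp
    then have "card S = Suc (card (S - {Min S}))" by (rule card.remove[OF fin])
    with S True have "card (S - {Min S}) \<noteq> p" by metis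
    then have "c (S - {Min S}) = 0"
      by (intro chainD0[OF c]) auto
    with True show ?thesis by (simp add: homotopy_def)
  qed (auto simp: homotopy_def)
qed

text \<open>The identity "boundary of homotopy plus homotopy of boundary is the identity up to
  constants", evaluated on a cycle. With \<open>s = Min T\<close>, indices below \<open>s\<close>
  recover the monomials of \<open>c T\<close> whose smallest variable is below \<open>s\<close>, and
  the cycle condition at \<open>T - {s}\<close> yields the others. The twist \<open>a\<close> is the
  degree of a basis element; \<open>const\<close> excludes the one nonzero class, in index
  0.\<close>

lemma koszul_exact:
  assumes c: "c \<in> chain n (\<lambda>d. hpoly n (d - a)) p j"
    and cyc: "\<And>S. hbd n c S = 0"
    and const: "p = 0 \<Longrightarrow> lookup (c {}) 0 = 0"
  shows "hbd n (homotopy n c) T = c T"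
proof -
  have cpoly: "c S \<in> polys n" for S
    using chainD1[OF c, of S] chainD0[OF c, of S] by (cases "S \<subseteq> {1..n} \<and> card S = p") (auto simp: hpoly_polys)
  consider "\<not> T \<subseteq> {1..n}" | "T = {}" | "T \<subseteq> {1..n}" "T \<noteq> {}" by blast
  then show ?thesis
  proof cases
    case 1
    then show ?thesis using chainD0[OF c, of T] by (simp add: bd_def homotopy_def)
  next
    case 2
    have "lookup (c {}) 0 = 0"
      using const chainD0[OF c, of "{}"] by (cases "p = 0") auto
    with 2 cpoly show ?thesis
      using sum_X_times_divmin[of "c {}" n] by (simp add: bd_def homotopy_def)
  next
    case 3
    define s where "s = Min T"
    define E where "E = {1..n} - T"
    let ?\<sigma> = "\<lambda>u T. (- 1 :: 'a mpoly) ^ card {t \<in> T. t < u}"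
    have fin: "finite T" using 3 by (auto intro: finite_subset)
    have s: "s \<in> T" "\<And>t. t \<in> T \<Longrightarrow> s \<le> t" using fin 3 by (auto simp: s_def)
    define h where "h u = ?\<sigma> u T * X u * homotopy n c (insert u T)" for u
    have E1: "{u\<in>E. u < s} = {1..<s}" using s 3 by (auto simp: E_def dest: s(2))
    have h1: "h u = X u * divmin u (c T)" if "u \<in> {1..<s}" for u
    proof -
      have u: "u \<notin> T" "{t \<in> T. t < u} = {}" using s that by force+
      have "Min (insert u T) = u" using s that fin by (intro Min_eqI) force+
      moreover have "?\<sigma> u T = 1" by (simp only: u(2) card.empty power_0)
      moreover have "insert u T \<subseteq> {1..n}" "insert u T - {u} = T" using u(1) that 3 s(1) by auto
      ultimately show ?thesis by (simp add: h_def homotopy_def)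
    qed
    have h2: "h u = - (?\<sigma> u (T - {s}) * divmin s (X u * c (insert u (T - {s}))))"
      if "u \<in> {u\<in>E. s < u}" for u
    proof -
      have u: "u \<in> {1..n}" "u \<notin> T" "s < u" using that by (auto simp: E_def)
      have "Min (insert u T) = s" using s u fin by (intro Min_eqI) force+
      moreover have "insert u T - {s} = insert u (T - {s})" using u by auto
      moreover have "card {t \<in> T. t < u} = Suc (card {t \<in> T - {s}. t < u})"
        using card_less_insert[of s "T - {s}" u] fin s u by (simp add: insert_absorb)
      ultimately show ?thesis using u 3 by (simp add: h_def homotopy_def divmin_X_greater)
    qed
    \<comment> \<open>Apply \<open>divmin s\<close> to the cycle condition at
      \<open>T - {s}\<close>: the index \<open>s\<close> gives the part of \<open>c T\<close> in
      variables from \<open>s\<close> on, smaller indices vanish, and larger ones give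
      \<open>- h u\<close>.\<close>
    have "0 = divmin s (hbd n c (T - {s}))" by (simp add: cyc)
    also have "{1..n} - (T - {s}) = insert s E" using s 3 by (auto simp: E_def)
    then have "divmin s (hbd n c (T - {s})) =
        (\<Sum>u\<in>insert s E. ?\<sigma> u (T - {s}) * divmin s (X u * c (insert u (T - {s}))))"
      by (simp only: bd_def divmin_sum mult.assoc)
        (intro sum.cong refl; simp add: minus_one_power_iff divmin_uminus)
    also have "\<dots> = ?\<sigma> s (T - {s}) * divmin s (X s * c T) +
        (\<Sum>u\<in>E. ?\<sigma> u (T - {s}) * divmin s (X u * c (insert u (T - {s}))))"
      using s by (subst sum.insert) (auto simp: E_def insert_absorb)
    also have "?\<sigma> s (T - {s}) = 1"
    proof -
      have "{t \<in> T - {s}. t < s} = {}" using s(2) by force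
      then show ?thesis by (simp only: card.empty power_0)
    qed
    also have "(\<Sum>u\<in>E. ?\<sigma> u (T - {s}) * divmin s (X u * c (insert u (T - {s})))) =
       (\<Sum>u\<in>{u\<in>E. s < u}. - h u)"
    proof (rule sum.mono_neutral_cong_right)
      show "\<forall>u\<in>E - {u \<in> E. s < u}. ?\<sigma> u (T - {s}) * divmin s (X u * c (insert u (T - {s}))) = 0"
      proof
        fix u assume "u \<in> E - {u \<in> E. s < u}"
        then have "u < s" using s by (auto simp: E_def not_less_iff_gr_or_eq intro: ccontr)
        then show "?\<sigma> u (T - {s}) * divmin s (X u * c (insert u (T - {s}))) = 0"
          by (simp add: divmin_X_less)
      qed
    qed (auto simp: E_def h2)
    finally have E2: "(\<Sum>u\<in>{u\<in>E. s < u}. h u) = restr (\<lambda>m. keys m \<subseteq> {s..}) (c T)"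
      by (simp add: sum_negf divmin_X_same)
    have "E = {u\<in>E. u < s} \<union> {u\<in>E. s < u}"
      using s by (auto simp: E_def not_less_iff_gr_or_eq)
    moreover have "hbd n (homotopy n c) T = (\<Sum>u\<in>E. h u)"
      by (simp only: bd_def h_def E_def)
    ultimately have "hbd n (homotopy n c) T = (\<Sum>u\<in>{u\<in>E. u < s} \<union> {u\<in>E. s < u}. h u)"
      by simp
    also have "\<dots> = (\<Sum>u\<in>{u\<in>E. u < s}. h u) + (\<Sum>u\<in>{u\<in>E. s < u}. h u)"
      by (rule sum.union_disjoint) (auto simp: E_def)
    also have "\<dots> = (\<Sum>u\<in>{1..<s}. X u * divmin u (c T)) + restr (\<lambda>m. keys m \<subseteq> {s..}) (c T)"
      by (simp only: E1 E2) (simp add: h1)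
    also have "\<dots> = c T"
      using s(1) 3(1) by (intro smallest_variable_decomposition[OF cpoly]) auto
    finally show ?thesis .
  qed
qed

section \<open>Syzygies and Koszul homology\<close>

definition vsc :: "'a::field mpoly \<Rightarrow> (nat \<Rightarrow> 'a mpoly) \<Rightarrow> nat \<Rightarrow> 'a mpoly"
  where "vsc p v = (\<lambda>b. p * v b)"

text \<open>Unlike the vectors of \<open>free_module\<close>, these vanish from index
  \<open>r\<close> on, so pointwise subtraction stays inside and the group structure on functions
  applies.\<close>

definition hvec :: "nat \<Rightarrow> nat \<Rightarrow> (nat \<Rightarrow> int) \<Rightarrow> int \<Rightarrow> (nat \<Rightarrow> 'a::field mpoly) set"
  where "hvec n r sh d = {v. (\<forall>b<r. v b \<in> hpoly n (d - sh b)) \<and> (\<forall>b\<ge>r. v b = 0)}"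

lemma sum_fun_app: "(\<Sum>i\<in>I. f i) b = (\<Sum>i\<in>I. (f i b :: 'b::comm_monoid_add))"
  by (induction I rule: infinite_finite_induct) (auto simp: plus_fun_def zero_fun_def)

lemma module_vsc: "module vsc"
  by unfold_locales (auto simp: vsc_def fun_eq_iff plus_fun_def algebra_simps)

lemma hvecD: "v \<in> hvec n r sh d \<Longrightarrow> b < r \<Longrightarrow> v b \<in> hpoly n (d - sh b)"
  and hvec_outside: "v \<in> hvec n r sh d \<Longrightarrow> b \<ge> r \<Longrightarrow> v b = 0"
  by (auto simp: hvec_def)

lemma hvec_zero: "0 \<in> hvec n r sh d"
  by (auto simp: hvec_def zero_fun_def)

lemma hvec_minus: "v \<in> hvec n r sh d \<Longrightarrow> w \<in> hvec n r sh d \<Longrightarrow> v - w \<in> hvec n r sh d"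
  by (auto simp: hvec_def fun_diff_def)

lemma hvec_X:
  assumes "u \<in> {1..n}" "v \<in> hvec n r sh d" shows "vsc (X u) v \<in> hvec n r sh (d + 1)"
proof -
  have "X u * v b \<in> hpoly n (d + 1 - sh b)" if "b < r" for b
    using hpoly_X_times[OF assms(1) hvecD[OF assms(2) that]] by (simp add: algebra_simps)
  then show ?thesis using hvec_outside[OF assms(2)] by (auto simp: hvec_def vsc_def)
qed

lemma gmod_hvec: "gmod vsc n (hvec n r sh) {0}"
  by (intro gmod.intro module_vsc gmod_axioms.intro)
     (auto intro: hvec_zero hvec_minus hvec_X simp only: module.scale_zero_right[OF module_vsc] singleton_iff diff_self)

interpretation vec: gmod vsc n "hvec n r sh" "{0}" for n r sh
  by (rule gmod_hvec)

lemma bd_vsc: "bd n vsc c T b = hbd n (\<lambda>S. c S b) T"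
  by (simp add: bd_def vsc_def sum_fun_app)

lemma koszul_exact_vec:
  assumes c: "c \<in> chain n (hvec n r sh) p j"
    and cyc: "\<And>S. bd n vsc c S = 0"
    and const: "\<And>b. p = 0 \<Longrightarrow> b < r \<Longrightarrow> lookup (c {} b) 0 = 0"
  shows "\<exists>f\<in>chain n (hvec n r sh) (Suc p) j. \<forall>T. bd n vsc f T = c T"
proof -
  define f where "f S b = homotopy n (\<lambda>S. c S b) S" for S b
  have comp: "(\<lambda>S. c S b) \<in> chain n (\<lambda>d. hpoly n (d - sh b)) p j" if "b < r" for b
    using hvecD[OF chainD1[OF c] that] chainD0[OF c] by (intro chainI) (auto simp: zero_fun_def)
  have out: "c S b = 0" if "b \<ge> r" for S b
    using hvec_outside[OF chainD1[OF c] that, of S] chainD0[OF c, of S]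
    by (cases "S \<subseteq> {1..n} \<and> card S = p") (auto simp: zero_fun_def)
  have fout: "f S b = 0" if "b \<ge> r" for S b
    using out[OF that] by (simp add: f_def homotopy_def)
  have "f \<in> chain n (hvec n r sh) (Suc p) j"
  proof (rule chainI)
    fix S :: "nat set" assume "S \<subseteq> {1..n}" "card S = Suc p"
    then show "f S \<in> hvec n r sh (j - int (Suc p))"
      using chainD1[OF homotopy_chain[OF comp]] fout by (auto simp: hvec_def f_def)
  next
    fix S :: "nat set" assume S: "\<not> (S \<subseteq> {1..n} \<and> card S = Suc p)"
    have "f S b = 0" for b
      using chainD0[OF homotopy_chain[OF comp] S, of b] fout[of b S] by (cases "b < r") (auto simp: f_def)
    then show "f S = 0" by (simp add: fun_eq_iff zero_fun_def)
  qed
  moreover have "bd n vsc f T b = c T b" for T b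
  proof (cases "b < r")
    case True
    have "hbd n (\<lambda>S. c S b) S = 0" for S
      using cyc[of S] bd_vsc[of n c S b] by (simp add: zero_fun_def)
    then have "hbd n (homotopy n (\<lambda>S. c S b)) T = c T b"
      using const True by (intro koszul_exact[OF comp]) auto
    then show ?thesis by (simp add: bd_vsc f_def)
  next
    case False
    then show ?thesis using fout out unfolding bd_vsc by (simp add: bd_def)
  qed
  ultimately show ?thesis by (intro bexI[of _ f]) (auto simp: fun_eq_iff)
qed

text \<open>A graded free module with basis degrees \<open>sh\<close>, mapped by \<open>\<phi>\<close> onto the quotient represented by
  \<open>A\<close> and \<open>N\<close>. The kernel \<open>Z\<close> plays the role of the first syzygy module.\<close>

locale free_cover = gmod sc n A N
  for sc :: "'a::field mpoly \<Rightarrow> 'w::ab_group_add \<Rightarrow> 'w" and n A N +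
  fixes r :: nat and sh :: "nat \<Rightarrow> int" and \<phi> :: "(nat \<Rightarrow> 'a mpoly) \<Rightarrow> 'w"
  assumes \<phi>_add: "\<phi> (v + w) = \<phi> v + \<phi> w"
    and \<phi>_scale: "\<phi> (vsc p v) = sc p (\<phi> v)"
    and \<phi>_A: "v \<in> hvec n r sh d \<Longrightarrow> \<phi> v \<in> A d"
    and \<phi>_surj: "a \<in> A d \<Longrightarrow> \<exists>v\<in>hvec n r sh d. \<phi> v - a \<in> N"
begin

definition Z :: "int \<Rightarrow> (nat \<Rightarrow> 'a mpoly) set"
  where "Z d = {v \<in> hvec n r sh d. \<phi> v \<in> N}"

lemma \<phi>_zero [simp]: "\<phi> 0 = 0"
  using \<phi>_add[of 0 0] by simp

lemma \<phi>_minus: "\<phi> (v - w) = \<phi> v - \<phi> w"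
  using \<phi>_add[of "v - w" w] by (simp add: algebra_simps)

lemma \<phi>_sum: "\<phi> (sum f I) = (\<Sum>i\<in>I. \<phi> (f i))"
  by (induction I rule: infinite_finite_induct)
     (simp_all only: sum.infinite sum.empty sum.insert \<phi>_zero \<phi>_add not_False_eq_True)

lemma \<phi>_bd: "\<phi> (bd n vsc c T) = bd n sc (\<lambda>S. \<phi> (c S)) T"
  by (simp add: bd_def \<phi>_sum \<phi>_scale)

lemma chain_\<phi>: "c \<in> chain n (hvec n r sh) q j \<Longrightarrow> (\<lambda>S. \<phi> (c S)) \<in> chain n A q j"
  using chainD1[of c n "hvec n r sh" q j] chainD0[of c n "hvec n r sh" q j]
  by (intro chainI) (auto intro: \<phi>_A)

lemma lift_chain:
  assumes "c \<in> chain n A q j"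
  shows "\<exists>e\<in>chain n (hvec n r sh) q j. \<forall>S. \<phi> (e S) - c S \<in> N"
proof -
  have "\<exists>v. if S \<subseteq> {1..n} \<and> card S = q then v \<in> hvec n r sh (j - int q) \<and> \<phi> v - c S \<in> N else v = 0" for S
    using \<phi>_surj[OF chainD1[OF assms, of S]] by auto
  then obtain e where e: "\<And>S. if S \<subseteq> {1..n} \<and> card S = q
      then e S \<in> hvec n r sh (j - int q) \<and> \<phi> (e S) - c S \<in> N else e S = 0"
    by metis
  have "e \<in> chain n (hvec n r sh) q j"
    using e by (intro chainI) (metis, metis)
  moreover have "\<phi> (e S) - c S \<in> N" for S
    using e[of S] chainD0[OF assms, of S] N_zero by (auto split: if_splits)
  ultimately show ?thesis by blast
qed

lemma kernel_chain:
  assumes "e \<in> chain n (hvec n r sh) q j" "\<And>S. \<phi> (e S) \<in> N"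
  shows "e \<in> chain n Z q j"
  using assms chainD1[OF assms(1)] chainD0[OF assms(1)] by (intro chainI) (auto simp: Z_def)

lemma chain_Z: "e \<in> chain n Z q j \<Longrightarrow> e \<in> chain n (hvec n r sh) q j"
  by (auto simp: chain_def Z_def split: if_splits)

lemma chain_Z_N: "e \<in> chain n Z q j \<Longrightarrow> \<phi> (e S) \<in> N"
  using chainD1[of e n Z q j S] chainD0[of e n Z q j S] N_zero
  by (cases "S \<subseteq> {1..n} \<and> card S = q") (auto simp: Z_def)

text \<open>Long exact sequence of \<open>0 -> Z -> F -> A/N -> 0\<close> with \<open>F\<close>
  free: the connecting map from index \<open>Suc p\<close> of \<open>A/N\<close> to index
  \<open>p\<close> of \<open>Z\<close> is onto. For \<open>p > 0\<close> this is because index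
  \<open>p\<close> of \<open>F\<close> vanishes; for \<open>p = 0\<close> because
  \<open>const\<close> puts \<open>Z\<close> into the maximal ideal times \<open>F\<close>, so that
  \<open>Z\<close> maps to zero in the homology of \<open>F\<close>.\<close>

lemma acyc_syzygy:
  assumes ac: "acyc n sc A N (Suc p) j"
    and const: "\<And>v b. p = 0 \<Longrightarrow> v \<in> Z j \<Longrightarrow> b < r \<Longrightarrow> lookup (v b) 0 = 0"
  shows "acyc n vsc Z {0} p j"
  unfolding acyc_def
proof (intro ballI impI)
  fix c assume c: "c \<in> chain n Z p j" and "\<forall>S. bd n vsc c S \<in> {0}"
  then have cyc: "\<And>S. bd n vsc c S = 0" by simp
  have "lookup (c {} b) 0 = 0" if "p = 0" "b < r" for b
    using const[OF that(1) _ that(2), of "c {}"] chainD1[OF c, of "{}"] that by simp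
  then obtain e where e: "e \<in> chain n (hvec n r sh) (Suc p) j" "\<And>T. bd n vsc e T = c T"
    using koszul_exact_vec[OF chain_Z[OF c] cyc] by blast
  have "bd n sc (\<lambda>S. \<phi> (e S)) S \<in> N" for S
    using chain_Z_N[OF c, of S] unfolding e(2)[symmetric] \<phi>_bd .
  then obtain f' where f': "f' \<in> chain n A (Suc (Suc p)) j"
      "\<And>S. \<phi> (e S) - bd n sc f' S \<in> N"
    using ac chain_\<phi>[OF e(1)] unfolding acyc_def by blast
  obtain f where f: "f \<in> chain n (hvec n r sh) (Suc (Suc p)) j" "\<And>S. \<phi> (f S) - f' S \<in> N"
    using lift_chain[OF f'(1)] by blast
  \<comment> \<open>Correcting \<open>e\<close> by the boundary of a lift moves it into
    \<open>Z\<close> without changing its boundary.\<close>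
  define g where "g S = e S - bd n vsc f S" for S
  have g: "g \<in> chain n (hvec n r sh) (Suc p) j"
    unfolding g_def by (intro vec.chain_minus e vec.bd_chain f)
  have "\<phi> (g S) = (\<phi> (e S) - bd n sc f' S) - bd n sc (\<lambda>S. \<phi> (f S) - f' S) S" for S
    by (simp add: g_def \<phi>_minus \<phi>_bd bd_minus)
  then have "\<phi> (g S) \<in> N" for S
    using f f' by (simp add: N_minus bd_N)
  with g have "g \<in> chain n Z (Suc p) j" by (rule kernel_chain)
  moreover have "bd n vsc g S = c S" for S
    using e vec.bd_bd[OF f(1)] unfolding g_def by (simp add: vec.bd_minus)
  ultimately show "\<exists>f\<in>chain n Z (Suc p) j. \<forall>S. c S - bd n vsc f S \<in> {0}"
    by (intro bexI[of _ g]) auto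
qed

text \<open>The same sequence in the other direction: the homology of the free module vanishes in
  index \<open>Suc p\<close>, so the connecting map is injective.\<close>

lemma acyc_from_syzygy:
  assumes ac: "acyc n vsc Z {0} p j"
  shows "acyc n sc A N (Suc p) j"
  unfolding acyc_def
proof (intro ballI impI)
  fix c assume c: "c \<in> chain n A (Suc p) j" and cyc: "\<forall>S. bd n sc c S \<in> N"
  obtain e where e: "e \<in> chain n (hvec n r sh) (Suc p) j" "\<And>S. \<phi> (e S) - c S \<in> N"
    using lift_chain[OF c] by blast
  have "\<phi> (bd n vsc e S) = bd n sc (\<lambda>S. \<phi> (e S) - c S) S + bd n sc c S" for S
    by (simp add: \<phi>_bd bd_minus)
  then have "\<phi> (bd n vsc e S) \<in> N" for S
    using e cyc by (simp add: N_add bd_N)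
  then have "bd n vsc e \<in> chain n Z p j"
    using e by (intro kernel_chain vec.bd_chain)
  moreover have "bd n vsc (bd n vsc e) S \<in> {0}" for S
    using vec.bd_bd[OF e(1)] by simp
  ultimately obtain g where g: "g \<in> chain n Z (Suc p) j" "\<And>S. bd n vsc e S - bd n vsc g S = 0"
    using ac unfolding acyc_def by blast
  have "(\<lambda>S. e S - g S) \<in> chain n (hvec n r sh) (Suc p) j"
    by (intro vec.chain_minus e chain_Z g)
  moreover have "bd n vsc (\<lambda>S. e S - g S) S = 0" for S
    using g by (simp add: vec.bd_minus)
  ultimately obtain h where h: "h \<in> chain n (hvec n r sh) (Suc (Suc p)) j" "\<And>S. bd n vsc h S = e S - g S"
    using koszul_exact_vec[of "\<lambda>S. e S - g S" n r sh "Suc p" j] by auto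
  have "c S - bd n sc (\<lambda>S. \<phi> (h S)) S \<in> N" for S
  proof -
    have eq: "c S - bd n sc (\<lambda>S. \<phi> (h S)) S = \<phi> (g S) - (\<phi> (e S) - c S)"
      unfolding \<phi>_bd[symmetric] h(2) \<phi>_minus by simp
    show ?thesis unfolding eq by (rule N_minus[OF chain_Z_N[OF g(1)] e(2)])
  qed
  with chain_\<phi>[OF h(1)] show "\<exists>f\<in>chain n A (Suc (Suc p)) j. \<forall>S. c S - bd n sc f S \<in> N"
    by blast
qed

text \<open>Since \<open>Z\<close> lies in the maximal ideal times the free module, the free module
  and its image have the same homology in index 0, and for the free module this is spanned by the
  basis elements of degree \<open>j\<close>.\<close>

lemma acyc_0_iff_no_generator:
  assumes const: "\<And>v b. v \<in> Z j \<Longrightarrow> b < r \<Longrightarrow> lookup (v b) 0 = 0"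
  shows "acyc n sc A N 0 j \<longleftrightarrow> \<not> (\<exists>b<r. sh b = j)"
proof
  assume ac: "acyc n sc A N 0 j"
  show "\<not> (\<exists>b<r. sh b = j)"
  proof
    assume "\<exists>b<r. sh b = j"
    then obtain b where b: "b < r" "sh b = j" by blast
    define e :: "nat \<Rightarrow> 'a mpoly" where "e b' = (if b' = b then 1 else 0)" for b'
    have e: "e \<in> hvec n r sh j"
      using b by (auto simp: hvec_def e_def hpoly_def homogeneous_def)
    obtain g where g: "\<And>u. u \<in> {1..n} \<Longrightarrow> g u \<in> A (j - 1)"
        "\<phi> e - (\<Sum>u\<in>{1..n}. sc (X u) (g u)) \<in> N"
      using ac \<phi>_A[OF e] unfolding acyc_0_iff by blast
    have "\<forall>u\<in>{1..n}. \<exists>v. v \<in> hvec n r sh (j - 1) \<and> \<phi> v - g u \<in> N"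
      using \<phi>_surj g(1) by blast
    then obtain h where h: "\<And>u. u \<in> {1..n} \<Longrightarrow> h u \<in> hvec n r sh (j - 1)"
        "\<And>u. u \<in> {1..n} \<Longrightarrow> \<phi> (h u) - g u \<in> N"
      by metis
    \<comment> \<open>If degree \<open>j\<close> needed no generator, then the basis vector
      \<open>e\<close> minus lifts of the terms with \<open>g u\<close> would lie in
      \<open>Z\<close>, although its \<open>b\<close>-th coordinate still has constant term
      1.\<close>
    define w where "w = e - (\<Sum>u\<in>{1..n}. vsc (X u) (h u))"
    have "vsc (X u) (h u) \<in> hvec n r sh j" if "u \<in> {1..n}" for u
      using hvec_X[OF that h(1)[OF that]] by simp
    then have "w \<in> hvec n r sh j"
      unfolding w_def by (intro hvec_minus e vec.A_sum)
    moreover have w: "\<phi> w = (\<phi> e - (\<Sum>u\<in>{1..n}. sc (X u) (g u))) - (\<Sum>u\<in>{1..n}. sc (X u) (\<phi> (h u) - g u))"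
      by (simp add: w_def \<phi>_minus \<phi>_sum \<phi>_scale scale_right_diff_distrib sum_subtractf)
    have "\<phi> w \<in> N"
      unfolding w by (rule N_minus[OF g(2)]) (intro N_sum N_X h(2))
    ultimately have "lookup (w b) 0 = 0"
      using const[of w b] b by (simp add: Z_def)
    moreover have "lookup (w b) 0 = 1"
      by (simp add: w_def e_def sum_fun_app vsc_def lookup_minus lookup_sum lookup_X_times)
    ultimately show False by simp
  qed
next
  assume no: "\<not> (\<exists>b<r. sh b = j)"
  show "acyc n sc A N 0 j"
    unfolding acyc_0_iff
  proof
    fix a assume "a \<in> A j"
    then obtain v where v: "v \<in> hvec n r sh j" "\<phi> v - a \<in> N"
      using \<phi>_surj by blast
    define g where "g u b = divmin u (v b)" for u b
    have g: "g u \<in> hvec n r sh (j - 1)" for u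
    proof -
      have "divmin u (v b) \<in> hpoly n (j - 1 - sh b)" if "b < r" for b
        using hpoly_divmin[OF hvecD[OF v(1) that], of u] by (simp add: algebra_simps)
      then show ?thesis using hvec_outside[OF v(1)] by (auto simp: hvec_def g_def)
    qed
    have "v b = (\<Sum>u\<in>{1..n}. X u * g u b)" for b
    proof (cases "b < r")
      case True
      have vb: "v b \<in> hpoly n (j - sh b)" using hvecD[OF v(1) True] .
      moreover have "lookup (v b) 0 = 0"
      proof (rule ccontr)
        assume "lookup (v b) 0 \<noteq> 0"
        then have "0 \<in> keys (v b)" by (simp add: in_keys_iff)
        then have "int (total_degree 0) = j - sh b"
          using vb unfolding hpoly_def homogeneous_def by blast
        with no True show False by auto
      qed
      ultimately show ?thesis
        using sum_X_times_divmin[of "v b" n] by (simp add: g_def hpoly_polys)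
    next
      case False
      then show ?thesis using hvec_outside[OF v(1)] by (simp add: g_def)
    qed
    then have "v = (\<Sum>u\<in>{1..n}. vsc (X u) (g u))"
      by (simp add: fun_eq_iff sum_fun_app vsc_def)
    then have "\<phi> v = (\<Sum>u\<in>{1..n}. sc (X u) (\<phi> (g u)))"
      by (metis (no_types, lifting) \<phi>_scale \<phi>_sum sum.cong)
    then have "a - (\<Sum>u\<in>{1..n}. sc (X u) (\<phi> (g u))) \<in> N"
      using N_uminus[OF v(2)] by simp
    then show "\<exists>g. (\<forall>u\<in>{1..n}. g u \<in> A (j - 1)) \<and> a - (\<Sum>u\<in>{1..n}. sc (X u) (g u)) \<in> N"
      using \<phi>_A[OF g] by (intro exI[of _ "\<lambda>u. \<phi> (g u)"]) auto
  qed
qed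

end

section \<open>Squarefree monomial ideals: the upper bound\<close>

text \<open>This is an ideal only if \<open>U\<close> is closed under supersets.\<close>

definition sqf :: "nat \<Rightarrow> nat set set \<Rightarrow> 'a::field mpoly set"
  where "sqf n U = {p \<in> polys n. \<forall>m\<in>keys p. keys m \<in> U}"

definition upclosed :: "nat set set \<Rightarrow> bool"
  where "upclosed U \<longleftrightarrow> (\<forall>A\<in>U. \<forall>u. insert u A \<in> U)"

text \<open>The bound reg(R/J) \<le> r in terms of Koszul homology. For the unit ideal it holds with
  every \<open>r\<close>; the value used for it below is \<open>- 1\<close>.\<close>

definition reg_le :: "nat \<Rightarrow> 'a::field mpoly set \<Rightarrow> int \<Rightarrow> bool"
  where "reg_le n J r \<longleftrightarrow> (\<forall>i j. r + int i < j \<longrightarrow> hacyc n J i j)"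

lemma reg_leD: "reg_le n J r \<Longrightarrow> r + int i < j \<Longrightarrow> hacyc n J i j"
  by (auto simp: reg_le_def)

lemma reg_le_mono: "reg_le n J r \<Longrightarrow> r \<le> s \<Longrightarrow> reg_le n J s"
  by (auto simp: reg_le_def)

lemma sqf_zero: "0 \<in> sqf n U"
  by (simp add: sqf_def)

lemma sqf_mono: "p \<in> sqf n U \<Longrightarrow> U \<subseteq> V \<Longrightarrow> p \<in> sqf n V"
  by (auto simp: sqf_def)

lemma sqf_minus: "p \<in> sqf n U \<Longrightarrow> q \<in> sqf n U \<Longrightarrow> p - q \<in> sqf n U"
  using keys_diff[of p q] by (auto simp: sqf_def)

lemma sqf_X_times:
  assumes "u \<in> {1..n}" "p \<in> polys n" "\<And>m. m \<in> keys p \<Longrightarrow> insert u (keys m) \<in> U"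
  shows "X u * p \<in> sqf n U"
proof -
  have "X u * p \<in> polys n" using assms by (intro polys_mult polys_X)
  then show ?thesis using assms(3) by (auto simp: sqf_def keys_X_times keys_plus_nat)
qed

lemma sqf_X: "upclosed U \<Longrightarrow> u \<in> {1..n} \<Longrightarrow> p \<in> sqf n U \<Longrightarrow> X u * p \<in> sqf n U"
  by (intro sqf_X_times) (auto simp: sqf_def upclosed_def)

lemma gmod_sqf: "upclosed U \<Longrightarrow> gmod (*) n (hpoly n) (sqf n U)"
  by (intro gmod_hpoly sqf_zero sqf_minus sqf_X)

lemma upclosed_empty: "upclosed {}"
  by (simp add: upclosed_def)

lemma sqf_empty: "sqf n {} = {0}"
  by (auto simp: sqf_def simp flip: keys_eq_empty)

lemma chain_polys: "c \<in> hchain n p j \<Longrightarrow> c S \<in> polys n"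
  using chainD1[of c n "hpoly n" p j S] chainD0[of c n "hpoly n" p j S]
  by (cases "S \<subseteq> {1..n} \<and> card S = p") (auto simp: hpoly_polys)

lemma bd_polys: "(\<And>S. g S \<in> polys n) \<Longrightarrow> hbd n g S \<in> polys n"
  unfolding bd_def
proof (intro polys_sum polys_mult polys_X)
  show "(- 1) ^ k \<in> polys n" for k
    by (cases "even k") (auto simp: polys_uminus)
qed auto

lemma restr_chain: "c \<in> hchain n p j \<Longrightarrow> (\<lambda>S. restr P (c S)) \<in> hchain n p j"
  by (auto simp: chain_def)

lemma quo_chain:
  assumes "c \<in> hchain n p j"
  shows "(\<lambda>S. quo s (c S)) \<in> hchain n p (j - 1)"
proof (rule chainI)
  fix S :: "nat set" assume "S \<subseteq> {1..n}" "card S = p"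
  from hpoly_quo[OF chainD1[OF assms this], of s]
  show "quo s (c S) \<in> hpoly n (j - 1 - int p)" by (simp add: algebra_simps)
qed (simp add: chainD0[OF assms])

lemma X_times_chain:
  assumes "c \<in> hchain n p (j - 1)" "s \<in> {1..n}"
  shows "(\<lambda>S. X s * c S) \<in> hchain n p j"
proof (rule chainI)
  fix S :: "nat set" assume "S \<subseteq> {1..n}" "card S = p"
  from hpoly_X_times[OF assms(2) chainD1[OF assms(1) this]]
  show "X s * c S \<in> hpoly n (j - int p)" by (simp add: algebra_simps)
qed (simp add: chainD0[OF assms(1)])

lemma bd_X_times: "hbd n (\<lambda>S. X s * c S) T = X s * hbd n c T"
  by (simp add: bd_def sum_distrib_left mult_ac)

lemma restr_sqf: "p \<in> polys n \<Longrightarrow> restr (\<lambda>m. keys m \<in> U) p \<in> sqf n U"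
  by (auto simp: sqf_def keys_restr)

lemma minus_restr_sqf: "p \<in> sqf n (U \<union> V) \<Longrightarrow> p - restr (\<lambda>m. keys m \<in> U) p \<in> sqf n V"
  by (auto simp: sqf_def in_keys_iff lookup_minus lookup_restr split: if_splits)

text \<open>Mayer-Vietoris for
  \<open>0 -> R/(I \<inter> J) -> R/I \<oplus> R/J -> R/(I + J) -> 0\<close>. Sums and intersections
  of these ideals are unions and intersections of set systems. The connecting map lowers the index
  by one, hence the slack of one for the intersection.\<close>

lemma reg_le_sqf_Un:
  fixes r :: int
  assumes "upclosed U" "upclosed V"
    and U: "reg_le n (sqf n U :: 'a::field mpoly set) r" and V: "reg_le n (sqf n V :: 'a mpoly set) r"
    and UV: "reg_le n (sqf n (U \<inter> V) :: 'a mpoly set) (r + 1)"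
  shows "reg_le n (sqf n (U \<union> V) :: 'a mpoly set) r"
  unfolding reg_le_def acyc_def
proof (intro allI impI ballI)
  fix i j and c :: "nat set \<Rightarrow> 'a mpoly"
  assume j: "r + int i < j" and c: "c \<in> hchain n i j" and cyc: "\<forall>S. hbd n c S \<in> sqf n (U \<union> V)"
  interpret U: gmod "(*)" n "hpoly n" "sqf n U :: 'a mpoly set" by (rule gmod_sqf) fact
  interpret V: gmod "(*)" n "hpoly n" "sqf n V :: 'a mpoly set" by (rule gmod_sqf) fact
  interpret W: gmod "(*)" n "hpoly n" "sqf n (U \<union> V) :: 'a mpoly set"
    by (rule gmod_sqf) (use assms(1,2) in \<open>auto simp: upclosed_def\<close>)
  show "\<exists>f\<in>hchain n (Suc i) j. \<forall>S. c S - hbd n f S \<in> sqf n (U \<union> V)"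
  proof (cases i)
    case 0
    have "hbd n c S \<in> sqf n U" for S
      using U.bd_chain_0[of c j S] c 0 sqf_zero by simp
    then obtain f where "f \<in> hchain n (Suc i) j" "\<And>S. c S - hbd n f S \<in> sqf n U"
      using reg_leD[OF U j] c unfolding acyc_def by blast
    then show ?thesis using sqf_mono[of _ n U "U \<union> V"] by blast
  next
    case (Suc i')
    \<comment> \<open>Split the boundary by monomials into a part in \<open>sqf n U\<close> and a
      rest in \<open>sqf n V\<close>; \<open>p\<close> represents the image under the connecting
      map.\<close>
    define p where "p S = restr (\<lambda>m. keys m \<in> U) (hbd n c S)" for S
    define q where "q S = hbd n c S - p S" for S
    have bdc: "hbd n c \<in> hchain n i' j" using U.bd_chain c Suc by simp
    then have p: "p \<in> hchain n i' j" unfolding p_def by (rule restr_chain)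
    have pU: "p S \<in> sqf n U" for S
      unfolding p_def by (intro restr_sqf chain_polys[OF bdc])
    have qV: "q S \<in> sqf n V" for S
      unfolding q_def p_def using cyc by (intro minus_restr_sqf) auto
    have "hbd n q S = hbd n (hbd n c) S - hbd n p S" for S
      unfolding q_def by (rule U.bd_minus)
    then have "hbd n p S = - hbd n q S" for S
      using U.bd_bd[OF c] by simp
    then have "hbd n p S \<in> sqf n V" for S
      using V.bd_N[of q S] qV V.N_uminus by simp
    moreover have "hbd n p S \<in> sqf n U" for S
      using pU by (rule U.bd_N)
    ultimately have "hbd n p S \<in> sqf n (U \<inter> V)" for S
      by (auto simp: sqf_def)
    then obtain h where h: "h \<in> hchain n (Suc i') j" "\<And>S. p S - hbd n h S \<in> sqf n (U \<inter> V)"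
      using reg_leD[OF UV, of i' j] p j Suc unfolding acyc_def by force
    \<comment> \<open>Once \<open>p\<close> bounds modulo the intersection, \<open>c\<close> is the
      sum of \<open>c - h\<close>, a cycle modulo \<open>sqf n V\<close>, and \<open>h\<close>, a
      cycle modulo \<open>sqf n U\<close>.\<close>
    have "hbd n (\<lambda>S. c S - h S) S = q S + (p S - hbd n h S)" for S
      by (simp add: U.bd_minus q_def)
    then have "hbd n (\<lambda>S. c S - h S) S \<in> sqf n V" for S
      using V.N_add[OF qV sqf_mono[OF h(2)]] by auto
    moreover have "(\<lambda>S. c S - h S) \<in> hchain n i j"
      using c h Suc by (intro U.chain_minus) auto
    ultimately obtain f where f: "f \<in> hchain n (Suc i) j" "\<And>S. c S - h S - hbd n f S \<in> sqf n V"
      using reg_leD[OF V j] unfolding acyc_def by blast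
    have "hbd n h S \<in> sqf n U" for S
      using U.N_minus[OF pU[of S] sqf_mono[OF h(2)[of S]]] by auto
    then obtain g where g: "g \<in> hchain n (Suc i) j" "\<And>S. h S - hbd n g S \<in> sqf n U"
      using reg_leD[OF U j] h(1) Suc unfolding acyc_def by blast
    have eq: "c S - hbd n (\<lambda>S. f S + g S) S = (c S - h S - hbd n f S) + (h S - hbd n g S)" for S
      by (simp add: U.bd_add)
    have "c S - hbd n (\<lambda>S. f S + g S) S \<in> sqf n (U \<union> V)" for S
      unfolding eq by (intro W.N_add sqf_mono[OF f(2)] sqf_mono[OF g(2)]) auto
    with U.chain_add[OF f(1) g(1)] show ?thesis by blast
  qed
qed

text \<open>Long exact sequence of \<open>0 -> R/(J : x)(-1) -> R/J -> R/(J + (x)) -> 0\<close>: the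
  two set systems describe the colon ideal and the sum, and the twist by one accounts for
  \<open>r - 1\<close>.\<close>

lemma reg_le_sqf_colon:
  fixes r :: int
  assumes "upclosed U" and x: "x \<in> {1..n}"
    and col: "reg_le n (sqf n {A. insert x A \<in> U} :: 'a::field mpoly set) (r - 1)"
    and add: "reg_le n (sqf n ({A. x \<in> A} \<union> U) :: 'a mpoly set) r"
  shows "reg_le n (sqf n U :: 'a mpoly set) r"
  unfolding reg_le_def acyc_def
proof (intro allI impI ballI)
  fix i j and c :: "nat set \<Rightarrow> 'a mpoly"
  assume j: "r + int i < j" and c: "c \<in> hchain n i j" and cyc: "\<forall>S. hbd n c S \<in> sqf n U"
  interpret U: gmod "(*)" n "hpoly n" "sqf n U :: 'a mpoly set" by (rule gmod_sqf) fact
  have "hbd n c S \<in> sqf n ({A. x \<in> A} \<union> U)" for S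
    using cyc by (auto intro: sqf_mono)
  then obtain f where f: "f \<in> hchain n (Suc i) j"
      "\<And>S. c S - hbd n f S \<in> sqf n ({A. x \<in> A} \<union> U)"
    using reg_leD[OF add j] c unfolding acyc_def by blast
  define w where "w S = c S - hbd n f S" for S
  have w: "w \<in> hchain n i j"
    unfolding w_def by (intro U.chain_minus c U.bd_chain f)
  \<comment> \<open>Up to an element of the ideal, the chain \<open>w\<close> is divisible by
    \<open>x\<close>, and the quotient \<open>g\<close> is a cycle modulo the colon ideal.\<close>
  define a where "a S = restr (\<lambda>m. keys m \<in> U) (w S)" for S
  have aU: "a S \<in> sqf n U" for S
    unfolding a_def by (intro restr_sqf chain_polys[OF w])
  have ac: "a \<in> hchain n i j" unfolding a_def using w by (rule restr_chain)
  have wa: "w S - a S \<in> sqf n {A. x \<in> A}" for S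
    unfolding a_def using f(2)[of S] by (intro minus_restr_sqf) (simp add: w_def Un_commute)
  define g where "g S = quo x (w S - a S)" for S
  have g: "g \<in> hchain n i (j - 1)"
    unfolding g_def by (intro quo_chain U.chain_minus w ac)
  have Xg: "X x * g S = w S - a S" for S
    unfolding g_def X_times_quo using wa[of S]
    by (intro poly_mapping_eqI) (auto simp: lookup_restr sqf_def in_keys_iff[symmetric] simp flip: not_in_keys_iff_lookup_eq_zero)
  have colU: "p \<in> sqf n {A. insert x A \<in> U}" if "X x * p \<in> sqf n U" "p \<in> polys n" for p :: "'a mpoly"
  proof -
    have "insert x (keys m) \<in> U" if "m \<in> keys p" for m
    proof -
      have "m + xv x \<in> keys (X x * p)" using that by (auto simp: keys_X_times)
      then have "keys (m + xv x) \<in> U" using \<open>X x * p \<in> sqf n U\<close> unfolding sqf_def by blast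
      then show ?thesis by (simp add: keys_plus_nat)
    qed
    then show ?thesis using that(2) by (simp add: sqf_def)
  qed
  have Ucol: "X x * p \<in> sqf n U" if "p \<in> sqf n {A. insert x A \<in> U}" for p :: "'a mpoly"
    using that x by (intro sqf_X_times) (auto simp: sqf_def)
  have "X x * hbd n g S = hbd n w S - hbd n a S" for S
    by (simp add: Xg U.bd_minus flip: bd_X_times)
  moreover have "hbd n w S \<in> sqf n U" for S
    using cyc U.bd_bd[OF f(1)] unfolding w_def U.bd_minus by simp
  ultimately have "X x * hbd n g S \<in> sqf n U" for S
    using U.bd_N[OF aU] by (simp add: sqf_minus)
  moreover have "hbd n g S \<in> polys n" for S
    by (intro bd_polys chain_polys[OF g])
  ultimately have "hbd n g S \<in> sqf n {A. insert x A \<in> U}" for S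
    using colU by blast
  then obtain h where h: "h \<in> hchain n (Suc i) (j - 1)"
      "\<And>S. g S - hbd n h S \<in> sqf n {A. insert x A \<in> U}"
    using reg_leD[OF col, of i "j - 1"] g j unfolding acyc_def by force
  have eq: "c S - hbd n (\<lambda>S. f S + X x * h S) S = a S + X x * (g S - hbd n h S)" for S
    using Xg[of S] by (simp add: U.bd_add bd_X_times w_def algebra_simps)
  have "c S - hbd n (\<lambda>S. f S + X x * h S) S \<in> sqf n U" for S
    unfolding eq by (intro U.N_add aU Ucol h(2))
  with U.chain_add[OF f(1) X_times_chain[OF h(1) x]]
  show "\<exists>f\<in>hchain n (Suc i) j. \<forall>S. c S - hbd n f S \<in> sqf n U" by blast
qed

lemma reg_le_sqf_empty: "reg_le n (sqf n {} :: 'a::field mpoly set) 0"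
  unfolding reg_le_def acyc_def
proof (intro allI impI ballI)
  fix i j and c :: "nat set \<Rightarrow> 'a mpoly"
  assume j: "0 + int i < j" and c: "c \<in> hchain n i j" and cyc: "\<forall>S. hbd n c S \<in> sqf n {}"
  have c': "c \<in> chain n (\<lambda>d. hpoly n (d - 0)) i j" using c by simp
  have const: "lookup (c {}) 0 = 0" if "i = 0"
  proof -
    have "c {} \<in> hpoly n j" using chainD1[OF c, of "{}"] that by simp
    then have "0 \<notin> keys (c {})" using j by (auto simp: hpoly_def homogeneous_def)
    then show ?thesis by (simp add: in_keys_iff)
  qed
  have "hbd n (homotopy n c) S = c S" for S
    using cyc const by (intro koszul_exact[OF c']) (auto simp: sqf_empty)
  with homotopy_chain[OF c'] show "\<exists>f\<in>hchain n (Suc i) j. \<forall>S. c S - hbd n f S \<in> sqf n {}"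
    by (intro bexI[of _ "homotopy n c"]) (auto simp: sqf_empty)
qed

text \<open>Long exact sequence of multiplication by \<open>x\<close> on R.
  \<open>reg_le_sqf_colon\<close> gives nothing here, since its third term would again be
  R/(x).\<close>

lemma reg_le_sqf_variable:
  assumes x: "x \<in> {1..n}"
  shows "reg_le n (sqf n {A. x \<in> A} :: 'a::field mpoly set) 0"
  unfolding reg_le_def acyc_def
proof (intro allI impI ballI)
  fix i j and c :: "nat set \<Rightarrow> 'a mpoly"
  assume j: "0 + int i < j" and c: "c \<in> hchain n i j" and cyc: "\<forall>S. hbd n c S \<in> sqf n {A. x \<in> A}"
  interpret E: gmod "(*)" n "hpoly n" "sqf n {} :: 'a mpoly set" by (intro gmod_sqf upclosed_empty)
  have exact: "\<exists>f\<in>hchain n (Suc p) k. \<forall>S. d S = hbd n f S"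
    if "int p < k" "d \<in> hchain n p k" "\<And>S. hbd n d S = 0" for p k and d :: "nat set \<Rightarrow> 'a mpoly"
  proof -
    have "hacyc n {0 :: 'a mpoly} p k"
      using reg_leD[OF reg_le_sqf_empty, of p k n] that(1) by (simp add: sqf_empty)
    then show ?thesis using that(2,3) unfolding acyc_def by simp
  qed
  show "\<exists>f\<in>hchain n (Suc i) j. \<forall>S. c S - hbd n f S \<in> sqf n {A. x \<in> A}"
  proof (cases i)
    case 0
    then have "hbd n c S = 0" for S using E.bd_chain_0[of c j S] c by simp
    then obtain f where f: "f \<in> hchain n (Suc i) j" "\<And>S. c S = hbd n f S"
      using exact[of i j c] c j by auto
    have "c S - hbd n f S \<in> sqf n {A. x \<in> A}" for S by (simp add: f(2) sqf_zero)
    with f(1) show ?thesis by blast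
  next
    case (Suc i')
    have bdc: "hbd n c \<in> hchain n i' j" using E.bd_chain c Suc by simp
    define e where "e S = quo x (hbd n c S)" for S
    have e: "e \<in> hchain n i' (j - 1)" unfolding e_def using bdc by (rule quo_chain)
    have Xe: "X x * e S = hbd n c S" for S
      unfolding e_def X_times_quo using cyc[rule_format, of S]
      by (intro poly_mapping_eqI) (auto simp: lookup_restr sqf_def in_keys_iff[symmetric] simp flip: not_in_keys_iff_lookup_eq_zero)
    have "X x * hbd n e S = X x * 0" for S
      using E.bd_bd[OF c] by (simp add: Xe flip: bd_X_times)
    then have "hbd n e S = 0" for S by (simp only: X_times_cancel)
    then obtain h where h: "h \<in> hchain n (Suc i') (j - 1)" "\<And>S. e S = hbd n h S"
      using exact[of i' "j - 1" e] e j Suc by auto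
    have d: "(\<lambda>S. c S - X x * h S) \<in> hchain n i j"
      using c X_times_chain[OF h(1) x] Suc by (intro E.chain_minus) auto
    moreover have "hbd n (\<lambda>S. c S - X x * h S) S = 0" for S
      by (simp add: E.bd_minus bd_X_times Xe flip: h(2))
    ultimately obtain f where f: "f \<in> hchain n (Suc i) j" "\<And>S. c S - X x * h S = hbd n f S"
      using exact[of i j "\<lambda>S. c S - X x * h S"] j by auto
    have "c S - hbd n f S \<in> sqf n {A. x \<in> A}" for S
    proof -
      have "c S - hbd n f S = X x * h S" by (simp flip: f(2))
      then show ?thesis
        using sqf_X_times[OF x chain_polys[OF h(1)], of _ "{A. x \<in> A}"] by simp
    qed
    with f(1) show ?thesis by blast
  qed
qed

lemma reg_le_sqf_UNIV: "reg_le n (sqf n UNIV :: 'a::field mpoly set) r"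
  unfolding reg_le_def acyc_def
proof (intro allI impI ballI)
  fix i j and c :: "nat set \<Rightarrow> 'a mpoly"
  assume c: "c \<in> hchain n i j"
  have "(\<lambda>_. 0) \<in> hchain n (Suc i) j" by (auto simp: chain_def)
  moreover have "c S - hbd n (\<lambda>_. 0) S \<in> sqf n UNIV" for S
    using chain_polys[OF c] by (simp add: sqf_def bd_def)
  ultimately show "\<exists>f\<in>hchain n (Suc i) j. \<forall>S. c S - hbd n f S \<in> sqf n UNIV" by blast
qed

text \<open>Multiply by one variable of \<open>M\<close> at a time. The ideal of \<open>U\<close>
  does not involve these variables, so the colon by the new one undoes the multiplication, while
  adding it leaves only \<open>(x)\<close>, of regularity 0. The condition
  \<open>- 1 \<le> r\<close> keeps the bound nonnegative from the first factor on and admits the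
  unit ideal.\<close>

lemma reg_le_sqf_multiple:
  fixes r :: int
  assumes "finite M" "M \<subseteq> {1..n}" "upclosed U" "\<And>x A. x \<in> M \<Longrightarrow> insert x A \<in> U \<Longrightarrow> A \<in> U"
    and "- 1 \<le> r" "reg_le n (sqf n U :: 'a::field mpoly set) r"
  shows "reg_le n (sqf n {A. M \<subseteq> A \<and> A \<in> U} :: 'a mpoly set) (r + int (card M))"
  using assms(1,2,4)
proof (induction M)
  case empty
  then show ?case using assms by simp
next
  case (insert x M)
  let ?W = "{A. insert x M \<subseteq> A \<and> A \<in> U}"
  have 1: "{A. insert x A \<in> ?W} = {A. M \<subseteq> A \<and> A \<in> U}"
    using insert assms(3) by (auto simp: upclosed_def)
  have 2: "{A. x \<in> A} \<union> ?W = {A. x \<in> A}" by auto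
  have "reg_le n (sqf n {A. M \<subseteq> A \<and> A \<in> U} :: 'a mpoly set) (r + int (card M))"
    using insert by auto
  moreover have "r + int (card (insert x M)) - 1 = r + int (card M)"
    using insert.hyps by simp
  ultimately have col: "reg_le n (sqf n {A. insert x A \<in> ?W} :: 'a mpoly set) (r + int (card (insert x M)) - 1)"
    by (simp only: 1)
  have x: "x \<in> {1..n}" using insert.prems(1) by blast
  have "0 \<le> r + int (card (insert x M))" using assms(5) insert.hyps by simp
  then have add: "reg_le n (sqf n ({A. x \<in> A} \<union> ?W) :: 'a mpoly set) (r + int (card (insert x M)))"
    unfolding 2 by (rule reg_le_mono[OF reg_le_sqf_variable[OF x]])
  have "upclosed ?W" using assms(3) by (auto simp: upclosed_def)
  then show ?case by (rule reg_le_sqf_colon[OF _ x col add])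
qed

text \<open>\<open>A\<close> contains \<open>k\<close> disjoint intervals of length \<open>t\<close> inside \<open>{1..m}\<close>, chosen from right to left.\<close>

primrec packs :: "nat \<Rightarrow> nat \<Rightarrow> nat \<Rightarrow> nat set \<Rightarrow> bool" where
  "packs t 0 m A \<longleftrightarrow> True"
| "packs t (Suc k) m A \<longleftrightarrow> (\<exists>i\<ge>1. i + t \<le> m + 1 \<and> {i..<i + t} \<subseteq> A \<and> packs t k (i - 1) A)"

section \<open>Combinatorics of disjoint intervals\<close>

lemma packs_mono: "packs t k m A \<Longrightarrow> m \<le> m' \<Longrightarrow> A \<subseteq> B \<Longrightarrow> packs t k m' B"
proof (induction k arbitrary: m m')
  case (Suc k)
  then obtain i where "i \<ge> 1" "i + t \<le> m + 1" "{i..<i + t} \<subseteq> A" "packs t k (i - 1) A" by auto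
  with Suc show ?case by (auto intro!: exI[of _ i])
qed simp

lemma packs_insert_greater: "packs t k m (insert x A) \<Longrightarrow> m < x \<Longrightarrow> packs t k m A"
proof (induction k arbitrary: m)
  case (Suc k)
  then obtain i where i: "i \<ge> 1" "i + t \<le> m + 1" "{i..<i + t} \<subseteq> insert x A" "packs t k (i - 1) (insert x A)"
    by auto
  then have "{i..<i + t} \<subseteq> A" using Suc.prems(2) by (auto simp: subset_insert_iff)
  moreover have "packs t k (i - 1) A" using i Suc.prems(2) by (intro Suc.IH) auto
  ultimately show ?case using i by (auto intro!: exI[of _ i])
qed simp

lemma packs_size: "packs t k m A \<Longrightarrow> 1 \<le> t \<Longrightarrow> k * t \<le> m"
proof (induction k arbitrary: m)
  case (Suc k)
  then obtain i where i: "i \<ge> 1" "i + t \<le> m + 1" "packs t k (i - 1) A" by auto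
  with Suc.IH[of "i - 1"] Suc.prems show ?case by simp
qed simp

lemma packs_Suc_imp: "packs t (Suc k) m A \<Longrightarrow> packs t k (m - t) A"
  by (auto intro: packs_mono)

lemma upclosed_packs: "upclosed {A. packs t k m A}"
  by (auto simp: upclosed_def intro: packs_mono)

lemma packs_split:
  assumes "1 \<le> t" "t \<le> m"
  shows "packs t (Suc k) m A \<longleftrightarrow> packs t (Suc k) (m - 1) A \<or> {m + 1 - t..m} \<subseteq> A \<and> packs t k (m - t) A"
proof
  assume "packs t (Suc k) m A"
  then obtain i where i: "i \<ge> 1" "i + t \<le> m + 1" "{i..<i + t} \<subseteq> A" "packs t k (i - 1) A" by auto
  show "packs t (Suc k) (m - 1) A \<or> {m + 1 - t..m} \<subseteq> A \<and> packs t k (m - t) A"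
  proof (cases "i + t = m + 1")
    case True
    then have "i = m + 1 - t" "{i..<i + t} = {m + 1 - t..m}" by auto
    with i show ?thesis by simp
  next
    case False
    with i have "packs t (Suc k) (m - 1) A" by (auto intro!: exI[of _ i])
    then show ?thesis ..
  qed
next
  assume "packs t (Suc k) (m - 1) A \<or> {m + 1 - t..m} \<subseteq> A \<and> packs t k (m - t) A"
  then show "packs t (Suc k) m A"
  proof
    assume "packs t (Suc k) (m - 1) A"
    then show ?thesis by (rule packs_mono) auto
  next
    assume *: "{m + 1 - t..m} \<subseteq> A \<and> packs t k (m - t) A"
    moreover have "{m + 1 - t..<m + 1 - t + t} = {m + 1 - t..m}" "m + 1 - t - 1 = m - t"
      using assms by auto
    ultimately show ?thesis using assms by (simp only: packs.simps) (intro exI[of _ "m + 1 - t"], simp)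
  qed
qed

text \<open>When the last \<open>t\<close> positions are all present, the rightmost chosen interval
  either ends before \<open>m - t\<close> or contains \<open>m - t\<close>, and then it can be
  shifted right to start there. This computes the intersection of the two summands of the
  ideal.\<close>

lemma packs_before_full_interval:
  assumes "1 \<le> t" "t \<le> m" "{m + 1 - t..m} \<subseteq> A"
  shows "packs t (Suc k) (m - 1) A \<longleftrightarrow>
    (t < m \<and> m - t \<in> A \<and> packs t k (m - t - 1) A) \<or> packs t (Suc k) (m - t - 1) A"
proof
  assume "packs t (Suc k) (m - 1) A"
  then obtain i where i: "i \<ge> 1" "i + t \<le> m" "{i..<i + t} \<subseteq> A" "packs t k (i - 1) A"
    using assms by auto
  show "(t < m \<and> m - t \<in> A \<and> packs t k (m - t - 1) A) \<or> packs t (Suc k) (m - t - 1) A"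
  proof (cases "i + t \<le> m - t")
    case True
    with i have "packs t (Suc k) (m - t - 1) A" by (auto intro!: exI[of _ i])
    then show ?thesis ..
  next
    case False
    with i have "m - t \<in> {i..<i + t}" by auto
    moreover have "packs t k (m - t - 1) A" using i(2,4) by (auto elim: packs_mono)
    ultimately show ?thesis using i by auto
  qed
next
  assume "(t < m \<and> m - t \<in> A \<and> packs t k (m - t - 1) A) \<or> packs t (Suc k) (m - t - 1) A"
  then show "packs t (Suc k) (m - 1) A"
  proof
    assume *: "t < m \<and> m - t \<in> A \<and> packs t k (m - t - 1) A"
    have "{m - t..<m - t + t} \<subseteq> insert (m - t) {m + 1 - t..m}"
    proof
      fix x assume "x \<in> {m - t..<m - t + t}"
      then show "x \<in> insert (m - t) {m + 1 - t..m}"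
        using assms(2) by (cases "x = m - t") auto
    qed
    with * assms have "{m - t..<m - t + t} \<subseteq> A" by blast
    with * show ?thesis by (auto intro!: exI[of _ "m - t"])
  next
    assume "packs t (Suc k) (m - t - 1) A"
    then show ?thesis by (rule packs_mono) auto
  qed
qed

text \<open>An induced matching of the path spends \<open>t + 1\<close> vertices per edge, except
  that the last edge needs no separator; hence \<open>a + 1\<close>. For \<open>t = 1\<close> the
  matching count is a different one, but the factor \<open>t - 1\<close> vanishes.\<close>

definition reg_path :: "nat \<Rightarrow> nat \<Rightarrow> int"
  where "reg_path t a = int ((t - 1) * ((a + 1) div (t + 1)))"

lemma reg_path_nonneg: "0 \<le> reg_path t a"
  by (simp add: reg_path_def)

lemma reg_path_mono: "a \<le> b \<Longrightarrow> reg_path t a \<le> reg_path t b"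
  by (simp add: reg_path_def mult_le_mono div_le_mono del: of_nat_mult of_nat_diff)

lemma reg_path_step:
  assumes "1 \<le> t" "t + 1 \<le> a"
  shows "reg_path t a = int t - 1 + reg_path t (a - t - 1)"
proof -
  have eq: "(a + 1) div (t + 1) = Suc ((a - t - 1 + 1) div (t + 1))"
  proof -
    have "a - t - 1 + 1 = a - t" using assms by simp
    then show ?thesis using assms div_add_self1[of "t + 1" "a - t"] by simp
  qed
  show ?thesis unfolding reg_path_def eq mult_Suc_right of_nat_add using assms by simp
qed

lemma reg_path_ge:
  assumes "1 \<le> t" "t \<le> a" shows "int t - 1 \<le> reg_path t a"
proof -
  have "1 \<le> (a + 1) div (t + 1)" using assms by (simp add: Suc_le_eq div_greater_zero_iff)
  then have "t - 1 \<le> (t - 1) * ((a + 1) div (t + 1))" by simp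
  then show ?thesis using assms unfolding reg_path_def by linarith
qed

text \<open>The value 0 is the regularity of R/0, for the case that no packing fits. The parameter
  is \<open>Suc k\<close> because zero intervals give the unit ideal, which does not follow the
  formula and is treated apart in the steps that drop an interval.\<close>

lemma reg_le_packs:
  assumes t: "1 \<le> t"
  shows "m \<le> n \<Longrightarrow> reg_le n (sqf n {A. packs t (Suc k) m A} :: 'a::field mpoly set)
    (if Suc k * t \<le> m then int (k * t) + reg_path t (m - k * t) else 0)"
proof (induction m arbitrary: k rule: less_induct)
  case (less m)
  define R where "R k m = (if Suc k * t \<le> m then int (k * t) + reg_path t (m - k * t) else 0)" for k m
  have IH: "reg_le n (sqf n {A. packs t (Suc k) m' A} :: 'a mpoly set) (R k m')" if "m' < m" for m' k
    using less.IH[OF that, of k] that less.prems unfolding R_def by simp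
  show ?case
  proof (cases "Suc k * t \<le> m")
    case False
    then have "{A. packs t (Suc k) m A} = {}" using packs_size[OF _ t] by blast
    then show ?thesis using False reg_le_sqf_empty by (simp only: if_False)
  next
    case True
    then have tm: "t \<le> m" by simp
    define r where "r = int (k * t) + reg_path t (m - k * t)"
    have rt: "int (k * t) + int t - 1 \<le> r"
      using reg_path_ge[OF t, of "m - k * t"] True by (simp add: r_def)
    have rt': "int t - 1 \<le> r"
      using rt of_nat_0_le_iff[of "k * t", where ?'a = int] by linarith
    define M where "M = {m + 1 - t..m}"
    have M: "finite M" "M \<subseteq> {1..n}" "card M = t"
      using t tm less.prems by (auto simp: M_def)
    define x where "x = m - t"
    define U2 where "U2 = {A. M \<subseteq> A \<and> A \<in> {A. packs t k (m - t) A}}"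
    \<comment> \<open>\<open>L1\<close> and \<open>L2\<close> together form the cofactor of
      \<open>M\<close> in the intersection of the two summands. The guard covers
      \<open>m = t\<close>, where \<open>x = 0\<close> is not a variable.\<close>
    define L1 where "L1 = {A. x \<ge> 1 \<and> x \<in> A \<and> packs t k (x - 1) A}"
    define L2 where "L2 = {A. packs t (Suc k) (x - 1) A}"
    have up: "upclosed U2" "upclosed L1" "upclosed L2" "upclosed (L1 \<union> L2)"
      by (auto simp: upclosed_def U2_def L1_def L2_def simp del: packs.simps intro: packs_mono)
    have indep: "A \<in> {A. packs t j y A}" if "insert z A \<in> {A. packs t j y A}" "y < z" for A z y j
      using packs_insert_greater[of t j y z A] that by simp
    have R_nonneg: "0 \<le> R k m'" for k m'
      unfolding R_def by (auto intro!: add_nonneg_nonneg simp: reg_path_nonneg simp del: of_nat_mult)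
    then have R_ge: "- 1 \<le> R k m'" for k m' by (rule order_trans[rotated]) simp
    \<comment> \<open>No intervals: the unit ideal. Its bound \<open>- 1\<close> makes a monomial of
      degree \<open>t\<close> cost \<open>t - 1\<close>.\<close>
    have trivial: "reg_le n (sqf n {A. packs t k y A} :: 'a mpoly set) (- 1)" if "k = 0" for y
      using reg_le_sqf_UNIV by (simp only: that packs.simps Collect_const if_True)
    have U1: "reg_le n (sqf n {A. packs t (Suc k) (m - 1) A} :: 'a mpoly set) r"
    proof (rule reg_le_mono[OF IH])
      show "R k (m - 1) \<le> r"
        using rt reg_path_mono[of "m - 1 - k * t" "m - k * t" t] t by (auto simp: R_def r_def)
    qed (use t tm in auto)
    have U2: "reg_le n (sqf n U2 :: 'a mpoly set) r"
    proof (cases k)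
      case 0
      have "reg_le n (sqf n U2 :: 'a mpoly set) (- 1 + int (card M))"
        unfolding U2_def by (rule reg_le_sqf_multiple[OF M(1,2) upclosed_packs _ _ trivial[OF 0]]) (simp_all add: 0)
      then show ?thesis by (rule reg_le_mono) (use rt 0 M in simp)
    next
      case (Suc k')
      have "reg_le n (sqf n U2 :: 'a mpoly set) (R k' (m - t) + int (card M))"
        unfolding U2_def
      proof (rule reg_le_sqf_multiple[OF M(1,2) upclosed_packs])
        show "reg_le n (sqf n {A. packs t k (m - t) A} :: 'a mpoly set) (R k' (m - t))"
          unfolding Suc by (rule IH) (use t tm in auto)
      qed (use indep t tm R_ge in \<open>auto simp: M_def\<close>)
      moreover have "R k' (m - t) + int (card M) = r"
      proof -
        have "Suc k' * t \<le> m - t" using True Suc by simp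
        moreover have "m - t - k' * t = m - k * t" using Suc by simp
        ultimately show ?thesis using Suc M by (simp add: R_def r_def)
      qed
      ultimately show ?thesis by simp
    qed
    \<comment> \<open>The target is \<open>r + 1 - t\<close>: multiplication by \<open>M\<close>
      adds \<open>t\<close>, and Mayer-Vietoris tolerates \<open>r + 1\<close>. Since
      \<open>L2\<close> lives on \<open>t + 1\<close> fewer vertices, \<open>reg_path_step\<close>
      gives exactly the difference \<open>t - 1\<close>.\<close>
    have L2: "reg_le n (sqf n L2 :: 'a mpoly set) (r + 1 - int t)"
      unfolding L2_def
    proof (rule reg_le_mono[OF IH])
      show "R k (x - 1) \<le> r + 1 - int t"
      proof (cases "Suc k * t \<le> x - 1")
        case True
        then have "t + 1 \<le> m - k * t" "x - 1 - k * t = m - k * t - t - 1"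
          using t by (auto simp: x_def)
        with True show ?thesis
          using reg_path_step[OF t, of "m - k * t"] by (simp add: R_def r_def)
      qed (use rt' in \<open>auto simp: R_def\<close>)
    qed (use t tm in \<open>auto simp: x_def\<close>)
    have L1: "reg_le n (sqf n L1 :: 'a mpoly set) (r + 1 - int t)"
    proof (cases "x \<ge> 1")
      case False
      then have "L1 = {}" by (auto simp: L1_def)
      then show ?thesis using rt' by (auto intro: reg_le_mono[OF reg_le_sqf_empty])
    next
      case x1: True
      have L1': "L1 = {A. {x} \<subseteq> A \<and> A \<in> {A. packs t k (x - 1) A}}"
        using x1 by (auto simp: L1_def)
      have xn: "{x} \<subseteq> {1..n}" using x1 less.prems by (auto simp: x_def)
      show ?thesis
      proof (cases k)
        case 0
        have "reg_le n (sqf n L1 :: 'a mpoly set) (- 1 + int (card {x}))"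
          unfolding L1' by (rule reg_le_sqf_multiple[OF _ xn upclosed_packs _ _ trivial[OF 0]]) (simp_all add: 0)
        then show ?thesis by (rule reg_le_mono) (use rt 0 in simp)
      next
        case (Suc k')
        have "reg_le n (sqf n L1 :: 'a mpoly set) (R k' (x - 1) + int (card {x}))"
          unfolding L1'
        proof (rule reg_le_sqf_multiple[OF _ xn upclosed_packs])
          show "reg_le n (sqf n {A. packs t k (x - 1) A} :: 'a mpoly set) (R k' (x - 1))"
            unfolding Suc by (rule IH) (use t tm in \<open>auto simp: x_def\<close>)
        qed (use indep x1 R_ge in auto)
        \<comment> \<open>Here \<open>k = Suc k'\<close> and \<open>x - 1 - k' * t\<close> equals
          \<open>m - k * t - 1\<close>. The interval given up lowers the first summand by
          \<open>t\<close>, so monotonicity of \<open>reg_path\<close> suffices.\<close>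
        moreover have "R k' (x - 1) + int (card {x}) \<le> r + 1 - int t"
        proof (cases "Suc k' * t \<le> x - 1")
          case True
          have "reg_path t (x - 1 - k' * t) \<le> reg_path t (m - k * t)"
            using Suc by (intro reg_path_mono) (auto simp: x_def)
          with True Suc show ?thesis by (simp add: R_def r_def)
        next
          case False
          have "int t \<le> int (k * t)" unfolding Suc by (simp only: of_nat_le_iff mult_Suc le_add1)
          then have "int t \<le> r" using rt t by linarith
          with False show ?thesis by (simp add: R_def)
        qed
        ultimately show ?thesis by (rule reg_le_mono)
      qed
    qed
    \<comment> \<open>A packing by \<open>Suc k\<close> intervals contains one by \<open>k\<close>,
      so the intersection is just \<open>x\<close> times \<open>L2\<close> and costs one degree
      more.\<close>
    have L12: "reg_le n (sqf n (L1 \<inter> L2) :: 'a mpoly set) (r + 1 - int t + 1)"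
    proof (cases "x \<ge> 1")
      case False
      then have "L1 \<inter> L2 = {}" by (auto simp: L1_def)
      then show ?thesis using rt' by (auto intro: reg_le_mono[OF reg_le_sqf_empty])
    next
      case x1: True
      have xn: "{x} \<subseteq> {1..n}" using x1 less.prems by (auto simp: x_def)
      have "packs t k (x - 1) A" if "packs t (Suc k) (x - 1) A" for A
        using packs_Suc_imp[OF that] by (rule packs_mono) auto
      then have eq: "L1 \<inter> L2 = {A. {x} \<subseteq> A \<and> A \<in> L2}"
        using x1 by (auto simp: L1_def L2_def simp del: packs.simps)
      have "reg_le n (sqf n (L1 \<inter> L2) :: 'a mpoly set) (r + 1 - int t + int (card {x}))"
        unfolding eq
      proof (rule reg_le_sqf_multiple[OF _ xn up(3) _ _ L2])
        fix z A assume "z \<in> {x}" "insert z A \<in> L2"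
        then show "A \<in> L2" using indep[of z A "Suc k" "x - 1"] x1 unfolding L2_def by simp
      qed (use rt' in auto)
      then show ?thesis by simp
    qed
    have "reg_le n (sqf n (L1 \<union> L2) :: 'a mpoly set) (r + 1 - int t)"
      by (rule reg_le_sqf_Un[OF up(2,3) L1 L2 L12])
    then have "reg_le n (sqf n {A. M \<subseteq> A \<and> A \<in> L1 \<union> L2} :: 'a mpoly set) (r + 1 - int t + int (card M))"
    proof (rule reg_le_sqf_multiple[OF M(1,2) up(4), rotated 2])
      fix z A assume z: "z \<in> M" "insert z A \<in> L1 \<union> L2"
      then have "x < z" "x - 1 < z" using tm by (auto simp: M_def x_def)
      with z show "A \<in> L1 \<union> L2"
        using packs_insert_greater[of t k "x - 1" z A] packs_insert_greater[of t "Suc k" "x - 1" z A]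
        by (auto simp: L1_def L2_def simp del: packs.simps)
    qed (use rt' in auto)
    moreover have "{A. M \<subseteq> A \<and> A \<in> L1 \<union> L2} = {A. packs t (Suc k) (m - 1) A} \<inter> U2"
    proof -
      have "A \<in> L1 \<union> L2 \<longleftrightarrow> packs t (Suc k) (m - 1) A \<and> packs t k (m - t) A" if "M \<subseteq> A" for A
      proof -
        have "packs t k (m - t) A" if "packs t (Suc k) (m - 1) A"
          using packs_Suc_imp[OF that] by (rule packs_mono) auto
        moreover have "packs t (Suc k) (m - 1) A \<longleftrightarrow> A \<in> L1 \<union> L2"
          using packs_before_full_interval[OF t tm, of A k] that
          by (auto simp: M_def L1_def L2_def x_def simp del: packs.simps)
        ultimately show ?thesis by blast
      qed
      then show ?thesis by (auto simp: U2_def simp del: packs.simps)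
    qed
    ultimately have "reg_le n (sqf n ({A. packs t (Suc k) (m - 1) A} \<inter> U2) :: 'a mpoly set) (r + 1)"
      using M by simp
    then have "reg_le n (sqf n ({A. packs t (Suc k) (m - 1) A} \<union> U2) :: 'a mpoly set) r"
      by (rule reg_le_sqf_Un[OF upclosed_packs up(1) U1 U2])
    moreover have "{A. packs t (Suc k) m A} = {A. packs t (Suc k) (m - 1) A} \<union> U2"
      using packs_split[OF t tm, of k] by (auto simp: U2_def M_def simp del: packs.simps)
    ultimately show ?thesis using True by (simp only: r_def if_True)
  qed
qed

section \<open>The lower bound\<close>

definition smon :: "nat set \<Rightarrow> monom"
  where "smon A = (\<Sum>x\<in>A. xv x)"

lemma lookup_smon: "finite A \<Longrightarrow> lookup (smon A) x = (if x \<in> A then 1 else 0)"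
  by (simp add: smon_def lookup_sum lookup_single when_def)

lemma keys_smon [simp]: "finite A \<Longrightarrow> keys (smon A) = A"
  by (auto simp: in_keys_iff lookup_smon split: if_splits)

lemma total_degree_smon [simp]: "finite A \<Longrightarrow> total_degree (smon A) = card A"
  by (simp add: total_degree_def lookup_smon)

lemma smon_remove: "finite A \<Longrightarrow> u \<in> A \<Longrightarrow> smon A - xv u = smon (A - {u})"
  by (rule poly_mapping_eqI) (auto simp: lookup_minus lookup_smon lookup_single when_def)

lemma lookup_sign_times: "lookup ((- 1) ^ k * p) m = (- 1) ^ k * lookup p m" for p :: "'a::field mpoly"
  by (cases "even k") simp_all

text \<open>A simplicial cycle \<open>\<Sum>S\<in>Tr. W - S\<close> of the complex of all sets outside \<open>U\<close>, one of whose faces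
  \<open>W - S0\<close> is maximal within \<open>W\<close>, is not a boundary: the indicator function of \<open>W - S0\<close> is a cocycle.\<close>

lemma not_acyc_by_cycle:
  fixes Tr :: "nat set set"
  assumes U: "upclosed U" and W: "W \<subseteq> {1..n}"
    and Tr: "\<And>S. S \<in> Tr \<Longrightarrow> S \<subseteq> W \<and> card S = i"
    and cycle: "\<And>V. V \<subseteq> W \<Longrightarrow> (\<Sum>s\<in>{s\<in>V. V - {s} \<in> Tr}. (- 1) ^ card {t\<in>V. t < s}) = (0 :: 'a::field)"
    and S0: "S0 \<in> Tr"
    and face: "\<And>S. S \<in> Tr \<Longrightarrow> W - S \<notin> U"
    and maximal: "\<And>u. u \<in> S0 \<Longrightarrow> insert u (W - S0) \<in> U"
  shows "\<not> hacyc n (sqf n U :: 'a mpoly set) i (int (card W))"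
proof
  assume ac: "hacyc n (sqf n U :: 'a mpoly set) i (int (card W))"
  interpret gmod "(*)" n "hpoly n" "sqf n U :: 'a mpoly set" by (rule gmod_sqf[OF U])
  have fW: "finite W" using W by (rule finite_subset) simp
  then have fin: "finite (W - S)" for S by simp
  have fTr: "finite Tr" using Tr fW by (meson Pow_iff finite_Pow_iff finite_subset subsetI)
  \<comment> \<open>The candidate class has a single coefficient, at \<open>S0\<close>, and total
    multidegree \<open>W\<close>. By \<open>maximal\<close>, multiplying this coefficient by a
    variable from \<open>S0\<close> lands in the ideal, so it is a cycle.\<close>
  define c where "c S = (if S = S0 then monom_poly (smon (W - S0)) else 0 :: 'a mpoly)" for S
  have c: "c \<in> hchain n i (int (card W))"
  proof (rule chainI)
    fix S assume "S \<subseteq> {1..n}" "card S = i"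
    have "int (card (W - S0)) = int (card W) - int i"
      using Tr[OF S0] card_Diff_subset[of S0 W] card_mono[OF fW, of S0] finite_subset[OF _ fW, of S0]
      by (simp add: of_nat_diff)
    then have "(monom_poly (smon (W - S0)) :: 'a mpoly) \<in> hpoly n (int (card W) - int i)"
      using W by (auto simp: hpoly_def polys_iff homogeneous_def monom_poly_def fin)
    then show "c S \<in> hpoly n (int (card W) - int i)"
      by (simp add: c_def hpoly_closed)
  next
    fix S assume "\<not> (S \<subseteq> {1..n} \<and> card S = i)"
    then have "S \<noteq> S0" using Tr[OF S0] W by blast
    then show "c S = 0" by (simp add: c_def)
  qed
  have "hbd n c T \<in> sqf n U" for T
    unfolding bd_def
  proof (rule N_sum)
    fix u assume u: "u \<in> {1..n} - T"
    have "X u * c (insert u T) \<in> sqf n U"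
    proof (cases "insert u T = S0")
      case True
      show ?thesis
      proof (rule sqf_X_times)
        fix m assume "m \<in> keys (c (insert u T))"
        then have "m = smon (W - S0)" using True by (auto simp: c_def monom_poly_def split: if_splits)
        then show "insert u (keys m) \<in> U" using maximal[of u] True by (auto simp: fin)
      qed (use u chain_polys[OF c] in auto)
    qed (simp add: c_def sqf_zero)
    then show "(- 1) ^ card {t \<in> T. t < u} * X u * c (insert u T) \<in> sqf n U"
      unfolding scale_sign by (auto intro: N_uminus)
  qed
  then obtain f where f: "f \<in> hchain n (Suc i) (int (card W))"
      "\<And>S. c S - hbd n f S \<in> sqf n U"
    using ac c unfolding acyc_def by blast
  \<comment> \<open>Only multidegree \<open>W\<close> matters, and \<open>G V\<close> is that
    coefficient of \<open>f\<close>. Summing over \<open>Tr\<close> evaluates on the simplicial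
    cycle, which gives 1 for \<open>c\<close> and 0 for the boundary of \<open>f\<close>.\<close>
  define G where "G V = lookup (f V) (smon (W - V))" for V
  have "lookup (c S) (smon (W - S)) = lookup (hbd n f S) (smon (W - S))" if "S \<in> Tr" for S
  proof -
    have "smon (W - S) \<notin> keys (c S - hbd n f S)"
      using f(2)[of S] face[OF that] fin[of S] by (auto simp: sqf_def simp del: keys_minus)
    then show ?thesis by (simp add: in_keys_iff lookup_minus)
  qed
  then have "(\<Sum>S\<in>Tr. lookup (c S) (smon (W - S))) = (\<Sum>S\<in>Tr. lookup (hbd n f S) (smon (W - S)))"
    by (intro sum.cong refl)
  also have "(\<Sum>S\<in>Tr. lookup (c S) (smon (W - S))) = (\<Sum>S\<in>Tr. if S = S0 then 1 else 0)"
    by (intro sum.cong refl) (simp add: c_def monom_poly_def)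
  also have "\<dots> = 1" using fTr S0 by simp
  also have "(\<Sum>S\<in>Tr. lookup (hbd n f S) (smon (W - S))) =
      (\<Sum>S\<in>Tr. \<Sum>u\<in>W - S. (- 1) ^ card {t \<in> insert u S. t < u} * G (insert u S))"
  proof (rule sum.cong[OF refl])
    fix S assume "S \<in> Tr"
    have *: "lookup (X u * f (insert u S)) (smon (W - S)) = (if u \<in> W - S then G (insert u S) else 0)" for u
    proof (cases "u \<in> W - S")
      case True
      have "smon (W - S) - xv u = smon (W - insert u S)"
        unfolding Diff_insert[of W u S] by (rule smon_remove[OF fin True])
      with True show ?thesis by (simp add: lookup_X_times fin G_def)
    qed (auto simp: lookup_X_times fin)
    have "lookup (hbd n f S) (smon (W - S)) =
        (\<Sum>u\<in>{1..n} - S. (- 1) ^ card {t \<in> S. t < u} * lookup (X u * f (insert u S)) (smon (W - S)))"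
      by (simp only: bd_def lookup_sum mult.assoc lookup_sign_times)
    also have "\<dots> = (\<Sum>u\<in>W - S. (- 1) ^ card {t \<in> S. t < u} * G (insert u S))"
      unfolding * using W by (intro sum.mono_neutral_cong_right) auto
    also have "\<dots> = (\<Sum>u\<in>W - S. (- 1) ^ card {t \<in> insert u S. t < u} * G (insert u S))"
    proof (rule sum.cong[OF refl])
      fix u have "{t \<in> insert u S. t < u} = {t \<in> S. t < u}" by auto
      then show "(- 1) ^ card {t \<in> S. t < u} * G (insert u S) = (- 1) ^ card {t \<in> insert u S. t < u} * G (insert u S)"
        by simp
    qed
    finally show "lookup (hbd n f S) (smon (W - S)) =
      (\<Sum>u\<in>W - S. (- 1) ^ card {t \<in> insert u S. t < u} * G (insert u S))" .
  qed
  also have "\<dots> = (\<Sum>(S, u)\<in>Sigma Tr (\<lambda>S. W - S). (- 1) ^ card {t \<in> insert u S. t < u} * G (insert u S))"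
    using fTr fin by (intro sum.Sigma) auto
  also have "\<dots> = (\<Sum>(V, s)\<in>Sigma (Pow W) (\<lambda>V. {s\<in>V. V - {s} \<in> Tr}). (- 1) ^ card {t \<in> V. t < s} * G V)"
    by (rule sum.reindex_bij_witness[of _ "\<lambda>(V, s). (V - {s}, s)" "\<lambda>(S, u). (insert u S, u)"])
       (use Tr in \<open>auto simp: insert_absorb\<close>)
  also have "\<dots> = (\<Sum>V\<in>Pow W. \<Sum>s\<in>{s\<in>V. V - {s} \<in> Tr}. (- 1) ^ card {t \<in> V. t < s} * G V)"
    using fW by (intro sum.Sigma[symmetric]) (auto intro: finite_subset)
  also have "\<dots> = (\<Sum>V\<in>Pow W. (\<Sum>s\<in>{s\<in>V. V - {s} \<in> Tr}. (- 1) ^ card {t \<in> V. t < s}) * G V)"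
    by (simp only: sum_distrib_right)
  also have "\<dots> = 0" using cycle by (intro sum.neutral ballI) (simp only: Pow_iff mult_zero_left)
  finally show False by simp
qed

text \<open>If removing a point of \<open>V\<close> leaves a transversal, then \<open>V\<close> has
  two points in exactly one block and may lose either of them. Blocks are convex, so no point of
  \<open>V\<close> lies between the two and their signs are opposite. This is why the cycle can have
  all coefficients 1.\<close>

lemma transversal_cycle:
  fixes B :: "nat \<Rightarrow> nat set"
  assumes convex: "\<And>j a b x. j < v \<Longrightarrow> a \<in> B j \<Longrightarrow> b \<in> B j \<Longrightarrow> a \<le> x \<Longrightarrow> x \<le> b \<Longrightarrow> x \<in> B j"
    and disj: "\<And>i j. i < v \<Longrightarrow> j < v \<Longrightarrow> i \<noteq> j \<Longrightarrow> B i \<inter> B j = {}"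
    and W: "W = (\<Union>j<v. B j)" "finite W"
    and Tr: "Tr = {S. S \<subseteq> W \<and> (\<forall>j<v. card (S \<inter> B j) = 1)}"
    and V: "V \<subseteq> W"
  shows "(\<Sum>s\<in>{s\<in>V. V - {s} \<in> Tr}. (- 1) ^ card {t\<in>V. t < s}) = (0 :: 'a::field)"
proof (cases "{s\<in>V. V - {s} \<in> Tr} = {}")
  case True
  then show ?thesis by (simp only: sum.empty)
next
  case False
  then obtain s0 where s0: "s0 \<in> V" "V - {s0} \<in> Tr" by blast
  then obtain j where j: "j < v" "s0 \<in> B j" using V W by blast
  then have "card ((V - {s0}) \<inter> B j) = 1" using s0 by (auto simp: Tr)
  then obtain s1 where s1: "(V - {s0}) \<inter> B j = {s1}" by (auto simp: card_1_singleton_iff)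
  then have VB: "V \<inter> B j = {s0, s1}" "s0 \<noteq> s1" using s0 j by auto
  have Q: "{s\<in>V. V - {s} \<in> Tr} = {s0, s1}"
  proof (intro Set.set_eqI iffI)
    fix s assume s: "s \<in> {s\<in>V. V - {s} \<in> Tr}"
    show "s \<in> {s0, s1}"
    proof (rule ccontr)
      assume "s \<notin> {s0, s1}"
      then have "(V - {s}) \<inter> B j = {s0, s1}" using VB by blast
      moreover have "card ((V - {s}) \<inter> B j) = 1" using s j by (auto simp: Tr)
      ultimately show False using VB(2) by simp
    qed
  next
    fix s assume "s \<in> {s0, s1}"
    moreover have "V - {s1} \<in> Tr"
    proof -
      have "card ((V - {s1}) \<inter> B i) = 1" if i: "i < v" for i
      proof (cases "i = j")
        case True
        have "(V - {s1}) \<inter> B j = {s0}" using VB by blast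
        then show ?thesis using True by simp
      next
        case False
        then have "s0 \<notin> B i" "s1 \<notin> B i" using disj[OF i j(1) False] VB by blast+
        then have "(V - {s1}) \<inter> B i = (V - {s0}) \<inter> B i" by blast
        then show ?thesis using s0(2) i by (simp add: Tr)
      qed
      then show ?thesis using V by (auto simp: Tr)
    qed
    ultimately show "s \<in> {s\<in>V. V - {s} \<in> Tr}" using s0 VB by blast
  qed
  obtain a b where ab: "a < b" "{s0, s1} = {a, b}" "a \<in> V \<inter> B j" "b \<in> V \<inter> B j"
    using VB by (metis insertCI insert_commute linorder_neqE_nat)
  have "{t\<in>V. t < b} = insert a {t\<in>V. t < a}"
  proof (intro Set.set_eqI iffI)
    fix x assume x: "x \<in> {t\<in>V. t < b}"
    show "x \<in> insert a {t\<in>V. t < a}"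
    proof (cases "a \<le> x")
      case True
      then have "x \<in> V \<inter> B j" using convex[of j a b x] x ab j by auto
      then have "x \<in> {a, b}" using VB ab(2) by blast
      then show ?thesis using x by auto
    qed (use x in auto)
  qed (use ab in auto)
  moreover have "finite V" using V W(2) by (rule finite_subset)
  ultimately have "card {t\<in>V. t < b} = Suc (card {t\<in>V. t < a})" by simp
  then show ?thesis unfolding Q ab(2) using ab(1) by simp
qed

section \<open>The sphere on the blocks and its packings\<close>

lemma packs_full: "{1..k * t} \<subseteq> A \<Longrightarrow> packs t k (k * t) A"
proof (induction k)
  case (Suc k)
  have "{1..k * t} \<subseteq> {1..Suc k * t}" by simp
  with Suc have "packs t k (k * t) A" by blast
  moreover have "{k * t + 1..<k * t + 1 + t} \<subseteq> A" using Suc.prems by auto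
  ultimately show ?case by (auto intro!: exI[of _ "k * t + 1"])
qed simp

text \<open>The chosen intervals are disjoint, and \<open>e\<close> bounds the end of every interval
  inside \<open>A\<close>, so they can only use points of \<open>A\<close> up to
  \<open>e\<close>.\<close>

lemma packs_card:
  assumes e: "\<And>i. 1 \<le> i \<Longrightarrow> {i..<i + t} \<subseteq> A \<Longrightarrow> i + t \<le> e + 1"
  shows "packs t q m A \<Longrightarrow> q * t \<le> card (A \<inter> {1..min m e})"
proof (induction q arbitrary: m)
  case (Suc q)
  then obtain i where i: "1 \<le> i" "i + t \<le> m + 1" "{i..<i + t} \<subseteq> A" "packs t q (i - 1) A" by auto
  have "Suc q * t \<le> card (A \<inter> {1..min (i - 1) e}) + card {i..<i + t}"
    using Suc.IH[OF i(4)] by simp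
  also have "\<dots> = card (A \<inter> {1..min (i - 1) e} \<union> {i..<i + t})"
    by (intro card_Un_disjoint[symmetric]) auto
  also have "\<dots> \<le> card (A \<inter> {1..min m e})"
    using i e[OF i(1,3)] by (intro card_mono) auto
  finally show ?case .
qed simp

lemma not_acyc_packs:
  assumes t: "1 \<le> t" and m: "Suc k * t \<le> m" "m \<le> n"
  shows "\<exists>i. \<not> hacyc n (sqf n {A. packs t (Suc k) m A} :: 'a::field mpoly set) i
    (int i + (int (k * t) + reg_path t (m - k * t)))"
proof -
  \<comment> \<open>The number of blocks that fit: the last one ends at
    \<open>k * t + (v - 1) * (t + 1) + t\<close>, which must not exceed \<open>m\<close>.\<close>
  define v where "v = (m - k * t + 1) div (t + 1)"
  define b where "b j = k * t + j * (t + 1)" for j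
  \<comment> \<open>Block 0 starts at 1 and so swallows the first \<open>k * t\<close>
    points.\<close>
  define lo where "lo j = (if j = 0 then 1 else b j + 1)" for j
  define B where "B j = {lo j..b j + t}" for j
  define W where "W = (\<Union>j<v. B j)"
  define Tr where "Tr = {S. S \<subseteq> W \<and> (\<forall>j<v. card (S \<inter> B j) = 1)}"
  \<comment> \<open>The last point of each block. Putting one back completes \<open>t\<close>
    consecutive points at the end of its block, while the points up to \<open>k * t\<close> are
    untouched and hold the other \<open>k\<close> intervals.\<close>
  define S0 where "S0 = (\<lambda>j. b j + t) ` {..<v}"
  have v1: "1 \<le> v" using m t unfolding v_def by (simp add: Suc_le_eq div_greater_zero_iff)
  have bm: "b j + t \<le> m" if "j < v" for j
  proof -
    have "Suc j * (t + 1) \<le> v * (t + 1)" using that by (intro mult_le_mono1) simp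
    also have "\<dots> \<le> m - k * t + 1" unfolding v_def by (rule div_times_less_eq_dividend)
    finally show ?thesis using m by (simp add: b_def)
  qed
  have b_less: "b i + t < b j" if "i < j" for i j
  proof -
    have "Suc i * (t + 1) \<le> j * (t + 1)" using that by (intro mult_le_mono1) simp
    then show ?thesis by (simp add: b_def)
  qed
  have lo_ge: "lo j \<ge> 1" "b 0 + 1 \<ge> lo 0" "lo j \<le> b j + 1" for j by (auto simp: lo_def)
  have B_less: "x < y" if "x \<in> B i" "y \<in> B j" "i < j" for x y i j
    using that b_less[OF that(3)] by (auto simp: B_def lo_def)
  have disj: "B i \<inter> B j = {}" if "i \<noteq> j" for i j
    using B_less that by (metis disjoint_iff less_irrefl linorder_neqE_nat)
  have e_in_B: "b j + t \<in> B j" for j using t lo_ge(3)[of j] by (auto simp: B_def)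
  have e_in_B_iff: "b i + t \<in> B j \<longleftrightarrow> i = j" for i j using e_in_B disj by blast
  have "B j \<subseteq> {1..n}" if "j < v" for j
    using bm[OF that] m(2) lo_ge(1)[of j] by (auto simp: B_def)
  then have W1: "W \<subseteq> {1..n}" by (auto simp: W_def)
  have fW: "finite W" using W1 by (rule finite_subset) simp
  have S0W: "S0 \<subseteq> W" using e_in_B by (auto simp: S0_def W_def)
  have S0B: "S0 \<inter> B j = {b j + t}" if "j < v" for j
    using that e_in_B_iff by (auto simp: S0_def)
  have cardTr: "card S = v" if "S \<in> Tr" for S
  proof -
    have "S = (\<Union>j<v. S \<inter> B j)" using that by (auto simp: Tr_def W_def)
    also have "card \<dots> = (\<Sum>j<v. card (S \<inter> B j))"
    proof (intro card_UN_disjoint ballI impI)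
      fix i j :: nat assume "i \<noteq> j"
      from disj[OF this] show "(S \<inter> B i) \<inter> (S \<inter> B j) = {}" by blast
    qed (simp_all add: B_def)
    also have "\<dots> = v" using that by (simp add: Tr_def)
    finally show ?thesis .
  qed
  have cardB: "card (B j) = t + (if j = 0 then k * t else 0)" for j
    by (auto simp: B_def lo_def b_def)
  have "card W = (\<Sum>j<v. card (B j))"
    unfolding W_def by (intro card_UN_disjoint ballI impI disj) (simp_all add: B_def)
  also have "\<dots> = k * t + t * v" using v1 by (simp add: cardB sum.distrib)
  finally have cardW: "card W = k * t + t * v" .
  have gap: "b j + t + 1 \<notin> W" if "j < v" for j
  proof
    assume "b j + t + 1 \<in> W"
    then obtain i where i: "i < v" "b j + t + 1 \<in> B i" by (auto simp: W_def)
    show False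
    proof (cases i j rule: linorder_cases)
      case less then show ?thesis using i b_less[OF less] by (auto simp: B_def)
    next
      case equal then show ?thesis using i by (auto simp: B_def)
    next
      case greater
      then have "lo i = b i + 1" by (simp add: lo_def)
      then show ?thesis using i b_less[OF greater] by (auto simp: B_def)
    qed
  qed
  \<comment> \<open>An interval inside \<open>W\<close> cannot cross a gap, so it lies in one block;
    every block but the first has only \<open>t\<close> points and loses one of them to
    \<open>S\<close>.\<close>
  have interval: "i + t \<le> b 0 + t + 1" if S: "S \<in> Tr" and i: "{i..<i + t} \<subseteq> W - S" for S i
  proof -
    have "i \<in> {i..<i + t}" using t by simp
    with i have "i \<in> W" by blast
    then obtain j where j: "j < v" "i \<in> B j" by (auto simp: W_def)
    have le: "i + t \<le> b j + t + 1"
    proof (rule ccontr)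
      assume "\<not> i + t \<le> b j + t + 1"
      then have "b j + t + 1 \<in> {i..<i + t}" using j by (auto simp: B_def)
      with i gap[OF j(1)] show False by blast
    qed
    show ?thesis
    proof (cases "j = 0")
      case False
      then have "i = lo j" "B j = {i..<i + t}" using le j(2) by (auto simp: B_def lo_def)
      then have "S \<inter> B j = {}" using i by blast
      then show ?thesis using S j by (auto simp: Tr_def)
    qed (use le in simp)
  qed
  have "\<not> hacyc n (sqf n {A. packs t (Suc k) m A} :: 'a mpoly set) v (int (card W))"
  proof (rule not_acyc_by_cycle[OF upclosed_packs W1, of Tr v S0])
    show "S \<subseteq> W \<and> card S = v" if "S \<in> Tr" for S
    proof
      show "S \<subseteq> W" using that unfolding Tr_def by blast
    qed (rule cardTr[OF that])
    show "(\<Sum>s\<in>{s\<in>V. V - {s} \<in> Tr}. (- 1) ^ card {t\<in>V. t < s}) = (0 :: 'a)" if "V \<subseteq> W" for V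
      by (rule transversal_cycle[OF _ disj W_def fW Tr_def that]) (simp_all add: B_def)
    show "S0 \<in> Tr" using S0W S0B by (simp add: Tr_def)
  next
    fix S assume S: "S \<in> Tr"
    show "W - S \<notin> {A. packs t (Suc k) m A}"
    proof
      assume "W - S \<in> {A. packs t (Suc k) m A}"
      then have "packs t (Suc k) m (W - S)" by (simp del: packs.simps)
      \<comment> \<open>All \<open>Suc k\<close> intervals would have to fit into block 0 with a
        point removed, which leaves fewer than \<open>Suc k * t\<close> points.\<close>
      then have "Suc k * t \<le> card ((W - S) \<inter> {1..min m (b 0 + t)})"
        by (rule packs_card[rotated]) (use interval[OF S] in auto)
      also have "\<dots> \<le> card (B 0 - S)"
      proof (rule card_mono)
        show "(W - S) \<inter> {1..min m (b 0 + t)} \<subseteq> B 0 - S" by (auto simp: B_def lo_def)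
      qed (simp add: B_def)
      also have "\<dots> < card (B 0)"
      proof (rule psubset_card_mono)
        have "card (S \<inter> B 0) = 1" using S v1 by (simp add: Tr_def)
        then have "S \<inter> B 0 \<noteq> {}" by auto
        then show "B 0 - S \<subset> B 0" by blast
      qed (simp add: B_def)
      finally show False by (simp add: cardB)
    qed
  next
    fix u assume "u \<in> S0"
    then obtain j where j: "j < v" "u = b j + t" by (auto simp: S0_def)
    let ?A = "insert u (W - S0)"
    have "packs t k (k * t) ?A"
    proof (rule packs_full)
      have "{1..k * t} \<subseteq> B 0" by (auto simp: B_def lo_def b_def)
      moreover have "{1..k * t} \<inter> S0 = {}" using t by (auto simp: S0_def b_def)
      moreover have "B 0 \<subseteq> W" unfolding W_def using v1 by (intro UN_upper) simp
      ultimately show "{1..k * t} \<subseteq> ?A" by blast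
    qed
    then have "packs t k (b j) ?A" by (rule packs_mono) (auto simp: b_def)
    moreover have "{b j + 1..<b j + 1 + t} \<subseteq> ?A"
    proof
      fix x assume x: "x \<in> {b j + 1..<b j + 1 + t}"
      then have "x \<in> B j" using lo_ge(3)[of j] by (auto simp: B_def)
      then show "x \<in> ?A" using S0B[OF j(1)] j by (auto simp: W_def)
    qed
    ultimately show "?A \<in> {A. packs t (Suc k) m A}"
      using bm[OF j(1)] by (auto intro!: exI[of _ "b j + 1"])
  qed
  moreover have "int (card W) = int v + (int (k * t) + reg_path t (m - k * t))"
    unfolding cardW reg_path_def v_def[symmetric] using t by (simp add: of_nat_diff algebra_simps)
  ultimately show ?thesis by metis
qed

section \<open>Minimal resolutions and Koszul homology\<close>

definition matv :: "nat \<Rightarrow> nat \<Rightarrow> (nat \<Rightarrow> nat \<Rightarrow> 'a::field mpoly) \<Rightarrow> (nat \<Rightarrow> 'a mpoly) \<Rightarrow> nat \<Rightarrow> 'a mpoly"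
  where "matv r c D w = (\<lambda>a. if a < r then \<Sum>b<c. D a b * w b else 0)"

text \<open>With \<open>V = {}\<close> this is the ordinary kernel of \<open>M\<close> in degree
  \<open>d\<close>; for the augmentation, \<open>V\<close> describes the ideal and the vectors are
  those mapped into it.\<close>

definition ker :: "nat \<Rightarrow> nat set set \<Rightarrow> nat \<Rightarrow> nat \<Rightarrow> (nat \<Rightarrow> nat \<Rightarrow> 'a::field mpoly) \<Rightarrow> (nat \<Rightarrow> int) \<Rightarrow> int \<Rightarrow> (nat \<Rightarrow> 'a mpoly) set"
  where "ker n V r' r M sh d = {v \<in> hvec n r sh d. \<forall>a<r'. (\<Sum>b<r. M a b * v b) \<in> sqf n V}"

definition homat :: "nat \<Rightarrow> nat \<Rightarrow> nat \<Rightarrow> (nat \<Rightarrow> nat \<Rightarrow> 'a::field mpoly) \<Rightarrow> (nat \<Rightarrow> int) \<Rightarrow> (nat \<Rightarrow> int) \<Rightarrow> bool"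
  where "homat n r' r M sh' sh \<longleftrightarrow> (\<forall>a<r'. \<forall>b<r. M a b \<in> hpoly n (sh b - sh' a))"

lemma homatD: "homat n r' r M sh' sh \<Longrightarrow> a < r' \<Longrightarrow> b < r \<Longrightarrow> M a b \<in> hpoly n (sh b - sh' a)"
  by (simp add: homat_def)

lemma hvec_polys: "v \<in> hvec n r sh d \<Longrightarrow> b < r \<Longrightarrow> v b \<in> polys n"
  using hvecD hpoly_polys by blast

lemma matv_add: "matv r c D (v + w) = matv r c D v + matv r c D w"
  by (auto simp: matv_def fun_eq_iff algebra_simps sum.distrib)

lemma matv_vsc: "matv r c D (vsc p v) = vsc p (matv r c D v)"
  by (auto simp: matv_def fun_eq_iff vsc_def sum_distrib_left mult_ac)

lemma matv_sum: "matv r c D (\<Sum>i\<in>I. f i) = (\<Sum>i\<in>I. matv r c D (f i))"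
proof -
  have "matv r c D 0 = 0" by (simp add: matv_def fun_eq_iff)
  then show ?thesis
    by (induction I rule: infinite_finite_induct)
       (simp_all only: sum.infinite sum.empty sum.insert matv_add not_False_eq_True)
qed

lemma matv_hvec:
  assumes "homat n r c D sh shc" "w \<in> hvec n c shc d"
  shows "matv r c D w \<in> hvec n r sh d"
proof -
  have "D a b * w b \<in> hpoly n (d - sh a)" if "a < r" "b < c" for a b
    using hpoly_mult[OF homatD[OF assms(1) that] hvecD[OF assms(2) that(2)]] by simp
  then show ?thesis by (auto simp: hvec_def matv_def intro!: hpoly_sum)
qed

lemma hcomp_sqf: "p \<in> sqf n V \<Longrightarrow> hcomp d p \<in> sqf n V"
  by (auto simp: sqf_def hcomp_def keys_restr)

lemma sqf_mult:
  assumes "upclosed V" "p \<in> polys n" "q \<in> sqf n V"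
  shows "p * q \<in> sqf n V"
proof -
  have absorb: "A \<union> B \<in> V" if "finite A" "B \<in> V" for A B
    using that by (induction A) (use assms(1) in \<open>auto simp: upclosed_def\<close>)
  have "keys m \<in> V" if m: "m \<in> keys (p * q)" for m
  proof -
    obtain a b where "m = a + b" "b \<in> keys q" using keys_mult[of p q] m by blast
    then show ?thesis using assms(3) absorb[of "keys a" "keys b"] by (simp add: sqf_def keys_plus_nat)
  qed
  moreover have "q \<in> polys n" using assms(3) by (simp add: sqf_def)
  ultimately show ?thesis using assms(2) by (auto simp: sqf_def)
qed

lemma sqf_sum: "(\<And>i. i \<in> I \<Longrightarrow> f i \<in> sqf n V) \<Longrightarrow> sum f I \<in> sqf n V"
proof (induction I rule: infinite_finite_induct)
  case (insert x F)
  then show ?case using sqf_minus[of "f x" n V "- sum f F"] sqf_minus[OF sqf_zero, of "sum f F" n V] by simp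
qed (auto simp: sqf_zero)

definition vcomp :: "nat \<Rightarrow> (nat \<Rightarrow> int) \<Rightarrow> int \<Rightarrow> (nat \<Rightarrow> 'a::field mpoly) \<Rightarrow> nat \<Rightarrow> 'a mpoly"
  where "vcomp r sh d v = (\<lambda>b. if b < r then hcomp (d - sh b) (v b) else 0)"

lemma vcomp_hvec: "(\<And>b. b < r \<Longrightarrow> v b \<in> polys n) \<Longrightarrow> vcomp r sh d v \<in> hvec n r sh d"
  by (auto simp: hvec_def vcomp_def hcomp_in_hpoly)

lemma sum_mult_vcomp:
  assumes "homat n r' r M sh' sh" "a < r'"
  shows "(\<Sum>b<r. M a b * vcomp r sh d v b) = hcomp (d - sh' a) (\<Sum>b<r. M a b * v b)"
proof -
  have "M a b * vcomp r sh d v b = hcomp (d - sh' a) (M a b * v b)" if "b < r" for b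
  proof -
    have "homogeneous (sh b - sh' a) (M a b)" using homatD[OF assms that] by (simp add: hpoly_def)
    from hcomp_mult[OF this, of "d - sh' a" "v b"] that show ?thesis by (simp add: vcomp_def)
  qed
  then show ?thesis by (simp add: hcomp_sum)
qed

lemma sum_vcomp:
  "\<exists>I. finite I \<and> (\<forall>b<r. v b = (\<Sum>d\<in>I. vcomp r sh d v b))"
proof -
  define I where "I = (\<Union>b<r. (\<lambda>m. int (total_degree m) + sh b) ` keys (v b))"
  have "v b = (\<Sum>d\<in>I. vcomp r sh d v b)" if b: "b < r" for b
  proof (rule poly_mapping_eqI)
    fix m
    have fin: "finite I" by (auto simp: I_def)
    have "lookup (\<Sum>d\<in>I. vcomp r sh d v b) m = (\<Sum>d\<in>I. if d = int (total_degree m) + sh b then lookup (v b) m else 0)"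
      unfolding lookup_sum using b by (intro sum.cong refl) (auto simp: vcomp_def hcomp_def lookup_restr)
    also have "\<dots> = lookup (v b) m"
    proof (cases "m \<in> keys (v b)")
      case True
      then have "int (total_degree m) + sh b \<in> I" using b by (auto simp: I_def)
      then show ?thesis using fin by simp
    next
      case False
      then have "lookup (v b) m = 0" by (simp add: in_keys_iff)
      then show ?thesis by (simp cong: if_cong)
    qed
    finally show "lookup (v b) m = lookup (\<Sum>d\<in>I. vcomp r sh d v b) m" by simp
  qed
  moreover have "finite I" by (auto simp: I_def)
  ultimately show ?thesis by blast
qed

lemma free_module_iff: "v \<in> free_module n r \<longleftrightarrow> (\<forall>b<r. v b \<in> polys n) \<and> (\<forall>b\<ge>r. v b = undefined)"
  by (auto simp: free_module_def PiE_iff extensional_def)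

definition exact_at where
  "exact_at n V r' r c M D \<longleftrightarrow>
    mat_apply r c D ` free_module n c = {v \<in> free_module n r. \<forall>a<r'. (\<Sum>b<r. M a b * v b) \<in> sqf n V}"

text \<open>The Koszul argument runs in a fixed degree, while a resolution is defined by exactness
  of whole modules. This is the degreewise counterpart of \<open>exact_at\<close>, with vectors that
  are zero rather than \<open>undefined\<close> outside their range.\<close>

definition hexact_at where
  "hexact_at n V r' r c M D sh shc \<longleftrightarrow>
    (\<forall>d. (\<forall>w\<in>hvec n c shc d. matv r c D w \<in> ker n V r' r M sh d) \<and>
      (\<forall>v\<in>ker n V r' r M sh d. \<exists>w\<in>hvec n c shc d. matv r c D w = v))"

text \<open>A homogeneous element of the image has a homogeneous preimage, namely the component of
  the right degree of any preimage.\<close>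

lemma exact_imp_hexact:
  fixes M D :: "nat \<Rightarrow> nat \<Rightarrow> 'a::field mpoly"
  assumes M: "homat n r' r M sh' sh" and D: "homat n r c D sh shc"
    and ex: "exact_at n V r' r c M D"
  shows "hexact_at n V r' r c M D sh shc"
  unfolding hexact_at_def
proof (intro allI conjI ballI)
  fix d and w :: "nat \<Rightarrow> 'a mpoly" assume w: "w \<in> hvec n c shc d"
  define w' where "w' = restrict w {..<c}"
  have "w' \<in> free_module n c"
    using hvec_polys[OF w] by (auto simp: free_module_iff w'_def)
  then have "mat_apply r c D w' \<in> {v \<in> free_module n r. \<forall>a<r'. (\<Sum>b<r. M a b * v b) \<in> sqf n V}"
    using ex unfolding exact_at_def by blast
  moreover have eq: "mat_apply r c D w' b = matv r c D w b" if "b < r" for b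
    using that by (simp add: mat_apply_def matv_def w'_def)
  ultimately have "\<forall>a<r'. (\<Sum>b<r. M a b * matv r c D w b) \<in> sqf n V"
    by (simp add: eq)
  then show "matv r c D w \<in> ker n V r' r M sh d"
    using matv_hvec[OF D w] by (simp add: ker_def)
next
  fix d and v :: "nat \<Rightarrow> 'a mpoly" assume v: "v \<in> ker n V r' r M sh d"
  then have vh: "v \<in> hvec n r sh d" by (simp add: ker_def)
  have "restrict v {..<r} \<in> {v \<in> free_module n r. \<forall>a<r'. (\<Sum>b<r. M a b * v b) \<in> sqf n V}"
    using v hvec_polys[OF vh] by (auto simp: free_module_iff ker_def)
  then obtain w where w: "w \<in> free_module n c" "restrict v {..<r} = mat_apply r c D w"
    using ex unfolding exact_at_def by blast
  have "matv r c D (vcomp c shc d w) a = v a" for a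
  proof (cases "a < r")
    case True
    have "(\<Sum>b<c. D a b * w b) = v a"
      using True fun_cong[OF w(2), of a] by (simp add: mat_apply_def)
    then have "matv r c D (vcomp c shc d w) a = hcomp (d - sh a) (v a)"
      using True by (simp add: matv_def sum_mult_vcomp[OF D True])
    also have "\<dots> = v a"
      using hvecD[OF vh True] by (auto simp: hpoly_def hcomp_homogeneous)
    finally show ?thesis .
  qed (use hvec_outside[OF vh] in \<open>simp add: matv_def\<close>)
  moreover have "vcomp c shc d w \<in> hvec n c shc d"
    using w(1) by (intro vcomp_hvec) (simp add: free_module_iff)
  ultimately show "\<exists>w\<in>hvec n c shc d. matv r c D w = v" by blast
qed

text \<open>A vector is a finite sum of homogeneous ones, and as the maps have degree 0, the
  components of a kernel element are kernel elements.\<close>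

lemma hexact_imp_exact:
  fixes M D :: "nat \<Rightarrow> nat \<Rightarrow> 'a::field mpoly"
  assumes M: "homat n r' r M sh' sh" and D: "homat n r c D sh shc" and V: "upclosed V"
    and ex: "hexact_at n V r' r c M D sh shc"
  shows "exact_at n V r' r c M D"
  unfolding exact_at_def
proof (intro subset_antisym subsetI)
  fix v assume "v \<in> mat_apply r c D ` free_module n c"
  then obtain w where w: "w \<in> free_module n c" and v: "v = mat_apply r c D w" by blast
  have Dp: "D a b \<in> polys n" if "a < r" "b < c" for a b
    using homatD[OF D that] by (rule hpoly_polys)
  have "v \<in> free_module n r"
    using w Dp by (auto simp: free_module_iff v mat_apply_def intro!: polys_sum polys_mult)
  moreover have "(\<Sum>b<r. M a b * v b) \<in> sqf n V" if a: "a < r'" for a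
  proof -
    \<comment> \<open>Testing on basis vectors shows that the product of the two matrices vanishes
      modulo \<open>sqf n V\<close>; linearity does the rest.\<close>
    have col: "(\<Sum>b<r. M a b * D b k) \<in> sqf n V" if k: "k < c" for k
    proof -
      define e :: "nat \<Rightarrow> 'a mpoly" where "e b = (if b = k then 1 else 0)" for b
      have "e \<in> hvec n c shc (shc k)"
        using k by (auto simp: hvec_def e_def hpoly_def homogeneous_def)
      then have "matv r c D e \<in> ker n V r' r M sh (shc k)"
        using ex by (simp add: hexact_at_def)
      moreover have "matv r c D e b = D b k" if "b < r" for b
        using that k by (simp add: matv_def e_def if_distrib[of "\<lambda>x. _ * x"] cong: if_cong)
      ultimately show ?thesis using a by (simp add: ker_def)
    qed
    have "(\<Sum>b<r. M a b * v b) = (\<Sum>b<r. \<Sum>k<c. w k * (M a b * D b k))"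
      by (simp add: v mat_apply_def sum_distrib_left mult_ac)
    also have "\<dots> = (\<Sum>k<c. \<Sum>b<r. w k * (M a b * D b k))"
      by (rule sum.swap)
    also have "\<dots> = (\<Sum>k<c. w k * (\<Sum>b<r. M a b * D b k))"
      by (simp add: sum_distrib_left)
    also have "\<dots> \<in> sqf n V"
    proof (rule sqf_sum)
      fix k assume "k \<in> {..<c}"
      then show "w k * (\<Sum>b<r. M a b * D b k) \<in> sqf n V"
        using w by (intro sqf_mult[OF V _ col]) (auto simp: free_module_iff)
    qed
    finally show ?thesis .
  qed
  ultimately show "v \<in> {v \<in> free_module n r. \<forall>a<r'. (\<Sum>b<r. M a b * v b) \<in> sqf n V}" by blast
next
  fix v assume "v \<in> {v \<in> free_module n r. \<forall>a<r'. (\<Sum>b<r. M a b * v b) \<in> sqf n V}"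
  then have v: "v \<in> free_module n r" and vk: "\<And>a. a < r' \<Longrightarrow> (\<Sum>b<r. M a b * v b) \<in> sqf n V" by auto
  obtain I where I: "finite I" "\<And>b. b < r \<Longrightarrow> v b = (\<Sum>d\<in>I. vcomp r sh d v b)"
    using sum_vcomp[of r v sh] by blast
  have "vcomp r sh d v \<in> ker n V r' r M sh d" for d
    using v vk by (auto simp: ker_def free_module_iff sum_mult_vcomp[OF M] intro!: vcomp_hvec hcomp_sqf)
  then have "\<exists>w\<in>hvec n c shc d. matv r c D w = vcomp r sh d v" for d
    using ex by (simp add: hexact_at_def)
  then obtain w where w: "\<And>d. w d \<in> hvec n c shc d" "\<And>d. matv r c D (w d) = vcomp r sh d v"
    by metis
  define u where "u = restrict (\<Sum>d\<in>I. w d) {..<c}"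
  have "u \<in> free_module n c"
    using hvec_polys[OF w(1)] by (auto simp: u_def free_module_iff sum_fun_app intro!: polys_sum)
  moreover have "mat_apply r c D u = v"
  proof
    fix a
    show "mat_apply r c D u a = v a"
    proof (cases "a < r")
      case True
      have "mat_apply r c D u a = matv r c D (\<Sum>d\<in>I. w d) a"
        using True by (simp add: mat_apply_def matv_def u_def)
      also have "\<dots> = (\<Sum>d\<in>I. vcomp r sh d v a)"
        by (simp only: matv_sum w(2) sum_fun_app)
      also have "\<dots> = v a" using I(2)[OF True] by simp
      finally show ?thesis .
    qed (use v in \<open>auto simp: mat_apply_def free_module_iff\<close>)
  qed
  ultimately show "v \<in> mat_apply r c D ` free_module n c" by blast
qed

text \<open>The map \<open>F\<^sub>0 \<rightarrow> R/I\<close> is treated as a matrix with one row, and the index of the differentials is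
  shifted by one, so that level \<open>0\<close> of the complex looks like the others.\<close>

definition mx :: "'p free_complex \<Rightarrow> nat \<Rightarrow> nat \<Rightarrow> nat \<Rightarrow> 'p"
  where "mx F i = (case i of 0 \<Rightarrow> (\<lambda>a b. aug F b) | Suc i' \<Rightarrow> diff F i')"

definition trk :: "'p free_complex \<Rightarrow> nat \<Rightarrow> nat"
  where "trk F i = (case i of 0 \<Rightarrow> 1 | Suc i' \<Rightarrow> rnk F i')"

definition tsh :: "'p free_complex \<Rightarrow> nat \<Rightarrow> nat \<Rightarrow> int"
  where "tsh F i = (case i of 0 \<Rightarrow> (\<lambda>_. 0) | Suc i' \<Rightarrow> shift F i')"

text \<open>Relations hold modulo the ideal at the augmentation and exactly afterwards; the empty
  system stands for the zero ideal.\<close>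

definition level :: "nat set set \<Rightarrow> nat \<Rightarrow> nat set set"
  where "level U i = (case i of 0 \<Rightarrow> U | Suc _ \<Rightarrow> {})"

lemma level_simps [simp]:
  "mx F 0 = (\<lambda>a b. aug F b)" "mx F (Suc i) = diff F i"
  "trk F 0 = 1" "trk F (Suc i) = rnk F i"
  "tsh F 0 = (\<lambda>_. 0)" "tsh F (Suc i) = shift F i"
  "level U 0 = U" "level U (Suc i) = {}"
  by (simp_all add: mx_def trk_def tsh_def level_def)

lemma upclosed_level: "upclosed U \<Longrightarrow> upclosed (level U i)"
  by (cases i) (auto simp: upclosed_empty)

lemma all_nat_split: "(\<forall>i. P i) \<longleftrightarrow> P 0 \<and> (\<forall>i. P (Suc i))"
  using not0_implies_Suc by metis

section \<open>Resolutions as chains of free covers\<close>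

lemma graded_free_resolution_iff:
  "graded_free_resolution n (sqf n U) F \<longleftrightarrow>
    (\<forall>i. homat n (trk F i) (rnk F i) (mx F i) (tsh F i) (shift F i)) \<and>
    (\<forall>p\<in>polys n. \<exists>v\<in>free_module n (rnk F 0). p - (\<Sum>b<rnk F 0. aug F b * v b) \<in> sqf n U) \<and>
    (\<forall>i. exact_at n (level U i) (trk F i) (rnk F i) (rnk F (Suc i)) (mx F i) (diff F i))"
proof -
  have "(mat_apply r c M v = (\<lambda>a\<in>{..<r}. 0)) \<longleftrightarrow> (\<forall>a<r. (\<Sum>b<c. M a b * v b) = 0)"
    for r c and M :: "nat \<Rightarrow> nat \<Rightarrow> 'a mpoly" and v
    by (auto simp: mat_apply_def fun_eq_iff restrict_def)
  then show ?thesis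
    unfolding graded_free_resolution_def all_nat_split[where P = "\<lambda>i. homat n (trk F i) (rnk F i) (mx F i) (tsh F i) (shift F i)"]
      all_nat_split[where P = "\<lambda>i. exact_at n (level U i) (trk F i) (rnk F i) (rnk F (Suc i)) (mx F i) (diff F i)"]
    by (simp add: exact_at_def homat_def hpoly_def sqf_empty)
qed

lemma gmod_ker:
  assumes V: "upclosed V"
  shows "gmod vsc n (ker n V r' r M sh) {0}"
proof (intro gmod.intro module_vsc gmod_axioms.intro)
  fix d and v w :: "nat \<Rightarrow> 'a mpoly"
  assume v: "v \<in> ker n V r' r M sh d"
  show "v - w \<in> ker n V r' r M sh d" if w: "w \<in> ker n V r' r M sh d"
  proof -
    have "(\<Sum>b<r. M a b * (v - w) b) = (\<Sum>b<r. M a b * v b) - (\<Sum>b<r. M a b * w b)" for a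
      by (simp add: fun_diff_def right_diff_distrib sum_subtractf)
    then show ?thesis using v w by (auto simp: ker_def hvec_minus intro!: sqf_minus)
  qed
  show "vsc (X u) v \<in> ker n V r' r M sh (d + 1)" if u: "u \<in> {1..n}" for u
  proof -
    have "(\<Sum>b<r. M a b * vsc (X u) v b) = X u * (\<Sum>b<r. M a b * v b)" for a
      by (simp add: vsc_def sum_distrib_left mult_ac)
    then show ?thesis using v u hvec_X[OF u, of v r sh d] by (auto simp: ker_def intro!: sqf_X[OF V])
  qed
qed (auto simp: ker_def hvec_zero sqf_zero module.scale_zero_right[OF module_vsc])

lemma ker_mult:
  assumes V: "upclosed V" and v: "v \<in> ker n V r' r M sh d" and p: "p \<in> hpoly n e"
  shows "vsc p v \<in> ker n V r' r M sh (e + d)"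
proof -
  have "(\<Sum>b<r. M a b * vsc p v b) = p * (\<Sum>b<r. M a b * v b)" for a
    by (simp add: vsc_def sum_distrib_left mult_ac)
  moreover have "vsc p v \<in> hvec n r sh (e + d)"
  proof -
    have vh: "v \<in> hvec n r sh d" using v by (simp add: ker_def)
    have "p * v b \<in> hpoly n (e + d - sh b)" if "b < r" for b
      using hpoly_mult[OF p hvecD[OF vh that]] by (simp add: algebra_simps)
    then show ?thesis using hvec_outside[OF vh] by (auto simp: hvec_def vsc_def)
  qed
  ultimately show ?thesis using v hpoly_polys[OF p] by (auto simp: ker_def intro!: sqf_mult[OF V])
qed

lemma free_cover_ker:
  assumes V: "upclosed V" and ex: "hexact_at n V r' r c M D sh shc"
  shows "free_cover vsc n (ker n V r' r M sh) {0} c shc (matv r c D)"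
    and "free_cover.Z n {0} c shc (matv r c D) = ker n {} r c D shc"
proof -
  show *: "free_cover vsc n (ker n V r' r M sh) {0} c shc (matv r c D)"
  proof (intro free_cover.intro free_cover_axioms.intro gmod_ker V matv_add matv_vsc)
    fix d a assume "a \<in> ker n V r' r M sh d"
    then obtain w where "w \<in> hvec n c shc d" "matv r c D w = a" using ex unfolding hexact_at_def by blast
    then show "\<exists>v\<in>hvec n c shc d. matv r c D v - a \<in> {0}" by (intro bexI[of _ w]) simp_all
  qed (use ex in \<open>simp add: hexact_at_def\<close>)
  have "matv r c D v = 0 \<longleftrightarrow> (\<forall>a<r. (\<Sum>b<c. D a b * v b) = 0)" for v
    by (auto simp: matv_def fun_eq_iff)
  then show "free_cover.Z n {0} c shc (matv r c D) = ker n {} r c D shc"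
    by (simp add: fun_eq_iff free_cover.Z_def[OF *] ker_def sqf_empty)
qed

lemma lookup_mult_zero: "lookup p 0 = 0 \<Longrightarrow> lookup (p * q) (0 :: monom) = (0 :: 'a::field)"
proof (rule ccontr)
  assume p: "lookup p 0 = 0" and "lookup (p * q) 0 \<noteq> 0"
  then have "0 \<in> keys (p * q)" by (simp add: in_keys_iff)
  then obtain a b where ab: "0 = a + b" "a \<in> keys p" using keys_mult[of p q] by blast
  then have "keys a = {}" using keys_plus_nat[of a b] by simp
  then show False using ab(2) p by (simp add: in_keys_iff)
qed

text \<open>Each cover turns index \<open>Suc p\<close> of one kernel into index \<open>p\<close> of
  the next. So index \<open>i\<close> of R/I descends to index 0 of the module covered by the
  \<open>i\<close>-th free module, where minimality identifies it with the basis degrees.\<close>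

lemma minimal_resolution_generators:
  fixes F :: "'a::field mpoly free_complex"
  assumes U: "upclosed U" and F: "minimal_graded_free_resolution n (sqf n U) F"
  shows "(\<exists>b<rnk F i. shift F i b = j) \<longleftrightarrow> \<not> hacyc n (sqf n U :: 'a mpoly set) i j"
proof -
  define K where "K i = ker n (level U i) (trk F i) (rnk F i) (mx F i) (shift F i)" for i
  have res: "graded_free_resolution n (sqf n U) F"
    and min: "\<And>i a b. a < rnk F i \<Longrightarrow> b < rnk F (Suc i) \<Longrightarrow> lookup (diff F i a b) 0 = 0"
    using F by (auto simp: minimal_graded_free_resolution_def)
  have hom: "homat n (trk F i) (rnk F i) (mx F i) (tsh F i) (shift F i)" for i
    using res by (simp add: graded_free_resolution_iff)
  have ex: "hexact_at n (level U i) (trk F i) (rnk F i) (rnk F (Suc i)) (mx F i) (diff F i) (shift F i) (shift F (Suc i))" for i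
    using res hom[of "Suc i"] by (intro exact_imp_hexact[OF hom[of i]]) (auto simp: graded_free_resolution_iff)
  \<comment> \<open>Minimality enters here: a kernel element is an image under \<open>diff\<close>,
    whose entries have no constant term.\<close>
  have const: "lookup (v b) 0 = 0" if "v \<in> K i d" "b < rnk F i" for v b i d
  proof -
    obtain w where w: "matv (rnk F i) (rnk F (Suc i)) (diff F i) w = v"
      using ex[of i] \<open>v \<in> K i d\<close> unfolding hexact_at_def K_def by blast
    show ?thesis
      using that(2) min[OF that(2)] by (simp add: w[symmetric] matv_def lookup_sum lookup_mult_zero)
  qed
  have cover: "free_cover vsc n (K i) {0} (rnk F (Suc i)) (shift F (Suc i)) (matv (rnk F i) (rnk F (Suc i)) (diff F i))"
    and coverZ: "free_cover.Z n {0} (rnk F (Suc i)) (shift F (Suc i)) (matv (rnk F i) (rnk F (Suc i)) (diff F i)) = K (Suc i)" for i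
    using free_cover_ker[OF upclosed_level[OF U] ex] by (simp_all add: K_def)
  define \<phi> where "\<phi> v = (\<Sum>b<rnk F 0. aug F b * v b)" for v
  interpret c0: free_cover "(*)" n "hpoly n" "sqf n U :: 'a mpoly set" "rnk F 0" "shift F 0" \<phi>
  proof (intro free_cover.intro free_cover_axioms.intro gmod_sqf U)
    fix d and a :: "'a mpoly" assume a: "a \<in> hpoly n d"
    then obtain v where v: "v \<in> free_module n (rnk F 0)" "a - \<phi> v \<in> sqf n U"
      using res hpoly_polys unfolding graded_free_resolution_iff \<phi>_def by blast
    have ha: "hcomp d a = a" using a by (simp add: hpoly_def hcomp_homogeneous[of d])
    have "\<phi> (vcomp (rnk F 0) (shift F 0) d v) = hcomp d (\<phi> v)"
      using sum_mult_vcomp[OF hom[of 0], of 0 d v] by (simp add: \<phi>_def)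
    then have "\<phi> (vcomp (rnk F 0) (shift F 0) d v) - a = 0 - hcomp d (a - \<phi> v)"
      using ha by (simp add: hcomp_def restr_minus)
    also have "\<dots> \<in> sqf n U" by (intro sqf_minus sqf_zero hcomp_sqf v)
    finally show "\<exists>v\<in>hvec n (rnk F 0) (shift F 0) d. \<phi> v - a \<in> sqf n U"
      using v(1) by (intro bexI[of _ "vcomp (rnk F 0) (shift F 0) d v"] vcomp_hvec) (auto simp: free_module_iff)
  next
    fix d and v :: "nat \<Rightarrow> 'a mpoly" assume v: "v \<in> hvec n (rnk F 0) (shift F 0) d"
    have "aug F b * v b \<in> hpoly n d" if "b < rnk F 0" for b
      using hpoly_mult[OF homatD[OF hom[of 0], of 0 b] hvecD[OF v that]] that by simp
    then show "\<phi> v \<in> hpoly n d" unfolding \<phi>_def by (intro hpoly_sum) auto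
  qed (auto simp: \<phi>_def vsc_def distrib_left sum.distrib sum_distrib_left mult_ac)
  have Z0: "c0.Z = K 0"
    by (simp add: fun_eq_iff c0.Z_def K_def ker_def \<phi>_def)
  \<comment> \<open>\<open>K i\<close> lies inside the \<open>i\<close>-th free module and is the
    syzygy module of order \<open>i + 1\<close>; hence the index \<open>Suc (p + i)\<close>.\<close>
  have syz: "acyc n vsc (K i) {0} p j \<longleftrightarrow> hacyc n (sqf n U :: 'a mpoly set) (Suc (p + i)) j" for i p
  proof (induction i arbitrary: p)
    case 0
    have "lookup (v b) 0 = 0" if "v \<in> c0.Z j" "b < rnk F 0" for v b
      using const[of v 0 j b] that by (simp add: Z0)
    then have "acyc n vsc c0.Z {0} p j \<longleftrightarrow> hacyc n (sqf n U :: 'a mpoly set) (Suc p) j"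
      using c0.acyc_syzygy c0.acyc_from_syzygy by blast
    then show ?case unfolding Z0 by (simp only: add_0_right)
  next
    case (Suc i)
    interpret c: free_cover vsc n "K i" "{0}" "rnk F (Suc i)" "shift F (Suc i)" "matv (rnk F i) (rnk F (Suc i)) (diff F i)"
      by (rule cover)
    have Z: "c.Z = K (Suc i)" by (rule coverZ)
    have "lookup (v b) 0 = 0" if "v \<in> c.Z j" "b < rnk F (Suc i)" for v b
      using const[of v "Suc i" j b] that by (simp add: Z)
    then have "acyc n vsc c.Z {0} p j \<longleftrightarrow> acyc n vsc (K i) {0} (Suc p) j"
      using c.acyc_syzygy c.acyc_from_syzygy by blast
    then show ?case unfolding Z Suc.IH[of "Suc p"] by (simp only: add_Suc add_Suc_right)
  qed
  show ?thesis
  proof (cases i)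
    case 0
    have "lookup (v b) 0 = 0" if "v \<in> c0.Z j" "b < rnk F 0" for v b
      using const[of v 0 j b] that by (simp add: Z0)
    with 0 show ?thesis using c0.acyc_0_iff_no_generator[of j] by auto
  next
    case (Suc i')
    interpret c: free_cover vsc n "K i'" "{0}" "rnk F (Suc i')" "shift F (Suc i')" "matv (rnk F i') (rnk F (Suc i')) (diff F i')"
      by (rule cover)
    have Z: "c.Z = K (Suc i')" by (rule coverZ)
    have "lookup (v b) 0 = 0" if "v \<in> c.Z j" "b < rnk F (Suc i')" for v b
      using const[of v "Suc i'" j b] that by (simp add: Z)
    then have "acyc n vsc (K i') {0} 0 j \<longleftrightarrow> \<not> (\<exists>b<rnk F (Suc i'). shift F (Suc i') b = j)"
      by (rule c.acyc_0_iff_no_generator)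
    then show ?thesis unfolding syz[of i' 0] Suc add_0_left by blast
  qed
qed

section \<open>Existence of minimal resolutions\<close>

text \<open>Constant polynomials act as scalars, which makes linear algebra over the field available
  in each degree.\<close>

lemma vector_space_vsc: "vector_space (\<lambda>(c :: 'a::field) v. vsc (single 0 c) v)"
  by unfold_locales
     (auto simp: vsc_def fun_eq_iff single_add algebra_simps mult_single[of 0 _ 0, simplified, symmetric])

lemma finite_monomials: "finite {m :: monom. keys m \<subseteq> {1..n} \<and> int (total_degree m) = d}"
proof (rule finite_imageD)
  have "lookup m i \<le> nat d" if "int (total_degree m) = d" for m :: monom and i
  proof (cases "i \<in> keys m")
    case True
    then have "lookup m i \<le> total_degree m"
      unfolding total_degree_def by (intro member_le_sum) auto
    then show ?thesis using that by simp
  qed (simp add: in_keys_iff)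
  then have "lookup ` {m :: monom. keys m \<subseteq> {1..n} \<and> int (total_degree m) = d}
      \<subseteq> {f. \<forall>x. (x \<in> {1..n} \<longrightarrow> f x \<in> {0..nat d}) \<and> (x \<notin> {1..n} \<longrightarrow> f x = 0)}"
    by (fastforce simp: in_keys_iff)
  then show "finite (lookup ` {m :: monom. keys m \<subseteq> {1..n} \<and> int (total_degree m) = d})"
    by (rule finite_subset) (rule finite_set_of_finite_funs; simp)
  show "inj_on lookup {m :: monom. keys m \<subseteq> {1..n} \<and> int (total_degree m) = d}"
    by (rule inj_onI) (rule poly_mapping_eq_iff[THEN iffD2])
qed

lemma sum_single_lookup: "(\<Sum>m\<in>keys p. single m (lookup p m)) = p"
  by (rule poly_mapping_eqI) (simp add: lookup_sum lookup_single when_def in_keys_iff)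

lemma hvec_finite_span:
  "\<exists>E. finite E \<and> hvec n r sh d \<subseteq> module.span (\<lambda>(c :: 'a::field) v. vsc (single 0 c) v) E"
proof -
  interpret vs: vector_space "\<lambda>(c :: 'a) v. vsc (single 0 c) v" by (rule vector_space_vsc)
  define M where "M b = {m :: monom. keys m \<subseteq> {1..n} \<and> int (total_degree m) = d - sh b}" for b
  define e where "e b m b' = (if b' = b then monom_poly m else 0 :: 'a mpoly)" for b b' :: nat and m
  define E where "E = (\<lambda>(b, m). e b m) ` Sigma {..<r} M"
  have "finite E" unfolding E_def M_def by (intro finite_imageI finite_SigmaI finite_monomials) simp
  moreover have "v \<in> vs.span E" if v: "v \<in> hvec n r sh d" for v
  proof -
    have "v = (\<Sum>b<r. \<Sum>m\<in>keys (v b). vsc (single 0 (lookup (v b) m)) (e b m))"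
    proof
      fix b'
      have "(\<Sum>b<r. \<Sum>m\<in>keys (v b). vsc (single 0 (lookup (v b) m)) (e b m)) b' =
        (\<Sum>b<r. if b = b' then \<Sum>m\<in>keys (v b). single m (lookup (v b) m) else 0)"
        unfolding sum_fun_app vsc_def e_def by (intro sum.cong refl) (auto simp: monom_poly_def mult_single)
      also have "\<dots> = v b'"
        using hvec_outside[OF v, of b'] by (simp add: sum_single_lookup)
      finally show "v b' = (\<Sum>b<r. \<Sum>m\<in>keys (v b). vsc (single 0 (lookup (v b) m)) (e b m)) b'" ..
    qed
    also have "\<dots> \<in> vs.span E"
    proof (intro vs.span_sum vs.span_scale vs.span_base)
      fix b m assume b: "b \<in> {..<r}" and m: "m \<in> keys (v b)"
      have "v b \<in> hpoly n (d - sh b)" using hvecD[OF v] b by simp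
      then have "m \<in> M b" using m by (auto simp: M_def hpoly_def homogeneous_def polys_iff)
      then show "e b m \<in> E" using b by (auto simp: E_def)
    qed
    finally show ?thesis .
  qed
  ultimately show ?thesis by blast
qed

text \<open>Generators carry their degree explicitly: it becomes the degree of a basis element, and
  a zero vector would not determine it.\<close>

definition gen :: "nat \<Rightarrow> (int \<times> (nat \<Rightarrow> 'a::field mpoly)) set \<Rightarrow> int \<Rightarrow> (nat \<Rightarrow> 'a mpoly) \<Rightarrow> bool"
  where "gen n G d v \<longleftrightarrow> (\<exists>w. (\<forall>x\<in>G. w x \<in> hpoly n (d - fst x)) \<and> v = (\<Sum>x\<in>G. vsc (w x) (snd x)))"

lemma gen_add:
  assumes "gen n G d v" "gen n G d v'" shows "gen n G d (v + v')"
proof -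
  obtain w w' where w: "\<forall>x\<in>G. w x \<in> hpoly n (d - fst x)" "v = (\<Sum>x\<in>G. vsc (w x) (snd x))"
    "\<forall>x\<in>G. w' x \<in> hpoly n (d - fst x)" "v' = (\<Sum>x\<in>G. vsc (w' x) (snd x))"
    using assms by (auto simp: gen_def)
  have "v + v' = (\<Sum>x\<in>G. vsc (w x + w' x) (snd x))"
    unfolding w(2,4) by (simp only: module.scale_left_distrib[OF module_vsc] sum.distrib)
  then show ?thesis unfolding gen_def using w by (intro exI[of _ "\<lambda>x. w x + w' x"]) auto
qed

lemma gen_mult:
  assumes "gen n G d v" "p \<in> hpoly n e" shows "gen n G (e + d) (vsc p v)"
proof -
  obtain w where w: "\<forall>x\<in>G. w x \<in> hpoly n (d - fst x)" "v = (\<Sum>x\<in>G. vsc (w x) (snd x))"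
    using assms by (auto simp: gen_def)
  have "vsc p v = (\<Sum>x\<in>G. vsc (p * w x) (snd x))"
    unfolding w(2) by (simp only: module.scale_sum_right[OF module_vsc] module.scale_scale[OF module_vsc])
  moreover have "p * w x \<in> hpoly n (e + d - fst x)" if "x \<in> G" for x
    using hpoly_mult[OF assms(2)] w(1) that by (simp add: add_diff_eq[symmetric])
  ultimately show ?thesis unfolding gen_def by (intro exI[of _ "\<lambda>x. p * w x"]) auto
qed

lemma gen_zero: "gen n G d 0"
  unfolding gen_def
  by (intro exI[of _ "\<lambda>_. 0"]) (simp add: hpoly_closed module.scale_zero_left[OF module_vsc])

lemma gen_sum: "(\<And>i. i \<in> I \<Longrightarrow> gen n G d (f i)) \<Longrightarrow> gen n G d (sum f I)"
  by (induction I rule: infinite_finite_induct) (simp_all add: gen_zero gen_add)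

lemma gen_base:
  assumes "finite G" "(d, g) \<in> G" shows "gen n G d g"
proof -
  have "(\<Sum>x\<in>G. vsc (if x = (d, g) then 1 else 0) (snd x)) = (\<Sum>x\<in>G. if x = (d, g) then g else 0)"
    by (intro sum.cong refl) (auto simp: vsc_def fun_eq_iff)
  also have "\<dots> = g" using assms by simp
  finally show ?thesis unfolding gen_def
    by (intro exI[of _ "\<lambda>x. if x = (d, g) then 1 else 0"]) (auto simp: hpoly_def homogeneous_def)
qed

locale graded_submodule = gmod vsc n Z "{0}"
  for n and Z :: "int \<Rightarrow> (nat \<Rightarrow> 'a::field mpoly) set" +
  fixes r :: nat and sh :: "nat \<Rightarrow> int"
  assumes Z_hvec: "Z d \<subseteq> hvec n r sh d"
    and Z_mult: "p \<in> hpoly n e \<Longrightarrow> v \<in> Z d \<Longrightarrow> vsc p v \<in> Z (e + d)"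
begin

definition generates :: "(int \<times> (nat \<Rightarrow> 'a mpoly)) set \<Rightarrow> bool"
  where "generates G \<longleftrightarrow> finite G \<and> (\<forall>x\<in>G. snd x \<in> Z (fst x)) \<and> (\<forall>d. \<forall>v\<in>Z d. gen n G d v)"

lemma degree_part_spanned:
  "\<exists>B. finite B \<and> B \<subseteq> Z d \<and> (\<forall>v\<in>Z d. \<exists>u. v = (\<Sum>x\<in>B. vsc (single 0 (u x)) x))"
proof -
  interpret vs: vector_space "\<lambda>(c :: 'a) v. vsc (single 0 c) v" by (rule vector_space_vsc)
  obtain B where B: "B \<subseteq> Z d" "vs.independent B" "Z d \<subseteq> vs.span B"
    using vs.maximal_independent_subset[of "Z d"] by blast
  obtain E where E: "finite E" "hvec n r sh d \<subseteq> vs.span E"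
    using hvec_finite_span[of n r sh d] by auto
  have "B \<subseteq> vs.span E" using B(1) Z_hvec E(2) by blast
  then have fB: "finite B" using vs.independent_span_bound[OF E(1) B(2)] by simp
  have "\<exists>u. v = (\<Sum>x\<in>B. vsc (single 0 (u x)) x)" if "v \<in> Z d" for v
    using B(3) that unfolding vs.span_finite[OF fB] by blast
  with B(1) fB show ?thesis by blast
qed

text \<open>Degrees below \<open>lo\<close> are zero, each degree up to \<open>B\<close> is
  finite-dimensional, and above \<open>B\<close> the vanishing of index 0 expresses every element
  through variables times elements of one degree less.\<close>

lemma finitely_generated:
  assumes ac: "\<And>j. B < j \<Longrightarrow> acyc n vsc Z {0} 0 j"
  shows "\<exists>G. generates G"
proof -
  have "\<exists>bas. \<forall>d. finite (bas d) \<and> bas d \<subseteq> Z d \<and>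
      (\<forall>v\<in>Z d. \<exists>u. v = (\<Sum>x\<in>bas d. vsc (single 0 (u x)) x))"
    by (intro choice allI degree_part_spanned)
  then obtain bas where bas0: "\<forall>d. finite (bas d) \<and> bas d \<subseteq> Z d \<and>
      (\<forall>v\<in>Z d. \<exists>u. v = (\<Sum>x\<in>bas d. vsc (single 0 (u x)) x))" ..
  have bas: "finite (bas d)" "bas d \<subseteq> Z d" for d
    by (rule conjunct1[OF bas0[rule_format]]) (rule conjunct1[OF conjunct2[OF bas0[rule_format]]])
  have span: "\<exists>u. v = (\<Sum>x\<in>bas d. vsc (single 0 (u x)) x)" if "v \<in> Z d" for d v
    using conjunct2[OF conjunct2[OF bas0[rule_format, of d]]] that by (rule bspec)
  define lo where "lo = Min (insert 0 (sh ` {..<r}))"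
  define G where "G = Sigma {lo..B} bas"
  have fG: "finite G" unfolding G_def using bas(1) by simp
  have low: "v = 0" if v: "v \<in> Z d" and d: "d < lo" for v d
  proof
    fix b
    have vh: "v \<in> hvec n r sh d" using v Z_hvec by blast
    show "v b = 0 b"
    proof (cases "b < r")
      case True
      then have "lo \<le> sh b" unfolding lo_def by (intro Min_le) auto
      then show ?thesis using hvecD[OF vh True] d homogeneous_neg[of "d - sh b" "v b"] by (simp add: hpoly_def)
    qed (use hvec_outside[OF vh] in simp)
  qed
  \<comment> \<open>The induction starts one below \<open>lo\<close>, where the module is
    zero.\<close>
  have "\<forall>v\<in>Z d. gen n G d v" if "lo - 1 \<le> d" for d
    using that
  proof (induction d rule: int_ge_induct)
    case base
    show ?case
    proof
      fix v assume "v \<in> Z (lo - 1)"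
      then have "v = 0" by (rule low) simp
      then show "gen n G (lo - 1) v" by (simp only: gen_zero)
    qed
  next
    case (step d)
    show ?case
    proof
      fix v assume v: "v \<in> Z (d + 1)"
      show "gen n G (d + 1) v"
      proof (cases "d + 1 \<le> B")
        case True
        obtain u where u: "v = (\<Sum>x\<in>bas (d + 1). vsc (single 0 (u x)) x)"
          using span[OF v] ..
        have "gen n G (d + 1) (vsc (single 0 (u x)) x)" if "x \<in> bas (d + 1)" for x
        proof -
          have "gen n G (d + 1) x"
            using that True step.hyps by (intro gen_base[OF fG]) (auto simp: G_def)
          moreover have "single 0 (u x) \<in> hpoly n 0"
            by (auto simp: hpoly_def polys_iff homogeneous_def)
          ultimately show ?thesis using gen_mult[of n G "d + 1" x _ 0] by simp
        qed
        then show ?thesis unfolding u by (rule gen_sum)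
      next
        case False
        then have "acyc n vsc Z {0} 0 (d + 1)" by (intro ac) simp
        with v obtain g where g: "\<And>u. u \<in> {1..n} \<Longrightarrow> g u \<in> Z d" "v - (\<Sum>u\<in>{1..n}. vsc (X u) (g u)) = 0"
          unfolding acyc_0_iff by force
        have "gen n G (d + 1) (vsc (X u) (g u))" if "u \<in> {1..n}" for u
        proof -
          have "X u \<in> hpoly n 1" using that by (simp add: hpoly_def homogeneous_X polys_X)
          from gen_mult[OF step.IH[rule_format, OF g(1)[OF that]] this] show ?thesis by (simp add: add.commute)
        qed
        then have "gen n G (d + 1) (\<Sum>u\<in>{1..n}. vsc (X u) (g u))" by (rule gen_sum)
        then show ?thesis using g(2) by simp
      qed
    qed
  qed
  moreover have "gen n G d v" if v: "v \<in> Z d" and d: "\<not> lo - 1 \<le> d" for d v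
  proof -
    have "v = 0" using v by (rule low) (use d in simp)
    then show ?thesis by (simp only: gen_zero)
  qed
  ultimately have "\<forall>v\<in>Z d. gen n G d v" for d by blast
  then have "generates G" using fG bas(2) by (auto simp: generates_def G_def)
  then show ?thesis by blast
qed

text \<open>A relation with a constant coefficient lets one discard a generator.\<close>

lemma minimal_generators_relation:
  assumes G: "generates G" and min: "\<And>G'. generates G' \<Longrightarrow> card G \<le> card G'"
    and w: "\<And>x. x \<in> G \<Longrightarrow> w x \<in> hpoly n (d - fst x)"
    and rel: "(\<Sum>x\<in>G. vsc (w x) (snd x)) = 0" and x0: "x0 \<in> G"
  shows "lookup (w x0) 0 = 0"
proof (rule ccontr)
  assume c: "lookup (w x0) 0 \<noteq> 0"
  define c where "c = lookup (w x0) 0"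
  have fG: "finite G" using G by (simp add: generates_def)
  have hom: "homogeneous (d - fst x0) (w x0)" using w[OF x0] by (simp add: hpoly_def)
  have "0 \<in> keys (w x0)" using c by (simp add: in_keys_iff)
  then have "int (total_degree 0) = d - fst x0" using hom unfolding homogeneous_def by blast
  then have d: "fst x0 = d" by simp
  \<comment> \<open>By homogeneity a nonzero constant term forces degree 0, so this coefficient is
    an invertible scalar.\<close>
  have wc: "w x0 = single 0 c"
  proof (rule poly_mapping_eqI)
    fix m
    have "lookup (w x0) m = 0" if "m \<noteq> 0"
    proof (rule ccontr)
      assume "lookup (w x0) m \<noteq> 0"
      then have "int (total_degree m) = 0"
        using hom d by (auto simp: homogeneous_def in_keys_iff)
      then show False using that by (simp add: total_degree_eq_0_iff)
    qed
    then show "lookup (w x0) m = lookup (single 0 c) m"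
      by (cases "m = 0") (simp_all add: c_def lookup_single)
  qed
  define G' where "G' = G - {x0}"
  define s where "s = (\<Sum>x\<in>G'. vsc (w x) (snd x))"
  have rel': "vsc (single 0 c) (snd x0) + s = 0"
    using rel sum.remove[OF fG x0, of "\<lambda>x. vsc (w x) (snd x)"] by (simp add: wc s_def G'_def)
  have "gen n G' d s" using w unfolding gen_def s_def by (intro exI[of _ w]) (auto simp: G'_def)
  moreover have "single 0 (- 1 / c) \<in> hpoly n 0"
    by (auto simp: hpoly_def polys_iff homogeneous_def)
  ultimately have "gen n G' (0 + d) (vsc (single 0 (- 1 / c)) s)"
    by (rule gen_mult)
  moreover have "vsc (single 0 (- 1 / c)) s = snd x0"
  proof -
    have "s = vsc (single 0 (- c)) (snd x0)"
      using rel' by (simp add: eq_neg_iff_add_eq_0 add.commute single_uminus module.scale_minus_left[OF module_vsc])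
    then show ?thesis
      using c by (simp add: module.scale_scale[OF module_vsc] mult_single c_def module.scale_one[OF module_vsc])
  qed
  ultimately have x0gen: "gen n G' d (snd x0)" by simp
  have "gen n G' e v" if v: "v \<in> Z e" for e v
  proof -
    obtain u where u: "\<And>x. x \<in> G \<Longrightarrow> u x \<in> hpoly n (e - fst x)" "v = (\<Sum>x\<in>G. vsc (u x) (snd x))"
      using G v unfolding generates_def gen_def by blast
    have "v = vsc (u x0) (snd x0) + (\<Sum>x\<in>G'. vsc (u x) (snd x))"
      unfolding u(2) G'_def by (rule sum.remove[OF fG x0])
    moreover have "gen n G' e (vsc (u x0) (snd x0))"
      using gen_mult[OF x0gen u(1)[OF x0]] d by simp
    moreover have "gen n G' e (\<Sum>x\<in>G'. vsc (u x) (snd x))"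
      using u(1) unfolding gen_def by (intro exI[of _ u]) (auto simp: G'_def)
    ultimately show ?thesis by (simp add: gen_add)
  qed
  then have "generates G'" using G by (auto simp: generates_def G'_def)
  then have "card G \<le> card G'" by (rule min)
  then show False using card_Diff1_less[OF fG x0] by (simp add: G'_def)
qed

text \<open>The columns of \<open>D\<close> are a generating set of least cardinality, numbered by
  \<open>h\<close>. Leastness excludes relations with a constant term, and this is what makes the
  next map minimal.\<close>

lemma minimal_presentation:
  assumes ac: "\<And>j. B < j \<Longrightarrow> acyc n vsc Z {0} 0 j"
  shows "\<exists>c shc D. homat n r c D sh shc \<and>
    (\<forall>d. (\<forall>w\<in>hvec n c shc d. matv r c D w \<in> Z d) \<and> (\<forall>v\<in>Z d. \<exists>w\<in>hvec n c shc d. matv r c D w = v)) \<and>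
    (\<forall>d. \<forall>w\<in>ker n {} r c D shc d. \<forall>b<c. lookup (w b) 0 = 0)"
proof -
  obtain G where G: "generates G" and min: "\<And>G'. generates G' \<Longrightarrow> card G \<le> card G'"
    using finitely_generated[OF ac] ex_has_least_nat[of generates _ card] by metis
  have fG: "finite G" using G by (simp add: generates_def)
  obtain h where h: "bij_betw h {0..<card G} G"
    using ex_bij_betw_nat_finite[OF fG] by blast
  define c where "c = card G"
  define shc where "shc b = fst (h b)" for b
  define D where "D a b = snd (h b) a" for a b
  have h: "bij_betw h {..<c} G" using h by (simp add: c_def atLeast0LessThan)
  then have hG: "h b \<in> G" if "b < c" for b using that by (auto simp: bij_betw_def)
  have hZ: "snd (h b) \<in> Z (shc b)" if "b < c" for b
    using G hG[OF that] by (simp add: generates_def shc_def)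
  have hom: "homat n r c D sh shc"
    unfolding homat_def D_def
  proof (intro allI impI)
    fix a b assume "a < r" "b < c"
    then show "snd (h b) a \<in> hpoly n (shc b - sh a)"
      using hZ Z_hvec hvecD by blast
  qed
  have matv: "matv r c D w = (\<Sum>b<c. vsc (w b) (snd (h b)))" for w
  proof
    fix a
    have "snd (h b) a = 0" if "b < c" "\<not> a < r" for b
      using hZ[OF that(1)] Z_hvec hvec_outside[of "snd (h b)" n r sh "shc b" a] that(2) by fastforce
    then show "matv r c D w a = (\<Sum>b<c. vsc (w b) (snd (h b))) a"
      by (simp add: matv_def D_def sum_fun_app vsc_def mult.commute)
  qed
  have reindex: "(\<Sum>b<c. vsc (w b) (snd (h b))) = (\<Sum>x\<in>G. vsc (w (inv_into {..<c} h x)) (snd x))" for w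
    using bij_betw_inv_into_left[OF h] by (simp flip: sum.reindex_bij_betw[OF h])
  have inv: "inv_into {..<c} h x < c" "h (inv_into {..<c} h x) = x" if "x \<in> G" for x
    using h that bij_betw_inv_into_right[OF h that] inv_into_into[of x h "{..<c}"] by (auto simp: bij_betw_def)
  have winv: "w (inv_into {..<c} h x) \<in> hpoly n (d - fst x)"
    if "w \<in> hvec n c shc d" "x \<in> G" for w d x
    using hvecD[OF that(1) inv(1)[OF that(2)]] inv(2)[OF that(2)] by (simp add: shc_def)
  have "matv r c D w \<in> Z d" if w: "w \<in> hvec n c shc d" for w d
    unfolding matv
  proof (rule A_sum)
    fix b assume "b \<in> {..<c}"
    then have b: "b < c" by simp
    show "vsc (w b) (snd (h b)) \<in> Z d" using Z_mult[OF hvecD[OF w b] hZ[OF b]] by simp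
  qed
  moreover have "\<exists>w\<in>hvec n c shc d. matv r c D w = v" if v: "v \<in> Z d" for v d
  proof -
    obtain u where u: "\<And>x. x \<in> G \<Longrightarrow> u x \<in> hpoly n (d - fst x)" "v = (\<Sum>x\<in>G. vsc (u x) (snd x))"
      using G v unfolding generates_def gen_def by blast
    define w where "w b = (if b < c then u (h b) else 0)" for b
    have "w \<in> hvec n c shc d" using u(1) hG by (auto simp: hvec_def w_def shc_def)
    moreover have "matv r c D w = v"
      unfolding matv u(2) by (simp add: w_def sum.reindex_bij_betw[OF h, of "\<lambda>x. vsc (u x) (snd x)"])
    ultimately show ?thesis by blast
  qed
  moreover have "lookup (w b) 0 = 0" if w: "w \<in> ker n {} r c D shc d" and b: "b < c" for w d b
  proof -
    have wh: "w \<in> hvec n c shc d" using w by (simp add: ker_def)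
    have "matv r c D w = 0" using w by (auto simp: ker_def sqf_empty matv_def fun_eq_iff)
    then have "(\<Sum>x\<in>G. vsc (w (inv_into {..<c} h x)) (snd x)) = 0"
      unfolding matv reindex .
    from minimal_generators_relation[OF G min winv[OF wh] this hG[OF b]]
    show ?thesis using bij_betw_inv_into_left[OF h, of b] b by simp
  qed
  ultimately show ?thesis using hom by blast
qed

end

lemma graded_submodule_ker: "upclosed V \<Longrightarrow> graded_submodule n (ker n V r' r M sh) r sh"
  by (intro graded_submodule.intro graded_submodule_axioms.intro gmod_ker ker_mult)
     (auto simp: ker_def)

text \<open>Dependent choice of one presentation after another. The invariant carries a vanishing
  bound for the current kernel, which keeps it finitely generated. As the ideal is proper, R itself
  is a minimal cover of R/I to start from.\<close>

lemma minimal_resolution_exists: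
  assumes U: "upclosed U" "{} \<notin> U" and reg: "reg_le n (sqf n U :: 'a::field mpoly set) B"
  shows "\<exists>F. minimal_graded_free_resolution n (sqf n U :: 'a mpoly set) F"
proof -
  \<comment> \<open>A state is a matrix together with the ranks and basis degrees of its two ends;
    \<open>start\<close> is the one-by-one matrix 1, read as the augmentation.\<close>
  define K where "K i = (\<lambda>(r', sh' :: nat \<Rightarrow> int, r, sh, M :: nat \<Rightarrow> nat \<Rightarrow> 'a mpoly). ker n (level U i) r' r M sh)" for i
  define start where "start = (1 :: nat, (\<lambda>_. 0) :: nat \<Rightarrow> int, 1 :: nat, (\<lambda>_. 0) :: nat \<Rightarrow> int, (\<lambda>_ _. 1) :: nat \<Rightarrow> nat \<Rightarrow> 'a mpoly)"
  define P where "P i s = (case s of (r', sh', r, sh, M) \<Rightarrow>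
      homat n r' r M sh' sh \<and> (\<forall>d. \<forall>v\<in>K i s d. \<forall>b<r. lookup (v b) 0 = 0) \<and>
      (\<exists>B. \<forall>p j. B + int p < j \<longrightarrow> acyc n vsc (K i s) {0} p j) \<and> (i = 0 \<longrightarrow> s = start))" for i s
  define Q where "Q i s s2 = (case (s, s2) of ((r', sh' :: nat \<Rightarrow> int, r, sh, M :: nat \<Rightarrow> nat \<Rightarrow> 'a mpoly), (r2, sh2, c, shc, D)) \<Rightarrow>
      r2 = r \<and> sh2 = sh \<and> hexact_at n (level U i) r' r c M D sh shc)" for i s s2
  have "\<exists>f. \<forall>i. P i (f i) \<and> Q i (f i) (f (Suc i))"
  proof (rule dependent_nat_choice)
    have K0: "K 0 start d = {v \<in> hvec n 1 (\<lambda>_. 0) d. v 0 \<in> sqf n U}" for d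
      by (simp add: K_def start_def ker_def)
    interpret c: free_cover "(*)" n "hpoly n" "sqf n U :: 'a mpoly set" 1 "\<lambda>_. 0" "\<lambda>v. v 0"
    proof (intro free_cover.intro free_cover_axioms.intro gmod_sqf U(1))
      fix d and a :: "'a mpoly" assume "a \<in> hpoly n d"
      then show "\<exists>v\<in>hvec n 1 (\<lambda>_. 0) d. v 0 - a \<in> sqf n U"
        by (intro bexI[of _ "\<lambda>b. if b = 0 then a else 0"]) (auto simp: hvec_def sqf_zero)
    qed (auto simp: vsc_def hvec_def)
    have Z: "c.Z = K 0 start" by (rule ext) (simp only: c.Z_def K0)
    have const: "lookup (v b) 0 = 0" if "v \<in> K 0 start d" "b < 1" for v d b
    proof (rule ccontr)
      assume "lookup (v b) 0 \<noteq> 0"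
      then have "0 \<in> keys (v 0)" using that by (simp add: in_keys_iff)
      then show False using that U(2) by (auto simp: K0 sqf_def)
    qed
    \<comment> \<open>Passing to the kernel lowers the index by one at a fixed degree, so the bound
      grows by one.\<close>
    have "acyc n vsc (K 0 start) {0} p j" if "B + 1 + int p < j" for p j
    proof -
      have "acyc n vsc c.Z {0} p j"
      proof (rule c.acyc_syzygy)
        show "hacyc n (sqf n U :: 'a mpoly set) (Suc p) j"
          using that by (intro reg_leD[OF reg]) simp
      next
        fix v and b :: nat assume "v \<in> c.Z j" "b < 1"
        then show "lookup (v b) 0 = 0" unfolding Z by (rule const)
      qed
      then show ?thesis by (simp only: Z)
    qed
    then have "P 0 start"
      using const unfolding P_def start_def by (auto simp: homat_def hpoly_def homogeneous_def)
    then show "\<exists>s. P 0 s" by blast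
  next
    fix s i assume Ps: "P i s"
    obtain r' sh' r sh M where s: "s = (r', sh', r, sh, M)" by (cases s) auto
    have Ks: "K i s = ker n (level U i) r' r M sh" by (simp add: K_def s)
    obtain B where B: "\<And>p j. B + int p < j \<Longrightarrow> acyc n vsc (ker n (level U i) r' r M sh) {0} p j"
      using Ps by (auto simp: P_def s Ks[unfolded s])
    interpret gs: graded_submodule n "ker n (level U i) r' r M sh" r sh
      by (intro graded_submodule_ker upclosed_level U)
    obtain c shc D where D: "homat n r c D sh shc" "hexact_at n (level U i) r' r c M D sh shc"
        "\<And>d w b. w \<in> ker n {} r c D shc d \<Longrightarrow> b < c \<Longrightarrow> lookup (w b) 0 = 0"
      using gs.minimal_presentation[of B] B[of 0] unfolding hexact_at_def by auto
    interpret fc: free_cover vsc n "ker n (level U i) r' r M sh" "{0}" c shc "matv r c D"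
      by (rule free_cover_ker(1)[OF upclosed_level[OF U(1)] D(2)])
    have Z: "fc.Z = ker n {} r c D shc"
      by (rule free_cover_ker(2)[OF upclosed_level[OF U(1)] D(2)])
    have "acyc n vsc (ker n {} r c D shc) {0} p j" if "B + 1 + int p < j" for p j
    proof -
      have "acyc n vsc fc.Z {0} p j"
      proof (rule fc.acyc_syzygy)
        show "acyc n vsc (ker n (level U i) r' r M sh) {0} (Suc p) j" using that by (intro B) simp
      qed (use D(3) Z in auto)
      then show ?thesis by (simp only: Z)
    qed
    then have "P (Suc i) (r, sh, c, shc, D)"
      using D(1,3) unfolding P_def K_def by auto
    moreover have "Q i s (r, sh, c, shc, D)" using D(2) by (simp add: Q_def s)
    ultimately show "\<exists>s2. P (Suc i) s2 \<and> Q i s s2" by blast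
  qed
  then obtain f where P: "\<And>i. P i (f i)" and Q: "\<And>i. Q i (f i) (f (Suc i))" by blast
  define r' sh' r sh M where "r' i = fst (f i)" and "sh' i = fst (snd (f i))" and "r i = fst (snd (snd (f i)))"
    and "sh i = fst (snd (snd (snd (f i))))" and "M i = snd (snd (snd (snd (f i))))" for i
  have f: "f i = (r' i, sh' i, r i, sh i, M i)" for i
    by (simp add: r'_def sh'_def r_def sh_def M_def)
  have hom: "homat n (r' i) (r i) (M i) (sh' i) (sh i)" for i
    using P[of i] by (simp add: P_def f)
  have const: "lookup (v b) 0 = 0" if "v \<in> ker n (level U i) (r' i) (r i) (M i) (sh i) d" "b < r i" for v b i d
    using P[of i] that by (auto simp: P_def f K_def)
  have start: "r' 0 = 1" "sh' 0 = (\<lambda>_. 0)" "r 0 = 1" "sh 0 = (\<lambda>_. 0)" "M 0 = (\<lambda>_ _. 1)"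
    using P[of 0] by (auto simp: P_def f start_def)
  have suc: "r' (Suc i) = r i" "sh' (Suc i) = sh i" for i
    using Q[of i] by (auto simp: Q_def f)
  have hex: "hexact_at n (level U i) (r' i) (r i) (r (Suc i)) (M i) (M (Suc i)) (sh i) (sh (Suc i))" for i
    using Q[of i] by (auto simp: Q_def f)
  define F where "F = \<lparr>rnk = r, shift = sh, aug = (\<lambda>_. 1), diff = (\<lambda>i. M (Suc i))\<rparr>"
  have F: "trk F i = r' i" "tsh F i = sh' i" "mx F i = M i" for i
    by (cases i; simp add: F_def start suc)+
  have homS: "homat n (r i) (r (Suc i)) (M (Suc i)) (sh i) (sh (Suc i))" for i
    using hom[of "Suc i"] by (simp add: suc)
  have "graded_free_resolution n (sqf n U) F"
    unfolding graded_free_resolution_iff F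
  proof (intro conjI allI ballI)
    fix p :: "'a mpoly" assume "p \<in> polys n"
    then show "\<exists>v\<in>free_module n (rnk F 0). p - (\<Sum>b<rnk F 0. aug F b * v b) \<in> sqf n U"
      by (intro bexI[of _ "restrict (\<lambda>_. p) {..<1}"]) (auto simp: F_def start free_module_iff sqf_zero)
  next
    show "exact_at n (level U i) (r' i) (rnk F i) (rnk F (Suc i)) (M i) (diff F i)" for i
      using hexact_imp_exact[OF hom[of i] homS[of i] upclosed_level[OF U(1)] hex[of i]] by (simp add: F_def)
  qed (simp add: F_def hom)
  \<comment> \<open>A column of the differential is the image of a basis vector, hence lies in the
    previous kernel, whose elements have no constant terms.\<close>
  moreover have "lookup (diff F i a b) 0 = 0" if "a < rnk F i" "b < rnk F (Suc i)" for i a b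
  proof -
    define e :: "nat \<Rightarrow> 'a mpoly" where "e b' = (if b' = b then 1 else 0)" for b'
    have ab: "a < r i" "b < r (Suc i)" using that by (auto simp: F_def)
    then have "e \<in> hvec n (r (Suc i)) (sh (Suc i)) (sh (Suc i) b)"
      by (auto simp: hvec_def e_def hpoly_def homogeneous_def)
    then have "matv (r i) (r (Suc i)) (M (Suc i)) e \<in> ker n (level U i) (r' i) (r i) (M i) (sh i) (sh (Suc i) b)"
      using hex[of i] by (simp add: hexact_at_def)
    then have "lookup (matv (r i) (r (Suc i)) (M (Suc i)) e a) 0 = 0"
      using const ab by blast
    moreover have "matv (r i) (r (Suc i)) (M (Suc i)) e a = M (Suc i) a b"
      using ab by (simp add: matv_def e_def if_distrib[of "\<lambda>x. _ * x"] cong: if_cong)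
    ultimately show ?thesis by (simp add: F_def)
  qed
  ultimately show ?thesis unfolding minimal_graded_free_resolution_def by auto
qed

section \<open>Regularity as the extreme strand of Koszul homology\<close>

lemma acyc_negative: "j < int i \<Longrightarrow> hacyc n (sqf n U :: 'a::field mpoly set) i j"
  unfolding acyc_def
proof (intro ballI impI)
  fix c :: "nat set \<Rightarrow> 'a mpoly" assume j: "j < int i" and c: "c \<in> hchain n i j"
  have "c S = 0" for S
    using chainD1[OF c, of S] chainD0[OF c, of S] j homogeneous_neg[of "j - int i" "c S"]
    by (cases "S \<subseteq> {1..n} \<and> card S = i") (auto simp: hpoly_def)
  moreover have "(\<lambda>_. 0) \<in> hchain n (Suc i) j" by (auto simp: chain_def)
  ultimately show "\<exists>f\<in>hchain n (Suc i) j. \<forall>S. c S - hbd n f S \<in> sqf n U"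
    by (intro bexI[of _ "\<lambda>_. 0"]) (auto simp: bd_def sqf_zero)
qed

text \<open>Existence makes the \<open>SOME\<close> in \<open>graded_betti\<close> a genuine minimal
  resolution, and \<open>minimal_resolution_generators\<close> holds for whichever one is chosen. By
  \<open>acyc_negative\<close> the differences \<open>j - i\<close> are nonnegative, so the set
  under \<open>Max\<close> is finite.\<close>

lemma reg_quot_sqf:
  assumes U: "upclosed U" "{} \<notin> U" and reg: "reg_le n (sqf n U :: 'a::field mpoly set) r"
    and attained: "\<not> hacyc n (sqf n U :: 'a mpoly set) i0 (int i0 + r)"
  shows "reg_quot n (sqf n U :: 'a mpoly set) = r"
proof -
  define F where "F = (SOME F. minimal_graded_free_resolution n (sqf n U :: 'a mpoly set) F)"
  have F: "minimal_graded_free_resolution n (sqf n U :: 'a mpoly set) F"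
    unfolding F_def by (rule someI_ex[OF minimal_resolution_exists[OF U reg]])
  have betti: "graded_betti n (sqf n U :: 'a mpoly set) i j \<noteq> 0 \<longleftrightarrow>
      \<not> hacyc n (sqf n U :: 'a mpoly set) i j" for i j
  proof -
    have "finite {b. b < rnk F i \<and> shift F i b = j}" by simp
    then have "graded_betti n (sqf n U :: 'a mpoly set) i j \<noteq> 0 \<longleftrightarrow> (\<exists>b<rnk F i. shift F i b = j)"
      unfolding graded_betti_def Let_def F_def[symmetric] by (auto simp: card_eq_0_iff)
    then show ?thesis using minimal_resolution_generators[OF U(1) F] by blast
  qed
  let ?S = "{j - int i | i j. graded_betti n (sqf n U :: 'a mpoly set) i j \<noteq> 0}"
  have bounds: "0 \<le> x \<and> x \<le> r" if xS: "x \<in> ?S" for x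
  proof -
    obtain i j where x: "x = j - int i" "\<not> hacyc n (sqf n U :: 'a mpoly set) i j"
      using xS betti by blast
    then have "\<not> j < int i" "\<not> r + int i < j" using acyc_negative reg_leD[OF reg] by blast+
    then show ?thesis using x by simp
  qed
  then have "?S \<subseteq> {0..r}" by (intro subsetI) (simp only: atLeastAtMost_iff)
  then have "finite ?S" by (rule finite_subset) simp
  moreover have "r \<in> ?S"
    using attained betti by (intro CollectI exI[of _ i0] exI[of _ "int i0 + r"]) simp
  ultimately show ?thesis
    unfolding reg_quot_def using bounds by (intro Max_eqI) blast+
qed

section \<open>Squarefree powers of path ideals\<close>

definition mideal :: "nat \<Rightarrow> monom set \<Rightarrow> 'a::field mpoly set"
  where "mideal n G = {p \<in> polys n. \<forall>m\<in>keys p. \<exists>g\<in>G. monom_dvd g m}"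

lemma monom_dvd_refl: "monom_dvd m m"
  by (simp add: monom_dvd_def)

lemma monom_dvd_trans: "monom_dvd a b \<Longrightarrow> monom_dvd b c \<Longrightarrow> monom_dvd a c"
  using order_trans unfolding monom_dvd_def by blast

lemma monom_dvd_add: "monom_dvd a b \<Longrightarrow> monom_dvd a (c + b)"
  by (simp add: monom_dvd_def lookup_add trans_le_add2)

lemma monom_dvd_add_mono: "monom_dvd a b \<Longrightarrow> monom_dvd c d \<Longrightarrow> monom_dvd (a + c) (b + d)"
  by (simp add: monom_dvd_def lookup_add add_mono)

lemma monom_dvd_diff: "monom_dvd a b \<Longrightarrow> (b - a) + a = b"
  by (rule poly_mapping_eqI) (simp add: monom_dvd_def lookup_add lookup_minus)

lemma monom_dvd_antisym_degree: "monom_dvd a b \<Longrightarrow> total_degree b \<le> total_degree a \<Longrightarrow> a = b"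
  using monom_dvd_diff[of a b] total_degree_add[of "b - a" a] total_degree_eq_0_iff[of "b - a"] by simp

lemma monom_dvd_keys: "monom_dvd a b \<Longrightarrow> keys a \<subseteq> keys b"
  unfolding monom_dvd_def in_keys_iff subset_iff by (metis le_zero_eq)

lemma monom_poly_in_mideal: "(monom_poly m :: 'a::field mpoly) \<in> mideal n G \<longleftrightarrow> keys m \<subseteq> {1..n} \<and> (\<exists>g\<in>G. monom_dvd g m)"
  by (simp add: mideal_def polys_iff monom_poly_def)

lemma ideal_mideal: "ideal (mideal n G :: 'a::field mpoly set) (poly_ring n)"
proof -
  interpret cring "poly_ring n :: 'a mpoly ring" by (rule cring_poly_ring)
  have mult: "x * p \<in> mideal n G" if "p \<in> mideal n G" "x \<in> polys n" for x p :: "'a mpoly"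
  proof -
    have "\<exists>g\<in>G. monom_dvd g m" if m: "m \<in> keys (x * p)" for m
    proof -
      obtain a b where "m = a + b" "b \<in> keys p" using m keys_mult[of x p] by blast
      moreover from this obtain g where "g \<in> G" "monom_dvd g b"
        using \<open>p \<in> mideal n G\<close> by (auto simp: mideal_def)
      ultimately show ?thesis by (intro bexI[of _ g]) (simp_all add: monom_dvd_add)
    qed
    then show ?thesis using that by (auto simp: mideal_def)
  qed
  show ?thesis
  proof (rule idealI)
    show "subgroup (mideal n G) (add_monoid (poly_ring n :: 'a mpoly ring))"
    proof (rule group.subgroupI[OF a_group])
      fix a :: "'a mpoly" assume a: "a \<in> mideal n G"
      then have "a \<in> polys n" by (simp add: mideal_def)
      then have "\<ominus>\<^bsub>poly_ring n\<^esub> a = - a" by (intro minus_equality) auto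
      moreover have "- a \<in> mideal n G" using mult[OF a polys_uminus[OF polys_one]] by simp
      ultimately show "inv\<^bsub>add_monoid (poly_ring n)\<^esub> a \<in> mideal n G" by (simp add: a_inv_def)
    next
      fix a b :: "'a mpoly" assume "a \<in> mideal n G" "b \<in> mideal n G"
      then show "a \<otimes>\<^bsub>add_monoid (poly_ring n)\<^esub> b \<in> mideal n G"
        using keys_add[of a b] by (auto simp: mideal_def)
    next
      have "(0 :: 'a mpoly) \<in> mideal n G" by (simp add: mideal_def)
      then show "(mideal n G :: 'a mpoly set) \<noteq> {}" by blast
    qed (auto simp: mideal_def)
  next
    fix a x :: "'a mpoly" assume "a \<in> mideal n G" "x \<in> polys n"
    then have "x * a \<in> mideal n G" by (rule mult)
    then show "x \<otimes>\<^bsub>poly_ring n\<^esub> a \<in> mideal n G" "a \<otimes>\<^bsub>poly_ring n\<^esub> x \<in> mideal n G"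
      by (simp_all add: mult.commute)
  qed (rule ring_axioms)
qed

lemma monomial_in_polys: "keys m \<subseteq> {1..n} \<Longrightarrow> single m c \<in> polys n"
  by (simp add: polys_iff)

lemma Idl_monomials:
  assumes G: "\<And>g. g \<in> G \<Longrightarrow> keys g \<subseteq> {1..n}"
  shows "Idl\<^bsub>poly_ring n\<^esub> (monom_poly ` G) = (mideal n G :: 'a::field mpoly set)"
proof
  interpret cring "poly_ring n :: 'a mpoly ring" by (rule cring_poly_ring)
  show "Idl\<^bsub>poly_ring n\<^esub> (monom_poly ` G) \<subseteq> (mideal n G :: 'a mpoly set)"
  proof (intro genideal_minimal ideal_mideal image_subsetI)
    fix g assume "g \<in> G"
    then show "(monom_poly g :: 'a mpoly) \<in> mideal n G"
      using G monom_dvd_refl unfolding monom_poly_in_mideal by blast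
  qed
  show "mideal n G \<subseteq> Idl\<^bsub>poly_ring n\<^esub> (monom_poly ` G :: 'a mpoly set)"
  proof
    fix p :: "'a mpoly" assume p: "p \<in> mideal n G"
    have sub: "monom_poly ` G \<subseteq> (polys n :: 'a mpoly set)"
      using G by (auto simp: monom_poly_def polys_iff)
    interpret I: ideal "Idl\<^bsub>poly_ring n\<^esub> (monom_poly ` G :: 'a mpoly set)" "poly_ring n"
      by (rule genideal_ideal[OF sub])
    have single: "single m (lookup p m) \<in> Idl\<^bsub>poly_ring n\<^esub> (monom_poly ` G)" if m: "m \<in> keys p" for m
    proof -
      obtain g where g: "g \<in> G" "monom_dvd g m" using p m by (auto simp: mideal_def)
      have "keys (m - g) \<subseteq> keys m" by (auto simp: in_keys_iff lookup_minus)
      also have "\<dots> \<subseteq> {1..n}" using p m by (auto simp: mideal_def polys_iff)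
      finally have "single (m - g) (lookup p m) \<otimes>\<^bsub>poly_ring n\<^esub> monom_poly g \<in> Idl\<^bsub>poly_ring n\<^esub> (monom_poly ` G)"
        using genideal_self[OF sub] g(1) by (intro I.I_l_closed monomial_in_polys) auto
      then show ?thesis using monom_dvd_diff[OF g(2)] by (simp add: monom_poly_def mult_single)
    qed
    have "(\<Sum>m\<in>A. single m (lookup p m)) \<in> Idl\<^bsub>poly_ring n\<^esub> (monom_poly ` G)" if "A \<subseteq> keys p" for A
    proof -
      have "finite A" using that by (rule finite_subset) simp
      then show ?thesis using that
      proof (induction A)
        case empty
        then show ?case using I.zero_closed by simp
      next
        case (insert m A)
        then show ?case using I.a_closed[OF single, of m] by simp
      qed
    qed
    from this[of "keys p"] show "p \<in> Idl\<^bsub>poly_ring n\<^esub> (monom_poly ` G)" by (simp add: sum_single_lookup)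
  qed
qed

definition msum :: "monom set \<Rightarrow> monom set \<Rightarrow> monom set"
  where "msum G H = {a + b | a b. a \<in> G \<and> b \<in> H}"

lemma ideal_prod_mideal:
  assumes H: "\<And>h. h \<in> H \<Longrightarrow> keys h \<subseteq> {1..n}" and G: "\<And>g. g \<in> G \<Longrightarrow> keys g \<subseteq> {1..n}"
  shows "ideal_prod (poly_ring n) (mideal n G) (mideal n H) = (mideal n (msum G H) :: 'a::field mpoly set)"
proof (intro subset_antisym subsetI)
  fix p :: "'a mpoly" assume "p \<in> ideal_prod (poly_ring n) (mideal n G) (mideal n H)"
  then show "p \<in> mideal n (msum G H)"
  proof (induction rule: ideal_prod.induct)
    case (prod i j)
    have "\<exists>g\<in>msum G H. monom_dvd g m" if m: "m \<in> keys (i * j)" for m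
    proof -
      obtain a b where ab: "m = a + b" "a \<in> keys i" "b \<in> keys j"
        using m keys_mult[of i j] by blast
      obtain g where "g \<in> G" "monom_dvd g a"
        using prod(1) ab(2) unfolding mideal_def by blast
      moreover obtain h where "h \<in> H" "monom_dvd h b"
        using prod(2) ab(3) unfolding mideal_def by blast
      ultimately show ?thesis using ab by (intro bexI[of _ "g + h"]) (auto simp: msum_def monom_dvd_add_mono)
    qed
    moreover have "i \<in> polys n" "j \<in> polys n" using prod unfolding mideal_def by blast+
    then have "i * j \<in> polys n" by (rule polys_mult)
    ultimately show ?case unfolding mideal_def poly_ring_simps by blast
  next
    case (sum s1 s2)
    show ?case by (rule additive_subgroup.a_closed[OF ideal.axioms(1)[OF ideal_mideal] sum.IH])
  qed
next
  fix p :: "'a mpoly" assume p: "p \<in> mideal n (msum G H)"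
  let ?P = "ideal_prod (poly_ring n) (mideal n G) (mideal n H) :: 'a mpoly set"
  have single: "single m (lookup p m) \<in> ?P" if m: "m \<in> keys p" for m
  proof -
    obtain g h where gh: "g \<in> G" "h \<in> H" "monom_dvd (g + h) m"
      using p m by (auto simp: mideal_def msum_def)
    let ?q = "m - (g + h)"
    have mn: "keys m \<subseteq> {1..n}" using p m by (auto simp: mideal_def polys_iff)
    have eq: "(?q + g) + h = m" using monom_dvd_diff[OF gh(3)] by (simp add: add.assoc)
    then have "keys (?q + g) \<subseteq> {1..n}" using mn keys_plus_nat[of "?q + g" h] by simp
    then have "single (?q + g) (lookup p m) \<in> mideal n G"
      using gh(1) monom_dvd_add[OF monom_dvd_refl] by (auto simp: mideal_def polys_iff)
    moreover have "(monom_poly h :: 'a mpoly) \<in> mideal n H"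
      using H[OF gh(2)] gh(2) monom_dvd_refl by (auto simp: monom_poly_in_mideal)
    ultimately have "single (?q + g) (lookup p m) \<otimes>\<^bsub>poly_ring n\<^esub> monom_poly h \<in> ?P"
      by (rule ideal_prod.prod)
    then show ?thesis by (simp add: monom_poly_def mult_single eq)
  qed
  have "(\<Sum>m\<in>A. single m (lookup p m)) \<in> ?P" if "A \<subseteq> keys p" for A
  proof -
    have "finite A" using that by (rule finite_subset) simp
    then show ?thesis using that
    proof (induction A)
      case empty
      have "(0 :: 'a mpoly) \<otimes>\<^bsub>poly_ring n\<^esub> 0 \<in> ?P"
        by (rule ideal_prod.prod) (simp_all add: mideal_def)
      then show ?case by simp
    next
      case (insert m A)
      then have "single m (lookup p m) \<oplus>\<^bsub>poly_ring n\<^esub> (\<Sum>m\<in>A. single m (lookup p m)) \<in> ?P"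
        by (intro ideal_prod.sum single) auto
      with insert show ?case by simp
    qed
  qed
  from this[of "keys p"] show "p \<in> ?P" by (simp add: sum_single_lookup)
qed

primrec sums :: "monom set \<Rightarrow> nat \<Rightarrow> monom set" where
  "sums G 0 = {0}"
| "sums G (Suc k) = msum (sums G k) G"

lemma sums_keys: "(\<And>g. g \<in> G \<Longrightarrow> keys g \<subseteq> {1..n}) \<Longrightarrow> m \<in> sums G k \<Longrightarrow> keys m \<subseteq> {1..n}"
  by (induction k arbitrary: m) (fastforce simp: msum_def keys_plus_nat)+

lemma sums_degree: "(\<And>g. g \<in> G \<Longrightarrow> total_degree g = t) \<Longrightarrow> m \<in> sums G k \<Longrightarrow> total_degree m = k * t"
  by (induction k arbitrary: m) (fastforce simp: msum_def total_degree_add)+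

lemma ideal_power_mideal:
  assumes G: "\<And>g. g \<in> G \<Longrightarrow> keys g \<subseteq> {1..n}"
  shows "mideal n G [^]\<^bsub>ideals_set (poly_ring n)\<^esub> k = (mideal n (sums G k) :: 'a::field mpoly set)"
proof (induction k)
  case 0
  have "monom_dvd 0 m" for m by (simp add: monom_dvd_def)
  then show ?case by (simp add: nat_pow_def ideals_set_def mideal_def)
next
  case (Suc k)
  then show ?case
    using ideal_prod_mideal[of G n "sums G k", OF G sums_keys[OF G]]
    by (simp add: nat_pow_def ideals_set_def)
qed

section \<open>Generators of the path ideal and of its squarefree powers\<close>

definition path_monoms :: "nat \<Rightarrow> nat \<Rightarrow> monom set"
  where "path_monoms m t = {smon {i..<i + t} | i. 1 \<le> i \<and> i + t \<le> m + 1}"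

text \<open>All these intervals have \<open>t\<close> elements and no face has more, so none is
  properly contained in a face.\<close>

lemma facets_path_complex:
  assumes "1 \<le> t" "t \<le> m"
  shows "facets (\<Gamma> m t) = {{i..<i + t} | i. 1 \<le> i \<and> i + t \<le> m + 1}"
proof (intro subset_antisym subsetI)
  have int: "{i..i + t - 1} = {i..<i + t}" for i using assms(1) by auto
  have \<Gamma>: "A \<in> \<Gamma> m t \<longleftrightarrow> (\<exists>i. 1 \<le> i \<and> i + t \<le> m + 1 \<and> A \<subseteq> {i..<i + t})" for A
  proof -
    have "i \<in> {1..m - t + 1} \<longleftrightarrow> 1 \<le> i \<and> i + t \<le> m + 1" for i using assms(2) by auto
    then show ?thesis unfolding path_complex_def int by blast
  qed
  show "F \<in> {{i..<i + t} | i. 1 \<le> i \<and> i + t \<le> m + 1}" if F: "F \<in> facets (\<Gamma> m t)" for F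
  proof -
    obtain i where i: "1 \<le> i" "i + t \<le> m + 1" "F \<subseteq> {i..<i + t}" using F by (auto simp: facets_def \<Gamma>)
    then have "{i..<i + t} \<in> \<Gamma> m t" by (auto simp: \<Gamma>)
    then have "{i..<i + t} = F" using F i(3) by (auto simp: facets_def)
    then show ?thesis using i by blast
  qed
  show "F \<in> facets (\<Gamma> m t)" if F: "F \<in> {{i..<i + t} | i. 1 \<le> i \<and> i + t \<le> m + 1}" for F
  proof -
    obtain i where i: "1 \<le> i" "i + t \<le> m + 1" "F = {i..<i + t}" using F by blast
    have "G = F" if "G \<in> \<Gamma> m t" "F \<subseteq> G" for G
    proof -
      obtain j where j: "G \<subseteq> {j..<j + t}" using \<open>G \<in> \<Gamma> m t\<close> by (auto simp: \<Gamma>)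
      then have "finite G" by (rule finite_subset) simp
      moreover have "card G \<le> card F" using card_mono[OF _ j] by (simp add: i)
      ultimately show ?thesis using card_seteq[OF _ \<open>F \<subseteq> G\<close>] by simp
    qed
    moreover have "F \<in> \<Gamma> m t" using i by (auto simp: \<Gamma>)
    ultimately show ?thesis by (auto simp: facets_def)
  qed
qed

lemma prod_X: "finite F \<Longrightarrow> (\<Prod>j\<in>F. X j) = (monom_poly (smon F) :: 'a::field mpoly)"
  by (induction F rule: finite_induct) (simp_all add: smon_def monom_poly_def X_def mult_single)

lemma path_monoms_keys: "g \<in> path_monoms m t \<Longrightarrow> m \<le> n \<Longrightarrow> keys g \<subseteq> {1..n}"
  by (auto simp: path_monoms_def)

lemma path_ideal_mideal:
  assumes "1 \<le> t" "t \<le> m" "m \<le> n"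
  shows "path_ideal n m t = (mideal n (path_monoms m t) :: 'a::field mpoly set)"
proof -
  have "{\<Prod>j\<in>F. X j :: 'a mpoly | F. F \<in> facets (\<Gamma> m t)} = (\<lambda>F. \<Prod>j\<in>F. X j) ` facets (\<Gamma> m t)"
    by blast
  also have "\<dots> = (\<lambda>F. monom_poly (smon F)) ` facets (\<Gamma> m t)"
    by (intro image_cong refl prod_X) (auto simp: facets_path_complex[OF assms(1,2)])
  also have "\<dots> = monom_poly ` path_monoms m t"
    unfolding facets_path_complex[OF assms(1,2)] path_monoms_def by blast
  finally have "{\<Prod>j\<in>F. X j :: 'a mpoly | F. F \<in> facets (\<Gamma> m t)} = monom_poly ` path_monoms m t" .
  then show ?thesis
    unfolding path_ideal_def facet_ideal_def
    using Idl_monomials[of "path_monoms m t" n] path_monoms_keys[OF _ assms(3)] by simp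
qed

lemma squarefree_add:
  assumes "squarefree_monom (a + b)"
  shows "squarefree_monom a" "squarefree_monom b" "keys a \<inter> keys b = {}"
proof -
  have "lookup a j + lookup b j \<le> 1" for j using assms by (simp add: squarefree_monom_def lookup_add)
  note * = this
  show "squarefree_monom a" "squarefree_monom b"
    unfolding squarefree_monom_def using * by (metis add_leE)+
  show "keys a \<inter> keys b = {}"
  proof (rule ccontr)
    assume "keys a \<inter> keys b \<noteq> {}"
    then obtain j where "lookup a j \<noteq> 0" "lookup b j \<noteq> 0" by (auto simp: in_keys_iff)
    with *[of j] show False by simp
  qed
qed

text \<open>\<open>packs\<close> lists its intervals from right to left, so a further disjoint
  interval has to be sorted into its place.\<close>

lemma packs_insert_interval:
  "packs t k m A \<Longrightarrow> 1 \<le> i \<Longrightarrow> i + t \<le> m + 1 \<Longrightarrow> A \<inter> {i..<i + t} = {} \<Longrightarrow> 1 \<le> t \<Longrightarrow>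
    packs t (Suc k) m (A \<union> {i..<i + t})"
proof (induction k arbitrary: m)
  case 0
  then show ?case by (auto intro!: exI[of _ i])
next
  case (Suc k)
  then obtain i' where i': "1 \<le> i'" "i' + t \<le> m + 1" "{i'..<i' + t} \<subseteq> A" "packs t k (i' - 1) A" by auto
  have "i' + t \<le> i \<or> i + t \<le> i'"
  proof (rule ccontr)
    assume "\<not> (i' + t \<le> i \<or> i + t \<le> i')"
    then have "max i i' \<in> {i'..<i' + t} \<inter> {i..<i + t}" by auto
    then show False using i'(3) Suc.prems(4) by blast
  qed
  then show ?case
  proof
    assume *: "i' + t \<le> i"
    have "packs t (Suc k) (i - 1) A" using i' * Suc.prems(2) by (auto intro!: exI[of _ i'])
    then have "packs t (Suc k) (i - 1) (A \<union> {i..<i + t})" by (rule packs_mono) auto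
    then show ?thesis using Suc.prems by (subst packs.simps(2)) (intro exI[of _ i], auto simp del: packs.simps)
  next
    assume *: "i + t \<le> i'"
    have "packs t (Suc k) (i' - 1) (A \<union> {i..<i + t})"
      using Suc.prems * i'(1) by (intro Suc.IH i'(4)) auto
    then show ?thesis using i' by (subst packs.simps(2)) (intro exI[of _ i'], auto simp del: packs.simps)
  qed
qed

text \<open>A product of interval monomials is squarefree only if the intervals are pairwise
  disjoint.\<close>

lemma squarefree_sums_packs:
  assumes t: "1 \<le> t"
  shows "g \<in> sums (path_monoms m t) k \<Longrightarrow> squarefree_monom g \<Longrightarrow> packs t k m (keys g)"
proof (induction k arbitrary: g)
  case (Suc k)
  then obtain a i where g: "g = a + smon {i..<i + t}" "a \<in> sums (path_monoms m t) k" "1 \<le> i" "i + t \<le> m + 1"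
    by (auto simp: msum_def path_monoms_def)
  note sq = squarefree_add[OF Suc.prems(2)[unfolded g(1)]]
  have "packs t (Suc k) m (keys a \<union> {i..<i + t})"
    using Suc.IH[OF g(2) sq(1)] g sq(3) t by (intro packs_insert_interval) auto
  then show ?case by (simp add: g(1) keys_plus_nat del: packs.simps)
qed simp

lemma packs_squarefree_sums:
  "packs t k m A \<Longrightarrow> m \<le> m' \<Longrightarrow>
    \<exists>g\<in>sums (path_monoms m' t) k. squarefree_monom g \<and> keys g \<subseteq> A \<inter> {1..m}"
proof (induction k arbitrary: m)
  case 0
  then show ?case by (simp add: squarefree_monom_def)
next
  case (Suc k)
  then obtain i where i: "1 \<le> i" "i + t \<le> m + 1" "{i..<i + t} \<subseteq> A" "packs t k (i - 1) A" by auto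
  then have "i - 1 \<le> m'" using Suc.prems by simp
  then obtain a where a: "a \<in> sums (path_monoms m' t) k" "squarefree_monom a" "keys a \<subseteq> A \<inter> {1..i - 1}"
    using Suc.IH[OF i(4)] by blast
  have "smon {i..<i + t} \<in> path_monoms m' t" using i Suc.prems(2) by (auto simp: path_monoms_def)
  then have "a + smon {i..<i + t} \<in> sums (path_monoms m' t) (Suc k)" using a(1) by (auto simp: msum_def)
  moreover have "squarefree_monom (a + smon {i..<i + t})"
    unfolding squarefree_monom_def
  proof
    fix j
    have "lookup a j = 0" if "j \<in> {i..<i + t}"
    proof -
      have "j \<notin> {1..i - 1}" using that by auto
      then have "j \<notin> keys a" using a(3) by blast
      then show ?thesis by (simp add: in_keys_iff)
    qed
    then show "lookup (a + smon {i..<i + t}) j \<le> 1"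
      using a(2) by (auto simp: squarefree_monom_def lookup_add lookup_smon)
  qed
  moreover have "keys (a + smon {i..<i + t}) \<subseteq> A \<inter> {1..m}"
    using a(3) i by (fastforce simp: keys_plus_nat)
  ultimately show ?case by blast
qed

lemma squarefree_dvd: "squarefree_monom g \<Longrightarrow> keys g \<subseteq> keys m \<Longrightarrow> monom_dvd g m"
  unfolding monom_dvd_def
proof
  fix j assume g: "squarefree_monom g" "keys g \<subseteq> keys m"
  show "lookup g j \<le> lookup m j"
  proof (cases "j \<in> keys g")
    case True
    then have "j \<in> keys m" using g(2) by blast
    then have "lookup m j \<noteq> 0" by (simp add: in_keys_iff)
    moreover have "lookup g j \<le> 1" using g(1) by (simp add: squarefree_monom_def)
    ultimately show ?thesis by simp
  qed (simp add: in_keys_iff)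
qed

lemma dvd_squarefree: "monom_dvd g m \<Longrightarrow> squarefree_monom m \<Longrightarrow> squarefree_monom g"
  unfolding squarefree_monom_def monom_dvd_def using order_trans by blast

lemma squarefree_smon: "finite A \<Longrightarrow> squarefree_monom (smon A)"
  by (simp add: squarefree_monom_def lookup_smon)

lemma path_ideal_eq_sqf:
  assumes "1 \<le> t" "t \<le> m" "m \<le> n"
  shows "path_ideal n m t = (sqf n {A. packs t (Suc 0) m A} :: 'a::field mpoly set)"
proof -
  have "(\<exists>g\<in>path_monoms m t. monom_dvd g a) \<longleftrightarrow> packs t (Suc 0) m (keys a)" for a
  proof
    assume "\<exists>g\<in>path_monoms m t. monom_dvd g a"
    then obtain i where "1 \<le> i" "i + t \<le> m + 1" "monom_dvd (smon {i..<i + t}) a"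
      by (auto simp: path_monoms_def)
    then show "packs t (Suc 0) m (keys a)" using monom_dvd_keys[of "smon {i..<i + t}" a] by auto
  next
    assume "packs t (Suc 0) m (keys a)"
    then obtain i where "1 \<le> i" "i + t \<le> m + 1" "{i..<i + t} \<subseteq> keys a" by auto
    then show "\<exists>g\<in>path_monoms m t. monom_dvd g a"
      by (intro bexI[of _ "smon {i..<i + t}"]) (auto simp: path_monoms_def intro!: squarefree_dvd squarefree_smon)
  qed
  then show ?thesis
    unfolding path_ideal_mideal[OF assms] mideal_def sqf_def by (simp del: packs.simps)
qed

text \<open>All products of \<open>k\<close> generators have degree \<open>k * t\<close>, so none
  properly divides another and every squarefree one is a minimal generator of the ordinary power.
  These squarefree products are the ones over disjoint intervals.\<close>

lemma squarefree_power_eq_sqf: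
  assumes t: "1 \<le> t" "t \<le> n"
  shows "squarefree_power n (path_ideal n n t) k = (sqf n {A. packs t k n A} :: 'a::field mpoly set)"
proof -
  let ?P = "sums (path_monoms n t) k"
  have Pk: "keys g \<subseteq> {1..n}" if "g \<in> ?P" for g
    using sums_keys[OF path_monoms_keys that] by auto
  have Pd: "total_degree g = k * t" if "g \<in> ?P" for g
    using that by (rule sums_degree[rotated]) (auto simp: path_monoms_def)
  have pow: "path_ideal n n t [^]\<^bsub>ideals_set (poly_ring n)\<^esub> k = (mideal n ?P :: 'a mpoly set)"
    unfolding path_ideal_mideal[OF t order_refl] by (intro ideal_power_mideal path_monoms_keys) auto
  define S where "S = {m \<in> min_monom_gens (mideal n ?P :: 'a mpoly set). squarefree_monom m}"
  have Sk: "keys m \<subseteq> {1..n}" if "m \<in> S" for m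
    using that by (simp add: S_def min_monom_gens_def monom_poly_in_mideal)
  have "(\<exists>g\<in>S. monom_dvd g m) \<longleftrightarrow> packs t k n (keys m)" if m: "keys m \<subseteq> {1..n}" for m
  proof
    assume "\<exists>g\<in>S. monom_dvd g m"
    then obtain g where g: "g \<in> S" "monom_dvd g m" by blast
    then obtain g' where g': "g' \<in> ?P" "monom_dvd g' g"
      by (auto simp: S_def min_monom_gens_def monom_poly_in_mideal)
    then have "squarefree_monom g'" using g by (auto simp: S_def intro: dvd_squarefree)
    then have "packs t k n (keys g')" by (rule squarefree_sums_packs[OF t(1) g'(1)])
    then show "packs t k n (keys m)"
      using monom_dvd_keys[OF monom_dvd_trans[OF g'(2) g(2)]] by (rule packs_mono[OF _ order_refl])
  next
    assume "packs t k n (keys m)"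
    then obtain g where g: "g \<in> ?P" "squarefree_monom g" "keys g \<subseteq> keys m"
      using packs_squarefree_sums[OF _ order_refl] by blast
    have "m' = g" if m': "monom_poly m' \<in> (mideal n ?P :: 'a mpoly set)" "monom_dvd m' g" for m'
    proof -
      obtain h where h: "h \<in> ?P" "monom_dvd h m'" using m'(1) by (auto simp: monom_poly_in_mideal)
      have "h = g"
        using monom_dvd_antisym_degree[OF monom_dvd_trans[OF h(2) m'(2)]] Pd h(1) g(1) by simp
      then have "total_degree g \<le> total_degree m'"
        using monom_dvd_diff[OF h(2)] total_degree_add[of "m' - h" h] by simp
      then show ?thesis by (rule monom_dvd_antisym_degree[OF m'(2)])
    qed
    moreover have "monom_poly g \<in> (mideal n ?P :: 'a mpoly set)"
      using g(1) Pk monom_dvd_refl by (auto simp: monom_poly_in_mideal)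
    ultimately have "g \<in> S" using g(2) by (simp add: S_def min_monom_gens_def)
    then show "\<exists>g\<in>S. monom_dvd g m" using squarefree_dvd[OF g(2,3)] by blast
  qed
  then have "(mideal n S :: 'a mpoly set) = sqf n {A. packs t k n A}"
    unfolding mideal_def sqf_def by (auto simp: polys_iff)
  then show ?thesis
    unfolding squarefree_power_def pow S_def[symmetric] by (simp only: Idl_monomials[OF Sk])
qed

section \<open>Matchings and induced matchings of the path\<close>

lemma matching_interval:
  assumes "1 \<le> t" "t \<le> m" "is_matching (\<Gamma> m t) M" "F \<in> M"
  shows "F = {Min F..<Min F + t}" "1 \<le> Min F" "Min F + t \<le> m + 1"
proof -
  obtain i where i: "F = {i..<i + t}" "1 \<le> i" "i + t \<le> m + 1"
    using assms by (auto simp: is_matching_def facets_path_complex)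
  then have "Min F = i" using assms(1) by (auto intro!: Min_eqI)
  then show "F = {Min F..<Min F + t}" "1 \<le> Min F" "Min F + t \<le> m + 1" using i by simp_all
qed

lemma finite_matchings:
  assumes "1 \<le> t" "t \<le> m"
  shows "finite {M. is_matching (\<Gamma> m t) M}"
proof (rule finite_subset)
  show "{M. is_matching (\<Gamma> m t) M} \<subseteq> Pow (facets (\<Gamma> m t))" by (auto simp: is_matching_def)
  have "facets (\<Gamma> m t) \<subseteq> (\<lambda>i. {i..<i + t}) ` {..m + 1}"
    unfolding facets_path_complex[OF assms] by auto
  then have "finite (facets (\<Gamma> m t))" by (rule finite_subset) simp
  then show "finite (Pow (facets (\<Gamma> m t)))" by simp
qed

text \<open>Edges may be enlarged by \<open>e\<close> before counting: the matching number takes the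
  edges themselves, the induced matching number each edge with the vertex after it.\<close>

lemma card_matching:
  assumes t: "1 \<le> t" "t \<le> m" and M: "is_matching (\<Gamma> m t) M"
    and F: "\<And>A. A \<in> M \<Longrightarrow> e A \<subseteq> {1..N} \<and> card (e A) = s"
    and disj: "\<And>A B. A \<in> M \<Longrightarrow> B \<in> M \<Longrightarrow> A \<noteq> B \<Longrightarrow> e A \<inter> e B = {}"
  shows "card M * s \<le> N"
proof -
  have "M \<subseteq> facets (\<Gamma> m t)" using M by (simp add: is_matching_def)
  moreover have "facets (\<Gamma> m t) \<subseteq> Pow {..m}"
    unfolding facets_path_complex[OF t] by auto
  ultimately have fM: "finite M" by (meson finite_Pow_iff finite_atMost finite_subset)
  have "card M * s = (\<Sum>A\<in>M. card (e A))" using F by simp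
  also have "\<dots> = card (\<Union>A\<in>M. e A)"
    using fM F disj by (intro card_UN_disjoint[symmetric] ballI impI) (auto dest: finite_subset)
  also have "\<dots> \<le> card {1..N}" using F by (intro card_mono) auto
  finally show ?thesis by simp
qed

lemma matching_number_le:
  assumes t: "1 \<le> t" "t \<le> m" and j: "j \<le> \<nu> (\<Gamma> m t)"
  shows "j * t \<le> m"
proof -
  have ne: "{card M | M. is_matching (\<Gamma> m t) M} \<noteq> {}"
    by (auto simp: is_matching_def intro!: exI[of _ "{}"])
  have "finite {card M | M. is_matching (\<Gamma> m t) M}"
    using finite_imageI[OF finite_matchings[OF t], of card] by (simp add: setcompr_eq_image)
  from Max_in[OF this ne] obtain M where M: "is_matching (\<Gamma> m t) M" "card M = \<nu> (\<Gamma> m t)"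
    by (auto simp: matching_number_def)
  have "card M * t \<le> m"
  proof (rule card_matching[OF t M(1), of "\<lambda>A. A"])
    show "A \<subseteq> {1..m} \<and> card A = t" if "A \<in> M" for A
      using matching_interval[OF t M(1) that] by (metis (no_types, lifting) add_diff_cancel_left' atLeastLessThan_iff
        atLeastAtMost_iff card_atLeastLessThan le_trans less_Suc_eq_le order_less_le_trans Suc_eq_plus1 subsetI)
  qed (use M(1) in \<open>auto simp: is_matching_def\<close>)
  moreover have "j * t \<le> card M * t" using j M(2) by (intro mult_le_mono1) simp
  ultimately show ?thesis by (rule le_trans[rotated])
qed

text \<open>Two edges of an induced matching cannot be adjacent, since their union would contain the
  first edge shifted by one; so each edge can be charged with the vertex after it. For
  \<open>t = 1\<close> the shifted edge is the second edge itself, and the formula fails once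
  \<open>m > 1\<close>.\<close>

lemma induced_matching_number_path:
  assumes t: "2 \<le> t" "t \<le> m"
  shows "\<nu>\<^sub>1 (\<Gamma> m t) = (m + 1) div (t + 1)"
proof -
  have t1: "1 \<le> t" using t by simp
  note fc = facets_path_complex[OF t1 t(2)]
  have upper: "card M \<le> (m + 1) div (t + 1)" if M: "is_induced_matching (\<Gamma> m t) M" for M
  proof -
    have mat: "is_matching (\<Gamma> m t) M" and ind: "{F \<in> facets (\<Gamma> m t). F \<subseteq> \<Union>M} = M"
      using M by (auto simp: is_induced_matching_def)
    have gap: "Min A + t < Min B" if AB: "A \<in> M" "B \<in> M" "Min A < Min B" for A B
    proof -
      define a b where "a = Min A" and "b = Min B"
      have A: "A = {a..<a + t}" "1 \<le> a" using matching_interval[OF t1 t(2) mat AB(1)] by (auto simp: a_def)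
      have B: "B = {b..<b + t}" "b + t \<le> m + 1" using matching_interval[OF t1 t(2) mat AB(2)] by (auto simp: b_def)
      have less: "a < b" using AB(3) by (simp add: a_def b_def)
      then have "a \<in> A" "b \<in> B" "a \<notin> B" unfolding A(1) B(1) using t1 by auto
      then have "A \<noteq> B" by blast
      then have "A \<inter> B = {}" using mat AB(1,2) unfolding is_matching_def by blast
      then have "b \<notin> A" using \<open>b \<in> B\<close> by blast
      then have ge: "a + t \<le> b" using less unfolding A(1) by simp
      have "b \<noteq> a + t"
      proof
        assume b: "b = a + t"
        have "{a + 1..<a + 1 + t} \<subseteq> A \<union> B" unfolding A(1) B(1) b by auto
        moreover have "{a + 1..<a + 1 + t} \<in> facets (\<Gamma> m t)" 
          unfolding fc using B(2) b t1 by (intro CollectI exI[of _ "a + 1"]) simp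
        ultimately have C: "{a + 1..<a + 1 + t} \<in> M" using ind AB by blast
        \<comment> \<open>The shifted edge meets \<open>A\<close> because \<open>2 \<le> t\<close>,
          yet it differs from \<open>A\<close>, contrary to disjointness.\<close>
        have "a + 1 \<in> A \<inter> {a + 1..<a + 1 + t}" unfolding A(1) using t by simp
        then have "A = {a + 1..<a + 1 + t}" using C mat AB unfolding is_matching_def by blast
        then show False using \<open>a \<in> A\<close> by auto
      qed
      with ge show ?thesis by (simp add: a_def b_def)
    qed
    \<comment> \<open>The vertex charged to the last edge may be \<open>m + 1\<close>, outside the
      path; hence \<open>m + 1\<close> on the right.\<close>
    have "card M * (t + 1) \<le> m + 1"
    proof (rule card_matching[OF t1 t(2) mat, of "\<lambda>A. {Min A..Min A + t}"])
      show "{Min A..Min A + t} \<subseteq> {1..m + 1} \<and> card {Min A..Min A + t} = t + 1" if "A \<in> M" for A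
        using matching_interval[OF t1 t(2) mat that] by auto
      show "{Min A..Min A + t} \<inter> {Min B..Min B + t} = {}" if "A \<in> M" "B \<in> M" "A \<noteq> B" for A B
      proof -
        have "Min A \<noteq> Min B"
          using matching_interval(1)[OF t1 t(2) mat] that by metis
        then show ?thesis using gap[of A B] gap[of B A] that by (cases "Min A < Min B") auto
      qed
    qed
    then show ?thesis using less_eq_div_iff_mult_less_eq[of "t + 1" "card M" "m + 1"] by simp
  qed
  define v where "v = (m + 1) div (t + 1)"
  define B where "B j = {j * (t + 1) + 1..<j * (t + 1) + 1 + t}" for j
  define M where "M = B ` {..<v}"
  have vm: "j * (t + 1) + 1 + t \<le> m + 1" if "j < v" for j
  proof -
    have "Suc j * (t + 1) \<le> v * (t + 1)" using that by (intro mult_le_mono1) simp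
    also have "\<dots> \<le> m + 1" unfolding v_def by (rule div_times_less_eq_dividend)
    finally show ?thesis by simp
  qed
  have step: "i * (t + 1) + (t + 1) \<le> j * (t + 1)" if "i < j" for i j
  proof -
    have "Suc i * (t + 1) \<le> j * (t + 1)" using that by (intro mult_le_mono1) simp
    then show ?thesis by simp
  qed
  have B_less: "x + 1 < y" if "x \<in> B i" "y \<in> B j" "i < j" for x y i j
    using that step[OF that(3)] by (auto simp: B_def)
  have disj: "B i \<inter> B j = {}" if "i \<noteq> j" for i j
  proof (rule ccontr)
    assume "B i \<inter> B j \<noteq> {}"
    then obtain x where x: "x \<in> B i" "x \<in> B j" by blast
    show False using B_less[OF x] B_less[OF x(2,1)] \<open>i \<noteq> j\<close> by (cases "i < j") auto
  qed
  have Bne: "j * (t + 1) + 1 \<in> B j" for j using t by (auto simp: B_def)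
  have "inj_on B {..<v}"
  proof (rule inj_onI, rule ccontr)
    fix i j assume "B i = B j" "i \<noteq> j"
    then show False using disj[of i j] Bne[of i] by auto
  qed
  then have cardM: "card M = v" by (simp add: M_def card_image)
  have BF: "B j \<in> facets (\<Gamma> m t)" if "j < v" for j
    unfolding fc B_def using vm[OF that] by (intro CollectI exI[of _ "j * (t + 1) + 1"]) simp
  have "is_matching (\<Gamma> m t) M"
    unfolding is_matching_def M_def
  proof (intro conjI ballI impI)
    fix E F assume "E \<in> B ` {..<v}" "F \<in> B ` {..<v}" "E \<noteq> F"
    then obtain i j where "E = B i" "F = B j" "i \<noteq> j" by blast
    then show "E \<inter> F = {}" using disj by simp
  qed (use BF in blast)
  moreover have "F \<in> M" if F: "F \<in> facets (\<Gamma> m t)" "F \<subseteq> \<Union>M" for F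
  proof -
    obtain s where s: "F = {s..<s + t}" using F(1) by (auto simp: fc)
    have "s \<in> F" using t by (simp add: s)
    then have "s \<in> \<Union>M" using F(2) by blast
    then obtain j where j: "j < v" "s \<in> B j" unfolding M_def by blast
    have "s = j * (t + 1) + 1"
    proof (rule ccontr)
      assume "s \<noteq> j * (t + 1) + 1"
      \<comment> \<open>An edge that starts later in block \<open>j\<close> reaches the separator
        after that block, which no block covers.\<close>
      let ?y = "j * (t + 1) + 1 + t"
      have y: "?y \<in> F" using j(2) \<open>s \<noteq> _\<close> by (auto simp: s B_def)
      then have "?y \<in> \<Union>M" using F(2) by blast
      then obtain i where i: "?y \<in> B i" unfolding M_def by blast
      have last: "j * (t + 1) + t \<in> B j" using t by (auto simp: B_def)
      have "i \<noteq> j" using i by (auto simp: B_def)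
      then show False using B_less[OF last i] B_less[OF i last] by (cases "j < i") auto
    qed
    then show ?thesis using j s by (auto simp: M_def B_def)
  qed
  ultimately have ind: "is_induced_matching (\<Gamma> m t) M"
    unfolding is_induced_matching_def by (auto simp: is_matching_def)
  have "finite {card M | M. is_induced_matching (\<Gamma> m t) M}"
  proof (rule finite_subset)
    show "{card M | M. is_induced_matching (\<Gamma> m t) M} \<subseteq> {..(m + 1) div (t + 1)}"
      using upper unfolding atMost_def by blast
  qed simp
  then show ?thesis
    unfolding induced_matching_number_def
  proof (rule Max_eqI)
    show "(m + 1) div (t + 1) \<in> {card M | M. is_induced_matching (\<Gamma> m t) M}"
      using ind cardM unfolding v_def by (intro CollectI exI[of _ M]) simp
  qed (use upper in blast)
qed

lemma reg_quot_packs: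
  assumes t: "1 \<le> t" and m: "Suc k * t \<le> m" "m \<le> n"
  shows "reg_quot n (sqf n {A. packs t (Suc k) m A} :: 'a::field mpoly set)
    = int (k * t + (t - 1) * \<nu>\<^sub>1 (\<Gamma> (m - k * t) t))"
proof -
  have "reg_le n (sqf n {A. packs t (Suc k) m A} :: 'a mpoly set) (int (k * t) + reg_path t (m - k * t))"
    using reg_le_packs[OF t m(2), of k] m(1) by simp
  moreover obtain i where "\<not> hacyc n (sqf n {A. packs t (Suc k) m A} :: 'a mpoly set) i
      (int i + (int (k * t) + reg_path t (m - k * t)))"
    using not_acyc_packs[OF t m] by blast
  moreover have "{} \<notin> {A. packs t (Suc k) m A}" using t by auto
  ultimately have "reg_quot n (sqf n {A. packs t (Suc k) m A} :: 'a mpoly set) = int (k * t) + reg_path t (m - k * t)"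
    by (intro reg_quot_sqf upclosed_packs)
  moreover have "reg_path t (m - k * t) = int ((t - 1) * \<nu>\<^sub>1 (\<Gamma> (m - k * t) t))"
  \<comment> \<open>For \<open>t = 1\<close> the induced matching number need not be the quotient in
    \<open>reg_path\<close>, but both sides carry the factor \<open>t - 1 = 0\<close>.\<close>
  proof (cases "t = 1")
    case False
    then show ?thesis using t m induced_matching_number_path[of t "m - k * t"] by (simp add: reg_path_def)
  qed (simp add: reg_path_def)
  ultimately show ?thesis by simp
qed

theorem theorem4p9:
  fixes n t k :: nat
  assumes "1 \<le> t" and "t \<le> n"
    and "1 \<le> k + 1" and "k + 1 \<le> \<nu> (\<Gamma> n t)"
  shows "reg_quot n (squarefree_power n (path_ideal n n t :: 'a::field mpoly set) (k + 1)) =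
           int (k * t + (t - 1) * \<nu>\<^sub>1 (\<Gamma> (n - k * t) t)) \<and>
         int (k * t + (t - 1) * \<nu>\<^sub>1 (\<Gamma> (n - k * t) t)) =
           int (k * t) + reg_quot n (path_ideal n (n - k * t) t :: 'a mpoly set)"
proof -
  \<comment> \<open>The bound on the matching number enters as room for \<open>k + 1\<close>
    disjoint intervals.\<close>
  have n: "Suc k * t \<le> n" using matching_number_le[OF assms(1,2,4)] by simp
  have "reg_quot n (squarefree_power n (path_ideal n n t :: 'a mpoly set) (k + 1)) =
      int (k * t + (t - 1) * \<nu>\<^sub>1 (\<Gamma> (n - k * t) t))"
    unfolding squarefree_power_eq_sqf[OF assms(1,2)] Suc_eq_plus1[symmetric]
    by (rule reg_quot_packs[OF assms(1) n order_refl])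
  \<comment> \<open>The path ideal on \<open>n - k * t\<close> vertices is the case of a single
    interval, so the same formula applies to it.\<close>
  moreover have "reg_quot n (path_ideal n (n - k * t) t :: 'a mpoly set) =
      int ((t - 1) * \<nu>\<^sub>1 (\<Gamma> (n - k * t) t))"
    using reg_quot_packs[of t 0 "n - k * t" n, where ?'a = 'a] assms(1) n
      path_ideal_eq_sqf[of t "n - k * t" n, where ?'a = 'a] by simp
  ultimately show ?thesis by simp
qed

end
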